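(* Suppose that for every element $\Omega_k$ there is a bijective, time-invariant polynomial mapping from $\hat\Omega$ onto $\Omega_k$ of degree $p_{\rm map}\le p+1$, that volume and facet quadrature rules exist such that degree-$p$ diagonal-norm SBP operators exist on the reference element, that the metric terms are evaluated exactly, and that the coefficient matrices $T^{(1)}_{ak},T^{(2)}_{ak},T^{(3)}_{ak},T^{(4)}_{ak},T^{(D)}_a$ are symmetric with $T^{(5)}_{abk}=(T^{(5)}_{bak})^T$ and $T^{(6)}_{abk}=(T^{(6)}_{bak})^T$ for every element $\Omega_k$ and facets $a,b$. Then the SBP-SAT discretization and the discrete functional $I_h$ are adjoint consistent with respect to the steady diffusion problem and the functional $\mathcal I$, i.e. $$\lim_{h\to0}\sum_{k}\|L^*_{h,k}(\psi)-g_k\|_{H_k}=0,\qquad\text{and}\qquad\|L^*_{h,k}(\psi)-g_k\|_\infty=\mathcal O(h^{p-1}),$$ if the exact adjoint satisfies $\psi_k\in\mathcal C^{p+1}(\Omega_k)$ and the coefficient matrices satisfy $$T^{(1)}_{\gamma k}=T^{(1)}_{\gamma v},\quad T^{(2)}_{\gamma k}+T^{(2)}_{\gamma v}=-B_\gamma,\quad T^{(3)}_{\gamma k}+T^{(3)}_{\gamma v}=B_\gamma,\quad T^{(4)}_{\gamma k}=T^{(4)}_{\gamma v},\quad T^{(5)}_{abk}=-T^{(6)}_{abk},$$ where $a,b\in\{\gamma,\epsilon_1,\epsilon_2\}$ are (distinct) interior facets of $\Omega_k$.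
   Context: **Problem.** $\Omega\subset\mathbb R^2$ is compact with piecewise smooth boundary $\Gamma^D\cup\Gamma^N$ ($\Gamma^D\neq\emptyset$), $\lambda$ is a symmetric positive definite (SPD) $2\times2$ tensor field. Primal: $-\nabla\cdot(\lambda\nabla\mathcal U)=\mathcal F$ in $\Omega$, $\mathcal U=\mathcal U_D$ on $\Gamma^D$, $(\lambda\nabla\mathcal U)\cdot n=\mathcal U_N$ on $\Gamma^N$. Functional: $\mathcal I(\mathcal U)=\int_\Omega\mathcal G\,\mathcal U\,d\Omega-\int_{\Gamma^D}\psi_D(\lambda\nabla\mathcal U)\cdot n\,d\Gamma+\int_{\Gamma^N}\psi_N\,\mathcal U\,d\Gamma$. Adjoint: $-\nabla\cdot(\lambda\nabla\psi)=\mathcal G$ in $\Omega$, $\psi=\psi_D$ on $\Gamma^D$, $(\lambda\nabla\psi)\cdot n=\psi_N$ on $\Gamma^N$. **Mesh.** $\Omega$ is partitioned into non-overlapping (possibly curved) triangles $\Omega_k$, $h$ is the element diameter. $\Gamma_k$ denotes the facets (edges) of $\Omega_k$, $\Gamma_k^I$ those that are interior. For an interior facet $\gamma$ of $\Omega_k$, $\Omega_v$ is the neighbour across $\gamma$; $\epsilon\in\{\epsilon_1,\epsilon_2\}$ runs over the other interior facets of $\Omega_k$ (neighbour $\Omega_g$) and $\delta$ over the other interior facets of $\Omega_v$ (neighbour $\Omega_q$). **Reference SBP operators.** $\hat\Omega$ is the triangle with vertices $(-1,-1),(1,-1),(-1,1)$. A degree-$p$ diagonal-norm SBP operator on nodes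 $\{(\xi_i,\eta_i)\}_{i=1}^{n_p}$ is $\hat D_\xi=\hat H^{-1}\hat Q_\xi$ where $\hat D_\xi$ is exact at the nodes for polynomials of total degree $\le p$; $\hat H$ is diagonal SPD (a quadrature of degree at least $2p-1$); $\hat Q_\xi=\hat S_\xi+\frac12\hat E_\xi$ with $\hat S_\xi$ skew-symmetric, $\hat E_\xi$ symmetric and $\mathbf p^T\hat E_\xi\mathbf q=\int_{\hat\Gamma}\mathcal P\mathcal Q\,\hat n_\xi\,d\Gamma$ for polynomials of degree $\le r$, some $r\ge p$. Similarly for $\eta$. Moreover $\hat E_\xi=\sum_\gamma R_\gamma^T\hat B_\gamma\hat N_{\xi\gamma}R_\gamma$, where $\hat B_\gamma$ is diagonal with the positive weights of the Legendre–Gauss rule of degree $2p+1$ at the $n_f$ facet nodes, $\hat N_{\xi\gamma}$ is diagonal holding $\hat n_\xi$, and $R_\gamma\in\mathbb R^{n_f\times n_p}$ extrapolates from volume to facet nodes exactly for polynomials of degree $\le p$. **Physical operators.** Metric terms ($x_\xi$, etc.) are computed exactly from the polynomial mapping. $J_k$ is the diagonal matrix of $|x_\xi y_\eta-x_\eta y_\xi|$ at volume nodes, $J_{f_\gamma}$ the diagonal matrix of the facet arc-length scaling factor at facet nodes; $H_k=J_k\hat H$, $B_\gamma=J_{f_\gamma}\hat B_\gamma$, $R_{\gamma k}=R_\gamma$; $N_{x\gamma k},N_{y\gamma k}$ are diagonal matrices of the components of the outward unit normal at facet nodes; $E_{xk}=\sum_{\gamma\subset\Gamma_k}R_{\gamma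 k}^TB_\gamma N_{x\gamma k}R_{\gamma k}$, $E_{yk}$ analogous; with metrics at volume nodes, $S_{xk}=\frac12(\mathrm{diag}(y_\eta)\hat Q_\xi-\hat Q_\xi^T\mathrm{diag}(y_\eta))+\frac12(-\mathrm{diag}(y_\xi)\hat Q_\eta+\hat Q_\eta^T\mathrm{diag}(y_\xi))$, $S_{yk}=\frac12(-\mathrm{diag}(x_\eta)\hat Q_\xi+\hat Q_\xi^T\mathrm{diag}(x_\eta))+\frac12(\mathrm{diag}(x_\xi)\hat Q_\eta-\hat Q_\eta^T\mathrm{diag}(x_\xi))$; $D_{xk}=H_k^{-1}(S_{xk}+\frac12E_{xk})$, $D_{yk}=H_k^{-1}(S_{yk}+\frac12E_{yk})$. $\Lambda_k$ is the $2\times2$ block matrix with diagonal blocks holding the entries of $\lambda$ at the volume nodes. $D^{(2)}_k=[D_{xk}\; D_{yk}]\Lambda_k\begin{bmatrix}D_{xk}\\ D_{yk}\end{bmatrix}$ and $D_{\gamma k}=[N_{x\gamma k}R_{\gamma k}\;\; N_{y\gamma k}R_{\gamma k}]\Lambda_k\begin{bmatrix}D_{xk}\\ D_{yk}\end{bmatrix}$. Known fact available: under the mapping assumption $D_{xk},D_{yk}$ are order $p$ accurate at the nodes for $\mathcal C^{p+1}$ functions. **Discretization.** With $n_f\times n_f$ coefficient matrices $T$, the steady discrete problem is $L_{h,k}(u_h)=f_k$, $L_{h,k}(u)=-D_k^{(2)}u_k+H_k^{-1}s^I_k+H_k^{-1}s^B_k$, $$s_k^I=\sum_{\gamma\subset\Gamma_k^I}[R_{\gamma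 k}^T\; D_{\gamma k}^T]\begin{bmatrix}T^{(1)}_{\gamma k}&T^{(3)}_{\gamma k}\\ T^{(2)}_{\gamma k}&T^{(4)}_{\gamma k}\end{bmatrix}\begin{bmatrix}R_{\gamma k}u_k-R_{\gamma v}u_v\\ D_{\gamma k}u_k+D_{\gamma v}u_v\end{bmatrix}+\sum_{\gamma\subset\Gamma_k^I}\Big\{\sum_{\epsilon}R_{\gamma k}^TT^{(5)}_{\gamma\epsilon k}[R_{\epsilon k}u_k-R_{\epsilon g}u_g]+\sum_{\delta}R_{\gamma k}^TT^{(6)}_{\gamma\delta v}[R_{\delta v}u_v-R_{\delta q}u_q]\Big\},$$ $$s_k^B=\sum_{\gamma\subset\Gamma^D\cap\Gamma_k}[R_{\gamma k}^T\; D_{\gamma k}^T]\begin{bmatrix}T_\gamma^{(D)}\\ -B_\gamma\end{bmatrix}(R_{\gamma k}u_k-u_{\gamma k})+\sum_{\gamma\subset\Gamma^N\cap\Gamma_k}R_{\gamma k}^TB_\gamma(D_{\gamma k}u_k-w_{\gamma k}),$$ with $f_k$ the nodal values of $\mathcal F$ and $u_{\gamma k},w_{\gamma k}$ the restrictions of $\mathcal U$, $n\cdot(\lambda\nabla\mathcal U)$ to the facet nodes. The discrete functional is $$I_h(u_h)=\sum_kg_k^TH_ku_{h,k}-\sum_{\gamma\subset\Gamma^D}\psi_{\gamma k}^TB_\gamma D_{\gamma k}u_{h,k}+\sum_{\gamma\subset\Gamma^N}z_{\gamma k}^TB_\gamma R_{\gamma k}u_{h,k}+\sum_{\gamma\subset\Gamma^D}\psi_{\gamma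 k}^TT_\gamma^{(D)}(R_{\gamma k}u_{h,k}-u_{\gamma k}),$$ with $g_k$ the nodal values of $\mathcal G$ and $\psi_{\gamma k},z_{\gamma k}$ the restrictions of $\psi$, $n\cdot(\lambda\nabla\psi)$ to the facet nodes. **Discrete adjoint operator** (obtained by requiring that $I_h(u_h)$ coincide with the analogous discretization of $\int_\Omega\mathcal F\psi-\int_{\Gamma^D}\mathcal U_D(\lambda\nabla\psi)\cdot n+\int_{\Gamma^N}\mathcal U_N\psi$): $L^*_{h,k}(\psi)=-D_k^{(2)}\psi_k+H_k^{-1}(s_k^I)^*+H_k^{-1}(s_k^B)^*$, where $(s^B_k)^*$ is $s_k^B$ with $(u_k,u_{\gamma k},w_{\gamma k})$ replaced by $(\psi_k,\psi_{\gamma k},z_{\gamma k})$ and $$(s_k^I)^*=\sum_{\gamma\subset\Gamma_k^I}[R_{\gamma k}^T\; D_{\gamma k}^T]\begin{bmatrix}T^{(1)}_{\gamma k}&-T^{(1)}_{\gamma v}&T^{(2)}_{\gamma k}+B_\gamma&-T^{(2)}_{\gamma v}\\ T^{(3)}_{\gamma k}-B_\gamma&T^{(3)}_{\gamma v}&T^{(4)}_{\gamma k}&T^{(4)}_{\gamma v}\end{bmatrix}\begin{bmatrix}R_{\gamma k}\psi_k\\ R_{\gamma v}\psi_v\\ D_{\gamma k}\psi_k\\ D_{\gamma v}\psi_v\end{bmatrix}+\sum_{\gamma\subset\Gamma_k^I}\Big\{\sum_\epsilon R_{\gamma k}^T[T^{(5)}_{\gamma\epsilon k}R_{\epsilon k}\psi_k+T^{(6)}_{\gamma\epsilon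 k}R_{\epsilon g}\psi_g]-\sum_\delta R_{\gamma k}^T[T^{(5)}_{\gamma\delta v}R_{\delta v}\psi_v+T^{(6)}_{\gamma\delta v}R_{\delta q}\psi_q]\Big\}.$$ In $L^*_{h,k}(\psi)$, $\psi_k$ denotes the nodal values of the exact adjoint; $\|w\|_{H_k}^2=w^TH_kw$.
   Formalization: The summed limit is false for p=1,2: it is stated for p≥3, with the root-sum-of-squares limit for p≥2. Added: shape-regular meshes, positive Jacobians, λ in C^p on each element, and scaled coefficients (T1,T5,T6,TD=O(1), T2,T3=O(h), T4=O(h²)). *)

theory Defs
  imports "HOL-Analysis.Analysis"
begin

section \<open>Calculus on plane sets\<close>

definition poly2 :: "nat \<Rightarrow> (real^2 \<Rightarrow> real) set" where
  "poly2 d = {f. \<exists>c :: nat \<Rightarrow> nat \<Rightarrow> real.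
     \<forall>z. f z = (\<Sum>i\<le>d. \<Sum>j\<le>d - i. c i j * (z $ 1) ^ i * (z $ 2) ^ j)}"

definition pd :: "2 \<Rightarrow> (real^2 \<Rightarrow> real) \<Rightarrow> real^2 \<Rightarrow> real" where
  "pd i f z = frechet_derivative f (at z) (axis i 1)"

text \<open>\<open>C\<^sup>m\<close> on a closed set: all derivatives up to order \<open>m\<close> exist (one-sided on the boundary) and
  are continuous up to the boundary.\<close>

fun Ck_on :: "nat \<Rightarrow> (real^2) set \<Rightarrow> (real^2 \<Rightarrow> real) \<Rightarrow> bool" where
  "Ck_on 0 K f = continuous_on K f"
| "Ck_on (Suc m) K f = (\<exists>fx fy.
     (\<forall>z\<in>K. (f has_derivative (\<lambda>v. fx z * v $ 1 + fy z * v $ 2)) (at z within K)) \<and>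
     Ck_on m K fx \<and> Ck_on m K fy)"

definition grad_in :: "(real^2) set \<Rightarrow> (real^2 \<Rightarrow> real) \<Rightarrow> real^2 \<Rightarrow> real^2" where
  "grad_in \<Omega> f x = (\<chi> i. frechet_derivative f (at x within \<Omega>) (axis i 1))"

definition div_in :: "(real^2) set \<Rightarrow> (real^2 \<Rightarrow> real^2) \<Rightarrow> real^2 \<Rightarrow> real" where
  "div_in \<Omega> q x = (\<Sum>i\<in>UNIV. frechet_derivative q (at x within \<Omega>) (axis i 1) $ i)"

section \<open>The boundary value problem\<close>

text \<open>\<open>\<nu>\<close> is the outward unit normal of \<open>\<Omega>\<close> at \<open>x\<close>: blowing up \<open>\<Omega>\<close> at \<open>x\<close> yields the half plane
  \<open>v \<bullet> \<nu> \<le> 0\<close>. It is unique where it exists, which excludes the corners.\<close>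

definition outer_normal :: "(real^2) set \<Rightarrow> real^2 \<Rightarrow> real^2 \<Rightarrow> bool" where
  "outer_normal \<Omega> x \<nu> \<longleftrightarrow> norm \<nu> = 1 \<and>
     (\<forall>e>0. \<exists>r>0. \<forall>y. 0 < dist y x \<and> dist y x < r \<longrightarrow>
        ((y - x) \<bullet> \<nu> < - e * norm (y - x) \<longrightarrow> y \<in> \<Omega>) \<and>
        ((y - x) \<bullet> \<nu> > e * norm (y - x) \<longrightarrow> y \<notin> \<Omega>))"

definition spd_tensor :: "(real^2) set \<Rightarrow> (real^2 \<Rightarrow> real^2^2) \<Rightarrow> bool" where
  "spd_tensor \<Omega> lam \<longleftrightarrow>
     (\<forall>x\<in>\<Omega>. transpose (lam x) = lam x \<and> (\<forall>v. v \<noteq> 0 \<longrightarrow> v \<bullet> (lam x *v v) > 0))"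

text \<open>The classical diffusion problem with source \<open>G\<close>, Dirichlet data \<open>gD\<close> and Neumann data \<open>gN\<close>.
  \<open>\<Omega>\<close> is compact, so the derivatives are those within \<open>\<Omega>\<close>.\<close>

definition solves_diffusion ::
  "(real^2) set \<Rightarrow> (real^2) set \<Rightarrow> (real^2) set \<Rightarrow> (real^2 \<Rightarrow> real^2^2) \<Rightarrow>
   (real^2 \<Rightarrow> real) \<Rightarrow> (real^2 \<Rightarrow> real) \<Rightarrow> (real^2 \<Rightarrow> real) \<Rightarrow> (real^2 \<Rightarrow> real) \<Rightarrow> bool" where
  "solves_diffusion \<Omega> \<Gamma>D \<Gamma>N lam G gD gN u \<longleftrightarrow>
     (let q = (\<lambda>x. lam x *v grad_in \<Omega> u x) in
       (\<forall>x\<in>\<Omega>. u differentiable (at x within \<Omega>) \<and> q differentiable (at x within \<Omega>) \<and>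
          - div_in \<Omega> q x = G x) \<and>
       (\<forall>x\<in>\<Gamma>D. u x = gD x) \<and>
       (\<forall>x\<in>\<Gamma>N. \<forall>\<nu>. outer_normal \<Omega> x \<nu> \<longrightarrow> q x \<bullet> \<nu> = gN x))"

section \<open>Reference triangle and reference SBP operators\<close>

definition vert :: "3 \<Rightarrow> real^2" where
  "vert i = (if i = 0 then vector [-1, -1] else if i = 1 then vector [1, -1] else vector [-1, 1])"

definition ref_tri :: "(real^2) set" where
  "ref_tri = convex hull (range vert)"

text \<open>Facet \<open>a\<close> runs counterclockwise from vertex \<open>a\<close> to vertex \<open>a + 1\<close> (modulo 3); \<open>facet_pt a\<close>
  parametrizes it over \<open>[-1, 1]\<close>.\<close>

definition facet_pt :: "3 \<Rightarrow> real \<Rightarrow> real^2" where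
  "facet_pt a t = ((1 - t) / 2) *\<^sub>R vert a + ((1 + t) / 2) *\<^sub>R vert (a + 1)"

definition facet_len :: "3 \<Rightarrow> real" where
  "facet_len a = norm (vert (a + 1) - vert a)"

definition facet_tan :: "3 \<Rightarrow> real^2" where
  "facet_tan a = (1 / facet_len a) *\<^sub>R (vert (a + 1) - vert a)"

definition rot_cw :: "real^2 \<Rightarrow> real^2" where
  "rot_cw v = vector [v $ 2, - (v $ 1)]"

definition ref_normal :: "3 \<Rightarrow> real^2" where
  "ref_normal a = rot_cw (facet_tan a)"

definition ref_facet_integral :: "3 \<Rightarrow> (real^2 \<Rightarrow> real) \<Rightarrow> real" where
  "ref_facet_integral a f = integral {-1..1} (\<lambda>t. f (facet_pt a t) * (facet_len a / 2))"

definition diag :: "('a::finite \<Rightarrow> real) \<Rightarrow> real^'a^'a" where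
  "diag v = (\<chi> i j. if i = j then v i else 0)"

text \<open>\<open>fpos\<close> and \<open>fwt\<close> hold the nodes and weights on \<open>[-1, 1]\<close> of the facet quadrature rule;
  \<open>Rref S a\<close> extrapolates to the points \<open>facet_pt a (fpos S i)\<close>. \<open>Qref S 1\<close> and \<open>Qref S 2\<close>
  are the operators for the two reference directions.\<close>

record ('n::finite, 'f::finite) sbp =
  vnode :: "'n \<Rightarrow> real^2"
  vwt :: "'n \<Rightarrow> real"
  Qref :: "2 \<Rightarrow> real^'n^'n"
  fpos :: "'f \<Rightarrow> real"
  fwt :: "'f \<Rightarrow> real"
  Rref :: "3 \<Rightarrow> real^'n^'f"

definition ref_nodal :: "('n::finite, 'f::finite) sbp \<Rightarrow> (real^2 \<Rightarrow> real) \<Rightarrow> real^'n" where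
  "ref_nodal S f = (\<chi> i. f (vnode S i))"

definition Href :: "('n::finite, 'f::finite) sbp \<Rightarrow> real^'n^'n" where
  "Href S = diag (vwt S)"

definition Bref :: "('n::finite, 'f::finite) sbp \<Rightarrow> 3 \<Rightarrow> real^'f^'f" where
  "Bref S a = diag (\<lambda>i. fwt S i * (facet_len a / 2))"

definition Eref :: "('n::finite, 'f::finite) sbp \<Rightarrow> 2 \<Rightarrow> real^'n^'n" where
  "Eref S i = (\<Sum>a\<in>UNIV. transpose (Rref S a) ** Bref S a ** diag (\<lambda>_. ref_normal a $ i) ** Rref S a)"

text \<open>The Legendre-Gauss rule of degree \<open>2 * p + 1\<close> is the rule with \<open>p + 1\<close> nodes that is exact to
  that degree. Positivity and symmetry are consequences of this.\<close>

definition legendre_gauss :: "nat \<Rightarrow> ('f::finite \<Rightarrow> real) \<Rightarrow> ('f \<Rightarrow> real) \<Rightarrow> bool" where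
  "legendre_gauss p t w \<longleftrightarrow>
     CARD('f) = p + 1 \<and> inj t \<and>
     (\<forall>m\<le>2 * p + 1. (\<Sum>i\<in>UNIV. w i * t i ^ m) = integral {-1..1} (\<lambda>s. s ^ m)) \<and>
     (\<forall>i. -1 < t i \<and> t i < 1 \<and> 0 < w i) \<and>
     (\<forall>i. \<exists>j. t j = - t i \<and> w j = w i)"

definition sbp_operator :: "nat \<Rightarrow> ('n::finite, 'f::finite) sbp \<Rightarrow> bool" where
  "sbp_operator p S \<longleftrightarrow>
     inj (vnode S) \<and> (\<forall>i. vnode S i \<in> ref_tri) \<and>
     (\<forall>i. 0 < vwt S i) \<and>
     (\<forall>f\<in>poly2 (2 * p - 1). (\<Sum>i\<in>UNIV. vwt S i * f (vnode S i)) = integral ref_tri f) \<and>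
     legendre_gauss p (fpos S) (fwt S) \<and>
     (\<forall>a. \<forall>f\<in>poly2 p. Rref S a *v ref_nodal S f = (\<chi> i. f (facet_pt a (fpos S i)))) \<and>
     (\<forall>d. \<forall>f\<in>poly2 p. matrix_inv (Href S) ** Qref S d *v ref_nodal S f = ref_nodal S (pd d f)) \<and>
     (\<forall>d. transpose (Qref S d - (1/2) *\<^sub>R Eref S d) = - (Qref S d - (1/2) *\<^sub>R Eref S d)) \<and>
     (\<forall>d. transpose (Eref S d) = Eref S d) \<and>
     (\<exists>r\<ge>p. \<forall>d. \<forall>f\<in>poly2 r. \<forall>g\<in>poly2 r. ref_nodal S f \<bullet> (Eref S d *v ref_nodal S g) =
        (\<Sum>a\<in>UNIV. ref_facet_integral a (\<lambda>z. f z * g z * ref_normal a $ d)))"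

section \<open>Meshes\<close>

datatype facet_link = Interior (adj_elem: nat) (adj_facet: 3) | Dirichlet | Neumann

text \<open>\<open>link M k a = Interior v b\<close> means that facet \<open>a\<close> of element \<open>k\<close> is facet \<open>b\<close> of element \<open>v\<close>.\<close>

record mesh =
  elems :: "nat set"
  emap :: "nat \<Rightarrow> real^2 \<Rightarrow> real^2"
  link :: "nat \<Rightarrow> 3 \<Rightarrow> facet_link"

definition elem :: "mesh \<Rightarrow> nat \<Rightarrow> (real^2) set" where
  "elem M k = emap M k ` ref_tri"

definition facet_set :: "mesh \<Rightarrow> nat \<Rightarrow> 3 \<Rightarrow> (real^2) set" where
  "facet_set M k a = emap M k ` facet_pt a ` {-1..1}"

definition int_facets :: "mesh \<Rightarrow> nat \<Rightarrow> 3 set" where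
  "int_facets M k = {a. is_Interior (link M k a)}"

definition dir_facets :: "mesh \<Rightarrow> nat \<Rightarrow> 3 set" where
  "dir_facets M k = {a. link M k a = Dirichlet}"

definition neu_facets :: "mesh \<Rightarrow> nat \<Rightarrow> 3 set" where
  "neu_facets M k = {a. link M k a = Neumann}"

definition nbe :: "mesh \<Rightarrow> nat \<Rightarrow> 3 \<Rightarrow> nat" where
  "nbe M k a = adj_elem (link M k a)"

definition nbf :: "mesh \<Rightarrow> nat \<Rightarrow> 3 \<Rightarrow> 3" where
  "nbf M k a = adj_facet (link M k a)"

text \<open>\<open>metric_term M k c d\<close> is the derivative of the physical coordinate \<open>c\<close> in the reference direction
  \<open>d\<close>: \<open>metric_term M k 1 2\<close> is \<open>x\<^sub>\<eta>\<close>, \<open>metric_term M k 2 1\<close> is \<open>y\<^sub>\<xi>\<close>, and so on.\<close>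

definition metric_term :: "mesh \<Rightarrow> nat \<Rightarrow> 2 \<Rightarrow> 2 \<Rightarrow> real^2 \<Rightarrow> real" where
  "metric_term M k c d = pd d (\<lambda>z. emap M k z $ c)"

definition jac :: "mesh \<Rightarrow> nat \<Rightarrow> real^2 \<Rightarrow> real" where
  "jac M k z =
     metric_term M k 1 1 z * metric_term M k 2 2 z - metric_term M k 1 2 z * metric_term M k 2 1 z"

text \<open>The maps preserve orientation: the formulas for the physical operators below carry no sign of
  the Jacobian. Hence the two neighbours of an interior facet traverse it in opposite directions.\<close>

definition is_mesh ::
  "nat \<Rightarrow> (real^2) set \<Rightarrow> (real^2) set \<Rightarrow> (real^2) set \<Rightarrow> mesh \<Rightarrow> bool" where
  "is_mesh pmap \<Omega> \<Gamma>D \<Gamma>N M \<longleftrightarrow>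
     finite (elems M) \<and>
     \<Omega> = (\<Union>k\<in>elems M. elem M k) \<and>
     (\<forall>k\<in>elems M. \<forall>l\<in>elems M. k \<noteq> l \<longrightarrow> interior (elem M k) \<inter> interior (elem M l) = {}) \<and>
     (\<forall>k\<in>elems M. (\<forall>c. (\<lambda>z. emap M k z $ c) \<in> poly2 pmap) \<and>
        inj_on (emap M k) ref_tri \<and> (\<forall>z\<in>ref_tri. 0 < jac M k z)) \<and>
     (\<forall>k\<in>elems M. \<forall>a v b. link M k a = Interior v b \<longrightarrow>
        v \<in> elems M \<and> v \<noteq> k \<and> link M v b = Interior k a \<and>
        (\<forall>s\<in>{-1..1}. emap M k (facet_pt a s) = emap M v (facet_pt b (- s)))) \<and>
     \<Gamma>D = (\<Union>k\<in>elems M. \<Union>a\<in>dir_facets M k. facet_set M k a) \<and>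
     \<Gamma>N = (\<Union>k\<in>elems M. \<Union>a\<in>neu_facets M k. facet_set M k a)"

definition elem_diam :: "mesh \<Rightarrow> nat \<Rightarrow> real" where
  "elem_diam M k = diameter (elem M k)"

definition mesh_size :: "mesh \<Rightarrow> real" where
  "mesh_size M = Max (elem_diam M ` elems M)"

text \<open>Regularity of curved elements in the sense of Ciarlet and Raviart. For affine maps this is the
  usual shape regularity. Neither the sizes of different elements nor those of different meshes are
  required to be comparable.\<close>

definition regular_mesh :: "real \<Rightarrow> mesh \<Rightarrow> bool" where
  "regular_mesh C M \<longleftrightarrow> (\<forall>k\<in>elems M. \<forall>z\<in>ref_tri.
     elem_diam M k ^ 2 \<le> C * jac M k z \<and>
     (\<forall>c i j. 1 \<le> i + j \<longrightarrow>
        \<bar>(pd 1 ^^ i) ((pd 2 ^^ j) (\<lambda>z. emap M k z $ c)) z\<bar> \<le> C * elem_diam M k ^ (i + j)))"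

section \<open>Physical operators\<close>

text \<open>The nodes of an interior facet are numbered identically from both sides, in the direction in
  which the neighbour with the smaller index traverses the facet. Seen from the other neighbour, node
  \<open>i\<close> sits at the parameter \<open>- fpos S i\<close>, and the rows of the extrapolation matrix are
  permuted accordingly.\<close>

definition orient :: "mesh \<Rightarrow> nat \<Rightarrow> 3 \<Rightarrow> real" where
  "orient M k a = (if is_Interior (link M k a) \<and> nbe M k a < k then -1 else 1)"

definition fref :: "('n::finite, 'f::finite) sbp \<Rightarrow> mesh \<Rightarrow> nat \<Rightarrow> 3 \<Rightarrow> 'f \<Rightarrow> real^2" where
  "fref S M k a i = facet_pt a (orient M k a * fpos S i)"

definition Rk :: "('n::finite, 'f::finite) sbp \<Rightarrow> mesh \<Rightarrow> nat \<Rightarrow> 3 \<Rightarrow> real^'n^'f" where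
  "Rk S M k a = (\<chi> i. Rref S a $ (THE j. fpos S j = orient M k a * fpos S i))"

text \<open>The image of the unit tangent of a reference facet; its length is the arc-length scaling
  factor, and its clockwise rotation points outwards because the map preserves orientation.\<close>

definition facet_tangent :: "mesh \<Rightarrow> nat \<Rightarrow> 3 \<Rightarrow> real^2 \<Rightarrow> real^2" where
  "facet_tangent M k a z = (\<chi> c. \<Sum>d\<in>UNIV. metric_term M k c d z * facet_tan a $ d)"

definition facet_normal :: "mesh \<Rightarrow> nat \<Rightarrow> 3 \<Rightarrow> real^2 \<Rightarrow> real^2" where
  "facet_normal M k a z = (1 / norm (facet_tangent M k a z)) *\<^sub>R rot_cw (facet_tangent M k a z)"

definition Jf :: "('n::finite, 'f::finite) sbp \<Rightarrow> mesh \<Rightarrow> nat \<Rightarrow> 3 \<Rightarrow> real^'f^'f" where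
  "Jf S M k a = diag (\<lambda>i. norm (facet_tangent M k a (fref S M k a i)))"

definition Bk :: "('n::finite, 'f::finite) sbp \<Rightarrow> mesh \<Rightarrow> nat \<Rightarrow> 3 \<Rightarrow> real^'f^'f" where
  "Bk S M k a = Jf S M k a ** Bref S a"

definition Nk :: "('n::finite, 'f::finite) sbp \<Rightarrow> mesh \<Rightarrow> nat \<Rightarrow> 3 \<Rightarrow> 2 \<Rightarrow> real^'f^'f" where
  "Nk S M k a c = diag (\<lambda>i. facet_normal M k a (fref S M k a i) $ c)"

definition Hk :: "('n::finite, 'f::finite) sbp \<Rightarrow> mesh \<Rightarrow> nat \<Rightarrow> real^'n^'n" where
  "Hk S M k = diag (\<lambda>i. \<bar>jac M k (vnode S i)\<bar>) ** Href S"

definition Ek :: "('n::finite, 'f::finite) sbp \<Rightarrow> mesh \<Rightarrow> nat \<Rightarrow> 2 \<Rightarrow> real^'n^'n" where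
  "Ek S M k c =
     (\<Sum>a\<in>UNIV. transpose (Rk S M k a) ** Bk S M k a ** Nk S M k a c ** Rk S M k a)"

definition metric_diag ::
  "('n::finite, 'f::finite) sbp \<Rightarrow> mesh \<Rightarrow> nat \<Rightarrow> 2 \<Rightarrow> 2 \<Rightarrow> real^'n^'n" where
  "metric_diag S M k c d = diag (\<lambda>i. metric_term M k c d (vnode S i))"

definition Sx :: "('n::finite, 'f::finite) sbp \<Rightarrow> mesh \<Rightarrow> nat \<Rightarrow> real^'n^'n" where
  "Sx S M k =
     (1/2) *\<^sub>R (metric_diag S M k 2 2 ** Qref S 1 - transpose (Qref S 1) ** metric_diag S M k 2 2) +
     (1/2) *\<^sub>R (- (metric_diag S M k 2 1 ** Qref S 2) + transpose (Qref S 2) ** metric_diag S M k 2 1)"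

definition Sy :: "('n::finite, 'f::finite) sbp \<Rightarrow> mesh \<Rightarrow> nat \<Rightarrow> real^'n^'n" where
  "Sy S M k =
     (1/2) *\<^sub>R (- (metric_diag S M k 1 2 ** Qref S 1) + transpose (Qref S 1) ** metric_diag S M k 1 2) +
     (1/2) *\<^sub>R (metric_diag S M k 1 1 ** Qref S 2 - transpose (Qref S 2) ** metric_diag S M k 1 1)"

definition Dk :: "('n::finite, 'f::finite) sbp \<Rightarrow> mesh \<Rightarrow> nat \<Rightarrow> 2 \<Rightarrow> real^'n^'n" where
  "Dk S M k c = matrix_inv (Hk S M k) **
     ((if c = 1 then Sx S M k else Sy S M k) + (1/2) *\<^sub>R Ek S M k c)"

definition Lam ::
  "('n::finite, 'f::finite) sbp \<Rightarrow> mesh \<Rightarrow> (real^2 \<Rightarrow> real^2^2) \<Rightarrow> nat \<Rightarrow> 2 \<Rightarrow> 2 \<Rightarrow> real^'n^'n" where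
  "Lam S M lam k c d = diag (\<lambda>i. lam (emap M k (vnode S i)) $ c $ d)"

definition D2 ::
  "('n::finite, 'f::finite) sbp \<Rightarrow> mesh \<Rightarrow> (real^2 \<Rightarrow> real^2^2) \<Rightarrow> nat \<Rightarrow> real^'n^'n" where
  "D2 S M lam k = (\<Sum>c\<in>UNIV. \<Sum>d\<in>UNIV. Dk S M k c ** Lam S M lam k c d ** Dk S M k d)"

definition Df ::
  "('n::finite, 'f::finite) sbp \<Rightarrow> mesh \<Rightarrow> (real^2 \<Rightarrow> real^2^2) \<Rightarrow> nat \<Rightarrow> 3 \<Rightarrow> real^'n^'f" where
  "Df S M lam k a = (\<Sum>c\<in>UNIV. \<Sum>d\<in>UNIV.
     Nk S M k a c ** Rk S M k a ** Lam S M lam k c d ** Dk S M k d)"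

definition nodal ::
  "('n::finite, 'f::finite) sbp \<Rightarrow> mesh \<Rightarrow> (real^2 \<Rightarrow> real) \<Rightarrow> nat \<Rightarrow> real^'n" where
  "nodal S M f k = (\<chi> i. f (emap M k (vnode S i)))"

definition facet_nodal ::
  "('n::finite, 'f::finite) sbp \<Rightarrow> mesh \<Rightarrow> (real^2 \<Rightarrow> real) \<Rightarrow> nat \<Rightarrow> 3 \<Rightarrow> real^'f" where
  "facet_nodal S M f k a = (\<chi> i. f (emap M k (fref S M k a i)))"

definition facet_flux ::
  "('n::finite, 'f::finite) sbp \<Rightarrow> mesh \<Rightarrow> (real^2 \<Rightarrow> real^2) \<Rightarrow> nat \<Rightarrow> 3 \<Rightarrow> real^'f" where
  "facet_flux S M q k a =
     (\<chi> i. facet_normal M k a (fref S M k a i) \<bullet> q (emap M k (fref S M k a i)))"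

definition hnorm :: "real^'n^'n \<Rightarrow> real^'n \<Rightarrow> real" where
  "hnorm H w = sqrt (w \<bullet> (H *v w))"

section \<open>Simultaneous approximation terms\<close>

text \<open>\<open>T1\<close> to \<open>T4\<close> and \<open>TD\<close> take an element and one of its facets, \<open>T5\<close> and \<open>T6\<close> an element and
  two of its facets.\<close>

record ('f::finite) sat =
  T1 :: "nat \<Rightarrow> 3 \<Rightarrow> real^'f^'f"
  T2 :: "nat \<Rightarrow> 3 \<Rightarrow> real^'f^'f"
  T3 :: "nat \<Rightarrow> 3 \<Rightarrow> real^'f^'f"
  T4 :: "nat \<Rightarrow> 3 \<Rightarrow> real^'f^'f"
  T5 :: "nat \<Rightarrow> 3 \<Rightarrow> 3 \<Rightarrow> real^'f^'f"
  T6 :: "nat \<Rightarrow> 3 \<Rightarrow> 3 \<Rightarrow> real^'f^'f"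
  TD :: "nat \<Rightarrow> 3 \<Rightarrow> real^'f^'f"

definition sat_symmetric :: "mesh \<Rightarrow> ('f::finite) sat \<Rightarrow> bool" where
  "sat_symmetric M T \<longleftrightarrow> (\<forall>k\<in>elems M.
     (\<forall>a\<in>int_facets M k.
        transpose (T1 T k a) = T1 T k a \<and> transpose (T2 T k a) = T2 T k a \<and>
        transpose (T3 T k a) = T3 T k a \<and> transpose (T4 T k a) = T4 T k a) \<and>
     (\<forall>a\<in>dir_facets M k. transpose (TD T k a) = TD T k a) \<and>
     (\<forall>a\<in>int_facets M k. \<forall>b\<in>int_facets M k. a \<noteq> b \<longrightarrow>
        T5 T k a b = transpose (T5 T k b a) \<and> T6 T k a b = transpose (T6 T k b a)))"

definition sat_adjoint_conditions ::
  "('n::finite, 'f::finite) sbp \<Rightarrow> mesh \<Rightarrow> 'f sat \<Rightarrow> bool" where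
  "sat_adjoint_conditions S M T \<longleftrightarrow> (\<forall>k\<in>elems M.
     (\<forall>a\<in>int_facets M k.
        T1 T k a = T1 T (nbe M k a) (nbf M k a) \<and>
        T2 T k a + T2 T (nbe M k a) (nbf M k a) = - Bk S M k a \<and>
        T3 T k a + T3 T (nbe M k a) (nbf M k a) = Bk S M k a \<and>
        T4 T k a = T4 T (nbe M k a) (nbf M k a)) \<and>
     (\<forall>a\<in>int_facets M k. \<forall>b\<in>int_facets M k. a \<noteq> b \<longrightarrow> T5 T k a b = - T6 T k a b))"

text \<open>The size of the coefficients relative to the element diameter: since \<open>Bk\<close> is of order \<open>h\<close>,
  this is the scaling of the interior penalty methods, for which \<open>T1\<close> is of order \<open>1/h\<close> times \<open>Bk\<close>
  and \<open>T2\<close>, \<open>T3\<close> are multiples of \<open>Bk\<close>.\<close>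

definition mat_le :: "real^'f^'f \<Rightarrow> real \<Rightarrow> bool" where
  "mat_le A c \<longleftrightarrow> (\<forall>i j. \<bar>A $ i $ j\<bar> \<le> c)"

definition sat_scaled :: "real \<Rightarrow> mesh \<Rightarrow> ('f::finite) sat \<Rightarrow> bool" where
  "sat_scaled C M T \<longleftrightarrow> (\<forall>k\<in>elems M.
     (\<forall>a\<in>int_facets M k.
        mat_le (T1 T k a) C \<and>
        mat_le (T2 T k a) (C * elem_diam M k) \<and>
        mat_le (T3 T k a) (C * elem_diam M k) \<and>
        mat_le (T4 T k a) (C * elem_diam M k ^ 2)) \<and>
     (\<forall>a\<in>dir_facets M k. mat_le (TD T k a) C) \<and>
     (\<forall>a\<in>int_facets M k. \<forall>b\<in>int_facets M k. a \<noteq> b \<longrightarrow>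
        mat_le (T5 T k a b) C \<and> mat_le (T6 T k a b) C))"

section \<open>The discrete adjoint operator\<close>

text \<open>Below \<open>u k\<close> is the vector of nodal values on element \<open>k\<close>.\<close>

definition facet_trace :: "('n::finite, 'f::finite) sbp \<Rightarrow> mesh \<Rightarrow> (nat \<Rightarrow> real^'n) \<Rightarrow> nat \<Rightarrow> 3 \<Rightarrow> real^'f" where
  "facet_trace S M u k a = Rk S M k a *v u k"

definition flux_trace ::
  "('n::finite, 'f::finite) sbp \<Rightarrow> mesh \<Rightarrow> (real^2 \<Rightarrow> real^2^2) \<Rightarrow>
   (nat \<Rightarrow> real^'n) \<Rightarrow> nat \<Rightarrow> 3 \<Rightarrow> real^'f" where
  "flux_trace S M lam u k a = Df S M lam k a *v u k"

definition sI_adj ::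
  "('n::finite, 'f::finite) sbp \<Rightarrow> mesh \<Rightarrow> 'f sat \<Rightarrow> (real^2 \<Rightarrow> real^2^2) \<Rightarrow>
   (nat \<Rightarrow> real^'n) \<Rightarrow> nat \<Rightarrow> real^'n" where
  "sI_adj S M T lam u k =
     (\<Sum>a\<in>int_facets M k. let v = nbe M k a; b = nbf M k a in
        transpose (Rk S M k a) *v
          (T1 T k a *v facet_trace S M u k a - T1 T v b *v facet_trace S M u v b +
           (T2 T k a + Bk S M k a) *v flux_trace S M lam u k a - T2 T v b *v flux_trace S M lam u v b) +
        transpose (Df S M lam k a) *v
          ((T3 T k a - Bk S M k a) *v facet_trace S M u k a + T3 T v b *v facet_trace S M u v b +
           T4 T k a *v flux_trace S M lam u k a + T4 T v b *v flux_trace S M lam u v b)) +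
     (\<Sum>a\<in>int_facets M k. let v = nbe M k a; b = nbf M k a in
        (\<Sum>e\<in>int_facets M k - {a}. transpose (Rk S M k a) *v
          (T5 T k a e *v facet_trace S M u k e + T6 T k a e *v facet_trace S M u (nbe M k e) (nbf M k e))) -
        (\<Sum>d\<in>int_facets M v - {b}. transpose (Rk S M k a) *v
          (T5 T v b d *v facet_trace S M u v d + T6 T v b d *v facet_trace S M u (nbe M v d) (nbf M v d))))"

definition sB_adj ::
  "('n::finite, 'f::finite) sbp \<Rightarrow> mesh \<Rightarrow> 'f sat \<Rightarrow> (real^2 \<Rightarrow> real^2^2) \<Rightarrow>
   (nat \<Rightarrow> 3 \<Rightarrow> real^'f) \<Rightarrow> (nat \<Rightarrow> 3 \<Rightarrow> real^'f) \<Rightarrow> (nat \<Rightarrow> real^'n) \<Rightarrow> nat \<Rightarrow> real^'n" where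
  "sB_adj S M T lam uD zN u k =
     (\<Sum>a\<in>dir_facets M k.
        transpose (Rk S M k a) *v (TD T k a *v (facet_trace S M u k a - uD k a)) -
        transpose (Df S M lam k a) *v (Bk S M k a *v (facet_trace S M u k a - uD k a))) +
     (\<Sum>a\<in>neu_facets M k.
        transpose (Rk S M k a) *v (Bk S M k a *v (flux_trace S M lam u k a - zN k a)))"

definition Lstar ::
  "('n::finite, 'f::finite) sbp \<Rightarrow> mesh \<Rightarrow> 'f sat \<Rightarrow> (real^2 \<Rightarrow> real^2^2) \<Rightarrow>
   (nat \<Rightarrow> 3 \<Rightarrow> real^'f) \<Rightarrow> (nat \<Rightarrow> 3 \<Rightarrow> real^'f) \<Rightarrow> (nat \<Rightarrow> real^'n) \<Rightarrow> nat \<Rightarrow> real^'n" where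
  "Lstar S M T lam uD zN u k =
     - (D2 S M lam k *v u k) +
     matrix_inv (Hk S M k) *v sI_adj S M T lam u k +
     matrix_inv (Hk S M k) *v sB_adj S M T lam uD zN u k"

text \<open>The residual of the exact adjoint in the discrete adjoint equation.\<close>

definition adj_residual ::
  "('n::finite, 'f::finite) sbp \<Rightarrow> mesh \<Rightarrow> 'f sat \<Rightarrow> (real^2) set \<Rightarrow> (real^2 \<Rightarrow> real^2^2) \<Rightarrow>
   (real^2 \<Rightarrow> real) \<Rightarrow> (real^2 \<Rightarrow> real) \<Rightarrow> nat \<Rightarrow> real^'n" where
  "adj_residual S M T \<Omega> lam G \<psi> k =
     Lstar S M T lam (facet_nodal S M \<psi>) (facet_flux S M (\<lambda>x. lam x *v grad_in \<Omega> \<psi> x))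
       (nodal S M \<psi>) k - nodal S M G k"

end

theory Submission
  imports Defs
begin

text \<open>
  All estimates are made on the reference triangle. The pullback of a \<open>C\<^sup>m\<close> function to an element of
  diameter \<open>h\<close> has derivatives of order \<open>j \<le> m\<close> bounded by \<open>h\<^sup>j\<close>, so Taylor expansion makes
  extrapolation to a facet and reference differentiation accurate to \<open>h\<^sup>m\<close> when \<open>m \<le> p + 1\<close>. The split
  form of the physical operators, together with the vanishing divergence of the cofactors of the Jacobian,
  then shows that \<open>Dk\<close> loses only one power of \<open>h\<close>. Under the conditions on the coefficients the
  interior part of the adjoint operator depends on the exact adjoint only through jumps of its
  traces and sums of its fluxes, which vanish for the exact traces and fluxes. Counting powers
  of \<open>h\<close> gives a residual of order \<open>p - 1\<close>, hence a contribution of order \<open>p\<close> per element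
  in the norm of \<open>Hk\<close>, and the sum of \<open>h\<^sup>2\<close> over the elements is bounded by the area of \<open>\<Omega>\<close>.
\<close>

section \<open>Polynomials in two variables\<close>

text \<open>Expansions are made in reference coordinates because on a curved element a polynomial in
  physical coordinates pulls back to one of higher degree, for which the operators are not exact.
  Three questions of uniformity shape the rest. Constants must be common to all elements of all
  meshes, although \<open>\<psi>\<close> and \<open>lam\<close> are only smooth piecewise and the
  pieces change with the mesh; hence all orders are stated over pairs of mesh and element. Interface
  terms mix neighbours whose sizes are not assumed comparable; comparability is extracted from the
  tangent of their common facet. And since the sizes within a mesh may vary freely, the number of
  elements is not controlled by the mesh size. Summing the unsquared norms therefore spends two of
  the \<open>p\<close> powers and leaves \<open>p - 2\<close>, whence \<open>3 \<le> p\<close> in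
  the first claim; the squared norms leave \<open>2 * p - 2\<close>, whence \<open>2 \<le> p\<close>
  in the second.\<close>

lemma poly2_real_polynomial_function:
  assumes "f \<in> poly2 d" shows "real_polynomial_function f"
proof -
  obtain c where c: "f z = (\<Sum>i\<le>d. \<Sum>j\<le>d - i. c i j * (z $ 1) ^ i * (z $ 2) ^ j)" for z
    using assms by (auto simp: poly2_def)
  have [intro]: "real_polynomial_function (\<lambda>z::real^2. z $ i)" for i
    by (intro real_polynomial_function.intros bounded_linear_vec_nth)
  have "real_polynomial_function (\<lambda>z. \<Sum>i\<le>d. \<Sum>j\<le>d - i. c i j * (z $ 1) ^ i * (z $ 2) ^ j)"
    by (intro real_polynomial_function_sum real_polynomial_function.intros
        real_polynomial_function_power finite_atMost bounded_linear_vec_nth)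
  moreover have "f = (\<lambda>z. \<Sum>i\<le>d. \<Sum>j\<le>d - i. c i j * (z $ 1) ^ i * (z $ 2) ^ j)"
    using c by auto
  ultimately show ?thesis by simp
qed

lemma poly2_add:
  assumes "f \<in> poly2 d" "g \<in> poly2 d" shows "(\<lambda>z. f z + g z) \<in> poly2 d"
proof -
  obtain c where c: "f z = (\<Sum>i\<le>d. \<Sum>j\<le>d - i. c i j * (z $ 1) ^ i * (z $ 2) ^ j)" for z
    using assms by (auto simp: poly2_def)
  obtain c' where c': "g z = (\<Sum>i\<le>d. \<Sum>j\<le>d - i. c' i j * (z $ 1) ^ i * (z $ 2) ^ j)" for z
    using assms by (auto simp: poly2_def)
  show ?thesis unfolding poly2_def mem_Collect_eq
    by (rule exI[of _ "\<lambda>i j. c i j + c' i j"]) (simp add: c c' sum.distrib algebra_simps)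
qed

lemma poly2_cmult:
  assumes "f \<in> poly2 d" shows "(\<lambda>z. r * f z) \<in> poly2 d"
proof -
  obtain c where c: "f z = (\<Sum>i\<le>d. \<Sum>j\<le>d - i. c i j * (z $ 1) ^ i * (z $ 2) ^ j)" for z
    using assms by (auto simp: poly2_def)
  show ?thesis unfolding poly2_def mem_Collect_eq
    by (rule exI[of _ "\<lambda>i j. r * c i j"]) (simp add: c sum_distrib_left mult_ac)
qed

lemma poly2_mono:
  assumes "f \<in> poly2 d" "d \<le> e" shows "f \<in> poly2 e"
proof -
  obtain c where c: "f z = (\<Sum>i\<le>d. \<Sum>j\<le>d - i. c i j * (z $ 1) ^ i * (z $ 2) ^ j)" for z
    using assms by (auto simp: poly2_def)
  \<comment> \<open>Entries \<open>c i j\<close> with \<open>i + j > d\<close> never occur in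
    \<open>f\<close> and may be arbitrary, so they are cut off before the range of summation
    grows.\<close>
  define c' where "c' i j = (if i + j \<le> d then c i j else 0)" for i j
  have "f z = (\<Sum>i\<le>e. \<Sum>j\<le>e - i. c' i j * (z $ 1) ^ i * (z $ 2) ^ j)" for z
  proof -
    have "(\<Sum>i\<le>e. \<Sum>j\<le>e - i. c' i j * (z $ 1) ^ i * (z $ 2) ^ j)
        = (\<Sum>i\<le>d. \<Sum>j\<le>e - i. c' i j * (z $ 1) ^ i * (z $ 2) ^ j)"
      using assms(2) by (intro sum.mono_neutral_right) (auto simp: c'_def)
    also have "\<dots> = (\<Sum>i\<le>d. \<Sum>j\<le>d - i. c' i j * (z $ 1) ^ i * (z $ 2) ^ j)"
      using assms(2) by (intro sum.cong refl sum.mono_neutral_right) (auto simp: c'_def)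
    also have "\<dots> = f z" by (auto simp: c c'_def intro!: sum.cong)
    finally show ?thesis by simp
  qed
  then show ?thesis by (auto simp: poly2_def)
qed

lemma poly2_const: "(\<lambda>_. r) \<in> poly2 d"
proof -
  have "(\<lambda>_. r) \<in> poly2 0" by (auto simp: poly2_def)
  then show ?thesis by (rule poly2_mono) simp
qed

lemma poly2_mult_coord:
  assumes "f \<in> poly2 d" shows "(\<lambda>z. z $ e * f z) \<in> poly2 (Suc d)"
proof -
  obtain c where c: "f z = (\<Sum>i\<le>d. \<Sum>j\<le>d - i. c i j * (z $ 1) ^ i * (z $ 2) ^ j)" for z
    using assms by (auto simp: poly2_def)
  consider "e = 1" | "e = 2" using exhaust_2 by blast
  then show ?thesis
  proof cases
    case 1
    show ?thesis unfolding poly2_def mem_Collect_eq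
    proof (rule exI[of _ "\<lambda>i j. if i = 0 then 0 else c (i - 1) j"], rule allI)
      fix z :: "real^2"
      show "z $ e * f z = (\<Sum>i\<le>Suc d. \<Sum>j\<le>Suc d - i.
          (if i = 0 then 0 else c (i - 1) j) * (z $ 1) ^ i * (z $ 2) ^ j)"
        unfolding sum.atMost_Suc_shift[of _ d] by (simp add: c 1 sum_distrib_left mult_ac)
    qed
  next
    case 2
    show ?thesis unfolding poly2_def mem_Collect_eq
    proof (rule exI[of _ "\<lambda>i j. if j = 0 then 0 else c i (j - 1)"], rule allI)
      fix z :: "real^2"
      have "(\<Sum>j\<le>Suc d - i. (if j = 0 then 0 else c i (j - 1)) * (z $ 1) ^ i * (z $ 2) ^ j)
          = z $ 2 * (\<Sum>j\<le>d - i. c i j * (z $ 1) ^ i * (z $ 2) ^ j)" if "i \<le> d" for i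
      proof -
        have "Suc d - i = Suc (d - i)" using that by simp
        then show ?thesis
          unfolding \<open>Suc d - i = Suc (d - i)\<close> sum.atMost_Suc_shift
          by (simp add: sum_distrib_left mult_ac)
      qed
      then show "z $ e * f z = (\<Sum>i\<le>Suc d. \<Sum>j\<le>Suc d - i.
          (if j = 0 then 0 else c i (j - 1)) * (z $ 1) ^ i * (z $ 2) ^ j)"
        by (simp add: c 2 sum_distrib_left)
    qed
  qed
qed

lemma poly2_mult_coord_diff:
  assumes "f \<in> poly2 d" shows "(\<lambda>z. (z - a) $ e * f z) \<in> poly2 (Suc d)"
proof -
  have "(\<lambda>z. z $ e * f z + (- (a $ e)) * f z) \<in> poly2 (Suc d)"
    by (intro poly2_add poly2_mult_coord poly2_cmult assms poly2_mono[OF assms]) simp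
  then show ?thesis by (simp add: algebra_simps)
qed

lemma poly2_sum:
  assumes "finite A" "\<And>i. i \<in> A \<Longrightarrow> f i \<in> poly2 d" shows "(\<lambda>z. \<Sum>i\<in>A. f i z) \<in> poly2 d"
  using assms by (induction) (auto intro: poly2_const poly2_add)

lemma pd_eqI:
  assumes "(f has_derivative f') (at z)" shows "pd d f z = f' (axis d 1)"
  using frechet_derivative_at[OF assms] by (simp add: pd_def)

text \<open>\<open>pd\<close> rests on a chosen derivative, so the induction first produces some
  polynomial gradient; uniqueness of the derivative identifies it with \<open>pd\<close> at the
  end.\<close>

lemma real_polynomial_function_derivative:
  assumes "real_polynomial_function (f :: real^2 \<Rightarrow> real)"
  shows "(f has_derivative (\<lambda>v. \<Sum>d\<in>UNIV. pd d f z * v $ d)) (at z)"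
    "\<And>d. real_polynomial_function (pd d f)"
proof -
  have "\<exists>f'. (\<forall>z. (f has_derivative (\<lambda>v. \<Sum>d\<in>UNIV. f' d z * v $ d)) (at z)) \<and>
     (\<forall>d. real_polynomial_function (f' d))"
    using assms
  proof induction
    case (linear f)
    have "f v = (\<Sum>d\<in>UNIV. f (axis d 1) * v $ d)" for v
    proof -
      have "f v = f (\<Sum>d\<in>UNIV. v $ d *\<^sub>R axis d 1)"
        by (simp add: basis_expansion[of v, unfolded scalar_mult_eq_scaleR])
      also have "\<dots> = (\<Sum>d\<in>UNIV. f (axis d 1) * v $ d)"
        using linear by (simp add: linear_sum bounded_linear.linear linear_scale mult.commute)
      finally show ?thesis .
    qed
    then have "f = (\<lambda>v. \<Sum>d\<in>UNIV. f (axis d 1) * v $ d)" by blast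
    with bounded_linear_imp_has_derivative[OF linear] show ?case
      by (intro exI[of _ "\<lambda>d _. f (axis d 1)"])
        (metis real_polynomial_function.intros(2))
  next
    case (const c)
    then show ?case
      by (intro exI[of _ "\<lambda>d _. 0"]) auto
  next
    case (add f g)
    then obtain f' g' where
      f: "\<And>z. (f has_derivative (\<lambda>v. \<Sum>d\<in>UNIV. f' d z * v $ d)) (at z)" "\<And>d. real_polynomial_function (f' d)" and
      g: "\<And>z. (g has_derivative (\<lambda>v. \<Sum>d\<in>UNIV. g' d z * v $ d)) (at z)" "\<And>d. real_polynomial_function (g' d)"
      by blast
    show ?case
      by (rule exI[of _ "\<lambda>d z. f' d z + g' d z"])
        (auto simp: algebra_simps sum.distrib intro!: has_derivative_eq_rhs[OF has_derivative_add[OF f(1) g(1)]] 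
            real_polynomial_function.intros(3) f g)
  next
    case (mult f g)
    then obtain f' g' where
      f: "\<And>z. (f has_derivative (\<lambda>v. \<Sum>d\<in>UNIV. f' d z * v $ d)) (at z)" "\<And>d. real_polynomial_function (f' d)" and
      g: "\<And>z. (g has_derivative (\<lambda>v. \<Sum>d\<in>UNIV. g' d z * v $ d)) (at z)" "\<And>d. real_polynomial_function (g' d)"
      by blast
    show ?case
      by (rule exI[of _ "\<lambda>d z. f z * g' d z + f' d z * g z"])
        (auto simp: algebra_simps sum.distrib sum_distrib_left intro!: has_derivative_eq_rhs[OF has_derivative_mult[OF f(1) g(1)]] 
            real_polynomial_function.intros(3,4) f g mult)
  qed
  then obtain f' where f': "\<And>z. (f has_derivative (\<lambda>v. \<Sum>d\<in>UNIV. f' d z * v $ d)) (at z)"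
     "\<And>d. real_polynomial_function (f' d)" by blast
  have "pd d f z = f' d z" for d z
    using pd_eqI[OF f'(1)] by (simp add: axis_def if_distrib cong: if_cong)
  then have "pd d f = f' d" for d by blast
  with f' show "(f has_derivative (\<lambda>v. \<Sum>d\<in>UNIV. pd d f z * v $ d)) (at z)"
    "\<And>d. real_polynomial_function (pd d f)" by auto
qed

lemma pd_add:
  assumes "real_polynomial_function f" "real_polynomial_function g"
  shows "pd d (\<lambda>z. f z + g z) = (\<lambda>z. pd d f z + pd d g z)"
proof
  fix z
  have "((\<lambda>z. f z + g z) has_derivative (\<lambda>v. (\<Sum>d\<in>UNIV. pd d f z * v $ d) + (\<Sum>d\<in>UNIV. pd d g z * v $ d))) (at z)"
    by (intro has_derivative_add real_polynomial_function_derivative assms)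
  from pd_eqI[OF this] show "pd d (\<lambda>z. f z + g z) z = pd d f z + pd d g z"
    by (simp add: axis_def if_distrib cong: if_cong)
qed

lemma pd_mult:
  assumes "real_polynomial_function f" "real_polynomial_function g"
  shows "pd d (\<lambda>z. f z * g z) = (\<lambda>z. pd d f z * g z + f z * pd d g z)"
proof
  fix z
  have "((\<lambda>z. f z * g z) has_derivative (\<lambda>v. f z * (\<Sum>d\<in>UNIV. pd d g z * v $ d) + (\<Sum>d\<in>UNIV. pd d f z * v $ d) * g z)) (at z)"
    by (intro has_derivative_mult real_polynomial_function_derivative assms)
  from pd_eqI[OF this] show "pd d (\<lambda>z. f z * g z) z = pd d f z * g z + f z * pd d g z"
    by (simp add: axis_def if_distrib cong: if_cong)
qed

text \<open>Both orders obey the same sum and product rules, so induction over the polynomial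
  suffices. It serves to sort mixed derivatives of the element maps and to make the cofactors
  divergence free.\<close>

lemma pd_commute:
  assumes "real_polynomial_function f"
  shows "pd d (pd e f) = pd e (pd d f)"
  using assms
proof induction
  case (linear f)
  have "pd d f = (\<lambda>_. f (axis d 1))" for d
    using pd_eqI[OF bounded_linear_imp_has_derivative[OF linear]] by blast
  then have "pd e (pd d f) = (\<lambda>_. 0)" for d e
    using pd_eqI[OF has_derivative_const] by fastforce
  then show ?case by metis
next
  case (const c)
  have *: "pd d (\<lambda>_. b) = (\<lambda>_. 0)" for d b
    using pd_eqI[OF has_derivative_const] by blast
  show ?case by (simp add: *)
next
  case (add f g)
  then show ?case by (simp add: pd_add real_polynomial_function_derivative)
next
  case (mult f g)
  then show ?case
    by (simp add: pd_add pd_mult real_polynomial_function_derivative real_polynomial_function.intros) (simp add: algebra_simps)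
qed

section \<open>Scaled derivative bounds\<close>

text \<open>A relation, because a derivative within a set need not be unique. Uniqueness is
  available on interiors, on the reference triangle and on its images.\<close>

definition has_grad_on ::
  "(real^2) set \<Rightarrow> (real^2 \<Rightarrow> real) \<Rightarrow> (2 \<Rightarrow> real^2 \<Rightarrow> real) \<Rightarrow> bool" where
  "has_grad_on K f f' \<longleftrightarrow>
     (\<forall>z\<in>K. (f has_derivative (\<lambda>v. \<Sum>d\<in>UNIV. f' d z * v $ d)) (at z within K))"

text \<open>The derivatives of order \<open>j \<le> m\<close> exist on \<open>K\<close> and are bounded by \<open>A * h ^ j\<close>.\<close>

fun deriv_bounded :: "nat \<Rightarrow> real \<Rightarrow> real \<Rightarrow> (real^2) set \<Rightarrow> (real^2 \<Rightarrow> real) \<Rightarrow> bool" where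
  "deriv_bounded 0 A h K f = (\<forall>z\<in>K. \<bar>f z\<bar> \<le> A)"
| "deriv_bounded (Suc m) A h K f = ((\<forall>z\<in>K. \<bar>f z\<bar> \<le> A) \<and>
     (\<exists>f'. has_grad_on K f f' \<and> (\<forall>d. deriv_bounded m (A * h) h K (f' d))))"

lemma deriv_bounded_abs_le: "deriv_bounded m A h K f \<Longrightarrow> z \<in> K \<Longrightarrow> \<bar>f z\<bar> \<le> A"
  by (cases m) auto

lemma has_grad_on_cong:
  assumes "\<And>z. z \<in> K \<Longrightarrow> f z = g z" shows "has_grad_on K f f' = has_grad_on K g f'"
  unfolding has_grad_on_def
  using has_derivative_transform[of _ K f g] has_derivative_transform[of _ K g f] assms
  by (auto simp del: sum_2)

lemma deriv_bounded_cong: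
  assumes "\<And>z. z \<in> K \<Longrightarrow> f z = g z" shows "deriv_bounded m A h K f = deriv_bounded m A h K g"
  using assms by (cases m) (auto simp: has_grad_on_cong[of K f g])

lemma deriv_bounded_lower:
  assumes "deriv_bounded m A h K f" "l \<le> m" shows "deriv_bounded l A h K f"
  using assms
proof (induction l arbitrary: m f A)
  case 0
  then show ?case using deriv_bounded_abs_le by auto
next
  case (Suc l)
  then obtain m' where m': "m = Suc m'" "l \<le> m'" by (cases m) auto
  obtain f' where f': "has_grad_on K f f'" "\<And>d. deriv_bounded m' (A * h) h K (f' d)"
    using Suc.prems m' by auto
  have "\<forall>d. deriv_bounded l (A * h) h K (f' d)" using Suc.IH[OF f'(2) m'(2)] by blast
  moreover have "\<forall>z\<in>K. \<bar>f z\<bar> \<le> A" using deriv_bounded_abs_le[OF Suc.prems(1)] by blast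
  ultimately show ?case using f'(1) by auto
qed

lemma deriv_bounded_mono:
  assumes "deriv_bounded m A h K f" "A \<le> B" "0 \<le> h" shows "deriv_bounded m B h K f"
  using assms
proof (induction m arbitrary: A B f)
  case (Suc m)
  then have "A * h \<le> B * h" by (simp add: mult_right_mono)
  moreover obtain f' where "has_grad_on K f f'" "\<And>d. deriv_bounded m (A * h) h K (f' d)"
    using Suc.prems by auto
  moreover have "\<bar>f z\<bar> \<le> B" if "z \<in> K" for z
    using Suc.prems that by fastforce
  moreover have "A * h \<le> B * h" using Suc.prems by (simp add: mult_right_mono)
  ultimately show ?case using Suc.IH[OF _ _ \<open>0 \<le> h\<close>] by fastforce
qed force

lemma deriv_bounded_add:
  assumes "deriv_bounded m A h K f" "deriv_bounded m B h K g"
  shows "deriv_bounded m (A + B) h K (\<lambda>z. f z + g z)"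
  using assms
proof (induction m arbitrary: A B f g)
  case (Suc m)
  then obtain f' g' where f: "has_grad_on K f f'" "\<And>d. deriv_bounded m (A * h) h K (f' d)"
    and g: "has_grad_on K g g'" "\<And>d. deriv_bounded m (B * h) h K (g' d)"
    by auto
  have "has_grad_on K (\<lambda>z. f z + g z) (\<lambda>d z. f' d z + g' d z)"
    unfolding has_grad_on_def
  proof
    fix z assume "z \<in> K"
    with f g show "((\<lambda>z. f z + g z) has_derivative (\<lambda>v. \<Sum>d\<in>UNIV. (f' d z + g' d z) * v $ d)) (at z within K)"
      by (auto simp: has_grad_on_def algebra_simps sum.distrib intro!: has_derivative_eq_rhs[OF has_derivative_add])
  qed
  moreover have "deriv_bounded m ((A + B) * h) h K (\<lambda>z. f' d z + g' d z)" for d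
    using Suc.IH[OF f(2) g(2)] by (simp add: algebra_simps)
  moreover have "\<forall>z\<in>K. \<bar>f z + g z\<bar> \<le> A + B" using Suc.prems by fastforce
  ultimately show ?case by auto
qed fastforce

lemma deriv_bounded_uminus:
  assumes "deriv_bounded m A h K f"
  shows "deriv_bounded m A h K (\<lambda>z. - f z)"
  using assms
proof (induction m arbitrary: A f)
  case (Suc m)
  then obtain f' where f: "has_grad_on K f f'" "\<And>d. deriv_bounded m (A * h) h K (f' d)"
    by auto
  have "has_grad_on K (\<lambda>z. - f z) (\<lambda>d z. - f' d z)"
    unfolding has_grad_on_def
  proof
    fix z assume "z \<in> K"
    with f show "((\<lambda>z. - f z) has_derivative (\<lambda>v. \<Sum>d\<in>UNIV. - f' d z * v $ d)) (at z within K)"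
      by (auto simp: has_grad_on_def algebra_simps sum_negf intro!: has_derivative_eq_rhs[OF has_derivative_minus])
  qed
  with Suc f show ?case by auto
qed auto

text \<open>The factor \<open>2 ^ m\<close> counts the terms of the Leibniz rule, which double with
  each derivative; every term keeps the total power of \<open>h\<close>, since a derivative falls on
  one factor at a time.\<close>

lemma deriv_bounded_mult:
  assumes "deriv_bounded m A h K f" "deriv_bounded m B h K g" "0 \<le> h"
  shows "deriv_bounded m (2 ^ m * A * B) h K (\<lambda>z. f z * g z)"
  using assms
proof (induction m arbitrary: A B f g)
  case 0
  have "\<bar>f z * g z\<bar> \<le> A * B" if "z \<in> K" for z
    using 0 that by (auto simp: abs_mult intro!: mult_mono intro: order_trans[OF abs_ge_zero])
  then show ?case by simp
next
  case (Suc m)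
  then obtain f' g' where f: "has_grad_on K f f'" "\<And>d. deriv_bounded m (A * h) h K (f' d)"
    and g: "has_grad_on K g g'" "\<And>d. deriv_bounded m (B * h) h K (g' d)"
    by auto
  have "has_grad_on K (\<lambda>z. f z * g z) (\<lambda>d z. f z * g' d z + f' d z * g z)"
    unfolding has_grad_on_def
  proof
    fix z assume "z \<in> K"
    with f g show "((\<lambda>z. f z * g z) has_derivative (\<lambda>v. \<Sum>d\<in>UNIV. (f z * g' d z + f' d z * g z) * v $ d)) (at z within K)"
      by (auto simp: has_grad_on_def algebra_simps sum.distrib sum_distrib_left intro!: has_derivative_eq_rhs[OF has_derivative_mult])
  qed
  moreover have "deriv_bounded m (2 ^ Suc m * A * B * h) h K (\<lambda>z. f z * g' d z + f' d z * g z)" for d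
  proof -
    have "deriv_bounded m A h K f" "deriv_bounded m B h K g"
      using Suc.prems deriv_bounded_lower le_Suc_eq by blast+
    from deriv_bounded_add[OF Suc.IH[OF this(1) g(2)] Suc.IH[OF f(2) this(2)]] \<open>0 \<le> h\<close>
    show ?thesis by (simp add: mult_ac)
  qed
  moreover have "\<bar>f z * g z\<bar> \<le> 2 ^ Suc m * A * B" if "z \<in> K" for z
  proof -
    have "\<bar>f z\<bar> \<le> A" "\<bar>g z\<bar> \<le> B" using Suc.prems that by auto
    then have "\<bar>f z * g z\<bar> \<le> A * B" "0 \<le> A * B" by (auto simp: abs_mult intro!: mult_mono)
    moreover have "1 * (A * B) \<le> 2 ^ Suc m * (A * B)"
      by (rule mult_right_mono) (use \<open>0 \<le> A * B\<close> one_le_power[of "2::real" "Suc m"] in auto)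
    ultimately show ?thesis by (simp only: mult.assoc)
  qed
  ultimately show ?case by auto
qed

text \<open>Integrates the expansions of the two partial derivatives along the segment from
  \<open>z0\<close> to \<open>z\<close>. A part of degree \<open>j\<close> integrates to a multiple
  of \<open>t ^ Suc j / Suc j\<close>, which dictates \<open>c (Suc j)\<close>. Each ray is treated
  on its own, so the expansions of the two partial derivatives need not fit together to a gradient.
  The factor 4 is two components times the bound 2 on the coordinates.\<close>

lemma taylor_step:
  fixes c' :: "2 \<Rightarrow> nat \<Rightarrow> real^2 \<Rightarrow> real"
  assumes grad: "has_grad_on K f f'" and K: "convex K" "z0 \<in> K" "\<And>z d. z \<in> K \<Longrightarrow> \<bar>(z - z0) $ d\<bar> \<le> 2"
    and hom: "\<And>d j t v. c' d j (t *\<^sub>R v) = t ^ j * c' d j v"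
    and app: "\<And>d z. z \<in> K \<Longrightarrow> \<bar>f' d z - (\<Sum>j<m. c' d j (z - z0))\<bar> \<le> E"
    and c_def: "\<And>v. c 0 v = f z0" "\<And>j v. c (Suc j) v = (\<Sum>d\<in>UNIV. v $ d * c' d j v) / Suc j"
    and z: "z \<in> K"
  shows "\<bar>f z - (\<Sum>j<Suc m. c j (z - z0))\<bar> \<le> 4 * E"
proof -
  define v where "v = z - z0"
  \<comment> \<open>The remainder on the segment and, below, its derivative; homogeneity turns the
    expansion into powers of \<open>t\<close>.\<close>
  define g where "g t = f (z0 + t *\<^sub>R v) - (\<Sum>j<Suc m. t ^ j * c j v)" for t
  define g' where "g' t = (\<Sum>d\<in>UNIV. v $ d * (f' d (z0 + t *\<^sub>R v) - (\<Sum>j<m. c' d j (t *\<^sub>R v))))" for t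
  have inK: "z0 + t *\<^sub>R v \<in> K" if "t \<in> {0..1}" for t
  proof -
    have "(1 - t) *\<^sub>R z0 + t *\<^sub>R z \<in> K" using K z that by (intro convexD) auto
    then show ?thesis by (simp add: v_def algebra_simps)
  qed
  have d1: "((\<lambda>t. f (z0 + t *\<^sub>R v)) has_derivative (\<lambda>s. s * (\<Sum>d\<in>UNIV. v $ d * f' d (z0 + t *\<^sub>R v)))) (at t within {0..1})"
    if t: "t \<in> {0..1}" for t
  proof -
    have "((\<lambda>t. f (z0 + t *\<^sub>R v)) has_derivative (\<lambda>s. \<Sum>d\<in>UNIV. f' d (z0 + t *\<^sub>R v) * (s *\<^sub>R v) $ d)) (at t within {0..1})"
    proof (rule has_derivative_in_compose2[where t = K and g = f and f = "\<lambda>t. z0 + t *\<^sub>R v"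
          and g' = "\<lambda>x v. \<Sum>d\<in>UNIV. f' d x * v $ d"])
      show "\<And>x. x \<in> K \<Longrightarrow> (f has_derivative (\<lambda>v. \<Sum>d\<in>UNIV. f' d x * v $ d)) (at x within K)"
        using grad by (auto simp: has_grad_on_def)
    qed (use inK t in \<open>auto intro!: derivative_eq_intros\<close>)
    then show ?thesis by (simp add: sum_distrib_left mult_ac)
  qed
  have d2: "((\<lambda>t. \<Sum>j<Suc m. t ^ j * c j v) has_derivative (\<lambda>s. s * (\<Sum>d\<in>UNIV. v $ d * (\<Sum>j<m. c' d j (t *\<^sub>R v))))) (at t within {0..1})" for t
  proof -
    have "((\<lambda>t. t ^ Suc j * c (Suc j) v) has_derivative (\<lambda>s. s * (Suc j * t ^ j * c (Suc j) v))) (at t within {0..1})" for j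
      by (rule has_derivative_eq_rhs, (rule derivative_intros)+) (simp add: fun_eq_iff)
    then have "((\<lambda>t. c 0 v + (\<Sum>j<m. t ^ Suc j * c (Suc j) v)) has_derivative
       (\<lambda>s. 0 + (\<Sum>j<m. s * (Suc j * t ^ j * c (Suc j) v)))) (at t within {0..1})"
      by (intro has_derivative_add has_derivative_const has_derivative_sum)
    moreover have "(\<Sum>j<m. s * (Suc j * t ^ j * c (Suc j) v)) = s * (\<Sum>d\<in>UNIV. v $ d * (\<Sum>j<m. c' d j (t *\<^sub>R v)))" for s
    proof -
      have "s * (Suc j * t ^ j * c (Suc j) v) = s * (\<Sum>d\<in>UNIV. v $ d * c' d j (t *\<^sub>R v))" for j
        by (simp add: c_def hom sum_2 field_simps)
      then show ?thesis by (simp add: sum_2 sum_distrib_left sum.distrib algebra_simps)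
    qed
    ultimately show ?thesis by (simp add: sum.lessThan_Suc_shift del: sum.lessThan_Suc)
  qed
  have gd: "(g has_derivative (\<lambda>s. s * g' t)) (at t within {0..1})" if "t \<in> {0..1}" for t
    unfolding g_def g'_def
    using has_derivative_diff[OF d1[OF that] d2] by (simp add: algebra_simps sum_subtractf)
  have bd: "\<bar>g' t\<bar> \<le> 4 * E" if "t \<in> {0..1}" for t
  proof -
    have "\<bar>v $ d * (f' d (z0 + t *\<^sub>R v) - (\<Sum>j<m. c' d j (t *\<^sub>R v)))\<bar> \<le> 2 * E" for d
      unfolding abs_mult using K(3)[OF z, of d] app[OF inK[OF that], of d]
      by (intro mult_mono) (auto simp: v_def)
    from this[of 1] this[of 2] show ?thesis unfolding g'_def sum_2 by linarith
  qed
  have "norm (g 1 - g 0) \<le> 4 * E * norm (1 - 0 :: real)"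
  proof (rule differentiable_bound[where S = "{0..1}"])
    show "\<And>t. t \<in> {0..1} \<Longrightarrow> onorm (\<lambda>s. s * g' t) \<le> 4 * E"
      using bd by (intro onorm_le) (simp add: abs_mult mult.commute mult_left_mono)
  qed (use gd in auto)
  moreover have "g 0 = 0"
    unfolding g_def by (subst sum.lessThan_Suc_shift) (simp add: c_def)
  moreover have "g 1 = f z - (\<Sum>j<Suc m. c j v)"
    by (simp add: g_def v_def)
  ultimately show ?thesis by (simp add: v_def)
qed

text \<open>The first-order term is exposed because the gradient of the Taylor polynomial at
  \<open>z0\<close> is read off from it.\<close>

lemma taylor_primitive:
  fixes c' :: "2 \<Rightarrow> nat \<Rightarrow> real^2 \<Rightarrow> real"
  assumes grad: "has_grad_on K f f'" and K: "convex K" "z0 \<in> K" "\<And>z d. z \<in> K \<Longrightarrow> \<bar>(z - z0) $ d\<bar> \<le> 2"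
    and hom: "\<And>d j t v. c' d j (t *\<^sub>R v) = t ^ j * c' d j v"
    and poly: "\<And>d j. (\<lambda>z. c' d j (z - z0)) \<in> poly2 j"
    and app: "\<And>d z. z \<in> K \<Longrightarrow> \<bar>f' d z - (\<Sum>j<m. c' d j (z - z0))\<bar> \<le> E"
  obtains c where "\<And>j t v. c j (t *\<^sub>R v) = t ^ j * c j v" "\<And>j. (\<lambda>z. c j (z - z0)) \<in> poly2 j"
    "\<And>v. c 0 v = f z0" "\<And>v. c (Suc 0) v = (\<Sum>d\<in>UNIV. v $ d * c' d 0 v)"
    "\<And>z. z \<in> K \<Longrightarrow> \<bar>f z - (\<Sum>j<Suc m. c j (z - z0))\<bar> \<le> 4 * E"
proof -
  define c where "c j v = (case j of 0 \<Rightarrow> f z0 | Suc i \<Rightarrow> (\<Sum>d\<in>UNIV. v $ d * c' d i v) / Suc i)" for j v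
  have c0: "c 0 v = f z0" "c (Suc j) v = (\<Sum>d\<in>UNIV. v $ d * c' d j v) / Suc j" for j v
    by (auto simp: c_def)
  show ?thesis
  proof (rule that[of c])
    show "\<bar>f z - (\<Sum>j<Suc m. c j (z - z0))\<bar> \<le> 4 * E" if "z \<in> K" for z
      by (rule taylor_step[where c = c and c' = c', OF grad K hom app c0 that])
    show "c j (t *\<^sub>R v) = t ^ j * c j v" for j t v
      by (cases j) (simp_all add: c0 hom sum_distrib_left mult_ac)
    show "(\<lambda>z. c j (z - z0)) \<in> poly2 j" for j
    proof (cases j)
      case 0
      then show ?thesis by (auto simp: c0 intro: poly2_const)
    next
      case (Suc i)
      have "(\<lambda>z. (1 / Suc i) * (\<Sum>d\<in>UNIV. (z - z0) $ d * c' d i (z - z0))) \<in> poly2 (Suc i)"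
        by (intro poly2_cmult poly2_sum poly2_mult_coord_diff poly) simp
      then show ?thesis by (simp add: Suc c0)
    qed
  qed (simp_all add: c0)
qed

text \<open>Recursion through the gradient: expand both partial derivatives, then integrate, at the
  cost of a factor 4 per order. Mixed derivatives and multi-indices never appear.\<close>

lemma taylor_homogeneous:
  assumes "deriv_bounded m A h K f" and K: "convex K" "z0 \<in> K" "\<And>z d. z \<in> K \<Longrightarrow> \<bar>(z - z0) $ d\<bar> \<le> 2"
  shows "\<exists>c. (\<forall>j t v. c j (t *\<^sub>R v) = t ^ j * c j v) \<and> (\<forall>j. (\<lambda>z. c j (z - z0)) \<in> poly2 j) \<and>
     (\<forall>v. c 0 v = f z0) \<and> (\<forall>z\<in>K. \<bar>f z - (\<Sum>j<m. c j (z - z0))\<bar> \<le> A * (4 * h) ^ m)"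
  using assms(1)
proof (induction m arbitrary: A f)
  case 0
  then show ?case
    \<comment> \<open>The sum over \<open>j < 0\<close> is empty, so the remainder is
      \<open>f\<close> itself, bounded by \<open>A\<close>.\<close>
    by (intro exI[of _ "\<lambda>j _. if j = 0 then f z0 else 0"]) (auto intro: poly2_const)
next
  case (Suc m)
  then obtain f' where grad: "has_grad_on K f f'" and f': "\<And>d. deriv_bounded m (A * h) h K (f' d)"
    by auto
  from Suc.IH[OF f'] obtain c' where c': "\<And>d j t v. c' d j (t *\<^sub>R v) = t ^ j * c' d j v"
     "\<And>d j. (\<lambda>z. c' d j (z - z0)) \<in> poly2 j"
     "\<And>d z. z\<in>K \<Longrightarrow> \<bar>f' d z - (\<Sum>j<m. c' d j (z - z0))\<bar> \<le> A * h * (4 * h) ^ m"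
    by metis
  obtain c where c: "\<And>j t v. c j (t *\<^sub>R v) = t ^ j * c j v" "\<And>j. (\<lambda>z. c j (z - z0)) \<in> poly2 j"
    "\<And>v. c 0 v = f z0" and "\<And>v. c (Suc 0) v = (\<Sum>d\<in>UNIV. v $ d * c' d 0 v)"
    and E: "\<And>z. z \<in> K \<Longrightarrow> \<bar>f z - (\<Sum>j<Suc m. c j (z - z0))\<bar> \<le> 4 * (A * h * (4 * h) ^ m)"
    by (rule taylor_primitive[where c' = c' and m = m, OF grad K c']) blast+
  have "4 * (A * h * (4 * h) ^ m) = A * (4 * h) ^ Suc m" by (simp add: mult_ac)
  then have "\<forall>z\<in>K. \<bar>f z - (\<Sum>j<Suc m. c j (z - z0))\<bar> \<le> A * (4 * h) ^ Suc m"
    using E by (simp only:) blast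
  with c(1-3) show ?case by (intro exI[of _ c]) blast
qed

text \<open>Degree \<open>m\<close> against a remainder of order \<open>Suc m\<close> is what an
  operator exact to degree \<open>m\<close> can exploit. The gradients are compared at the expansion
  point only, which will be the node of evaluation.\<close>

lemma taylor_poly2:
  assumes grad: "has_grad_on K f f'" and f': "\<And>d. deriv_bounded m (A * h) h K (f' d)" and h: "0 \<le> h"
    and K: "convex K" "z0 \<in> K" "\<And>z d. z \<in> K \<Longrightarrow> \<bar>(z - z0) $ d\<bar> \<le> 2"
  obtains P where "P \<in> poly2 m" "\<And>z. z\<in>K \<Longrightarrow> \<bar>f z - P z\<bar> \<le> A * (4 * h) ^ Suc m"
     "\<And>d. \<bar>pd d P z0 - f' d z0\<bar> \<le> A * h ^ Suc m"
proof -
  from taylor_homogeneous[OF f' K] obtain c' where c': "\<And>d j t v. c' d j (t *\<^sub>R v) = t ^ j * c' d j v"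
     "\<And>d j. (\<lambda>z. c' d j (z - z0)) \<in> poly2 j"
     "\<And>d z. z\<in>K \<Longrightarrow> \<bar>f' d z - (\<Sum>j<m. c' d j (z - z0))\<bar> \<le> A * h * (4 * h) ^ m"
     and c'0: "\<And>d v. c' d 0 v = f' d z0"
    by metis
  obtain c where chom: "\<And>j t v. c j (t *\<^sub>R v) = t ^ j * c j v" and cpoly: "\<And>j. (\<lambda>z. c j (z - z0)) \<in> poly2 j"
    and "\<And>v. c 0 v = f z0" and c1: "\<And>v. c (Suc 0) v = (\<Sum>d\<in>UNIV. v $ d * c' d 0 v)"
    and E: "\<And>z. z \<in> K \<Longrightarrow> \<bar>f z - (\<Sum>j<Suc m. c j (z - z0))\<bar> \<le> 4 * (A * h * (4 * h) ^ m)"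
    by (rule taylor_primitive[where c' = c' and m = m, OF grad K c']) blast+
  define P where "P z = (\<Sum>j<Suc m. c j (z - z0))" for z
  have P: "P \<in> poly2 m"
    unfolding P_def by (intro poly2_sum poly2_mono[OF cpoly]) auto
  have "\<bar>f z - P z\<bar> \<le> A * (4 * h) ^ Suc m" if "z \<in> K" for z
    using E[OF that] by (simp add: mult_ac P_def)
  moreover have "\<bar>pd d P z0 - f' d z0\<bar> \<le> A * h ^ Suc m" for d
  proof -
    \<comment> \<open>On a coordinate line through \<open>z0\<close> the homogeneous parts become
      powers of \<open>t\<close>, and only the linear one has a nonzero derivative at
      \<open>t = 0\<close>.\<close>
    have "(P has_derivative (\<lambda>v. \<Sum>d\<in>UNIV. pd d P z0 * v $ d)) (at (z0 + 0 *\<^sub>R axis d 1))"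
      using real_polynomial_function_derivative(1)[OF poly2_real_polynomial_function[OF P]] by simp
    then have "((\<lambda>t. P (z0 + t *\<^sub>R axis d 1)) has_derivative
        (\<lambda>t. \<Sum>e\<in>UNIV. pd e P z0 * (t *\<^sub>R axis d 1) $ e)) (at (0::real))"
      by (rule has_derivative_compose[rotated]) (auto intro!: derivative_eq_intros)
    then have D1: "((\<lambda>t. P (z0 + t *\<^sub>R axis d 1)) has_real_derivative pd d P z0) (at 0)"
      by (simp add: has_field_derivative_def axis_def if_distrib mult.commute mult_commute_abs cong: if_cong)
    have "(\<lambda>t. P (z0 + t *\<^sub>R axis d 1)) = (\<lambda>t. c 0 (axis d 1) + (\<Sum>j<m. t ^ Suc j * c (Suc j) (axis d 1)))"
      by (simp add: P_def chom sum.lessThan_Suc_shift del: sum.lessThan_Suc)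
    moreover have "((\<lambda>t. c 0 (axis d 1) + (\<Sum>j<m. t ^ Suc j * c (Suc j) (axis d 1))) has_real_derivative
        (\<Sum>j<m. (Suc j * 0 ^ j * c (Suc j) (axis d 1)))) (at 0)"
      by (auto intro!: derivative_eq_intros sum.cong)
    ultimately have "pd d P z0 = (\<Sum>j<m. (Suc j * 0 ^ j * c (Suc j) (axis d 1)))"
      using D1 DERIV_unique by auto
    \<comment> \<open>For \<open>m = 0\<close> the polynomial is constant with gradient zero; the
      bound \<open>A * h\<close> on \<open>f'\<close> itself then gives the estimate.\<close>
    also have "\<dots> = (if m = 0 then 0 else f' d z0)"
      by (cases m) (auto simp: sum.lessThan_Suc_shift c1 c'0 axis_def if_distrib if_distribR sum.If_cases
          simp del: sum.lessThan_Suc)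
    finally have pd_eq: "pd d P z0 = (if m = 0 then 0 else f' d z0)" .
    show ?thesis
    proof (cases "m = 0")
      case False
      have "0 \<le> A * h" using deriv_bounded_abs_le[OF f' K(2), of d] by linarith
      then have "0 \<le> A * h * h ^ m" using h by (metis mult_nonneg_nonneg zero_le_power)
      with False show ?thesis by (simp add: mult.assoc pd_eq)
    qed (use deriv_bounded_abs_le[OF f' K(2), of d] pd_eq in auto)
  qed
  ultimately show ?thesis using that P by blast
qed

section \<open>Piecewise smooth functions\<close>

lemma Ck_on_SucE:
  assumes "Ck_on (Suc m) K f"
  obtains f' where "has_grad_on K f f'" "\<And>d. Ck_on m K (f' d)"
proof -
  from assms obtain fx fy where
    d: "\<And>z. z \<in> K \<Longrightarrow> (f has_derivative (\<lambda>v. fx z * v $ 1 + fy z * v $ 2)) (at z within K)"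
    and "Ck_on m K fx" "Ck_on m K fy" by auto
  then show ?thesis
    by (intro that[of "\<lambda>d. if d = 1 then fx else fy"]) (auto simp: has_grad_on_def sum_2)
qed

lemma Ck_on_continuous: "Ck_on m K f \<Longrightarrow> continuous_on K f"
proof (cases m)
  case (Suc l)
  assume "Ck_on m K f"
  then obtain f' where "has_grad_on K f f'" using Ck_on_SucE Suc by blast
  then show ?thesis unfolding has_grad_on_def
    by (intro has_derivative_continuous_on[where f' = "\<lambda>z v. \<Sum>d\<in>UNIV. f' d z * v $ d"]) blast
qed simp

lemma compact_abs_bounded:
  fixes f :: "real^2 \<Rightarrow> real"
  assumes "compact K" "continuous_on K f" obtains B where "\<And>z. z \<in> K \<Longrightarrow> \<bar>f z\<bar> \<le> B"
  using compact_imp_bounded[OF compact_continuous_image[OF assms(2,1)]]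
  by (auto simp: bounded_iff)

lemma Ck_on_deriv_bounded:
  assumes "compact K" "Ck_on m K f" shows "\<exists>B. deriv_bounded m B 1 K f"
  using assms(2)
proof (induction m arbitrary: f)
  case 0
  then show ?case using compact_abs_bounded[OF assms(1), of f] by (metis Ck_on.simps(1) deriv_bounded.simps(1))
next
  case (Suc m)
  obtain f' where f': "has_grad_on K f f'" "\<And>d. Ck_on m K (f' d)"
    using Ck_on_SucE[OF Suc.prems] by blast
  obtain B where B: "\<And>d. deriv_bounded m (B d) 1 K (f' d)"
    using Suc.IH[OF f'(2)] by metis
  obtain B0 where B0: "\<And>z. z \<in> K \<Longrightarrow> \<bar>f z\<bar> \<le> B0"
    using compact_abs_bounded[OF assms(1) Ck_on_continuous[OF Suc.prems]] by blast
  define A where "A = max B0 (max (B 1) (B 2))"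
  have "B d \<le> A" for d using exhaust_2[of d] by (auto simp: A_def)
  then have "deriv_bounded m (A * 1) 1 K (f' d)" for d
    using deriv_bounded_mono[OF B] by simp
  moreover have "\<bar>f z\<bar> \<le> A" if "z \<in> K" for z using B0[OF that] by (simp add: A_def)
  ultimately have "deriv_bounded (Suc m) A 1 K f" using f'(1) by auto
  then show ?case ..
qed

text \<open>In the common interior, derivatives within either set are full derivatives, hence
  unique.\<close>

lemma has_grad_on_unique_interior:
  assumes "has_grad_on K f f'" "has_grad_on L g g'" "x \<in> interior K \<inter> interior L"
    "\<And>y. y \<in> interior K \<inter> interior L \<Longrightarrow> f y = g y"
  shows "f' d x = g' d x"
proof -
  have "x \<in> K" "x \<in> L" using assms(3) interior_subset by auto
  have "(f has_derivative (\<lambda>v. \<Sum>d\<in>UNIV. f' d x * v $ d)) (at x)"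
    using assms(1,3) \<open>x \<in> K\<close> at_within_interior[of x K] unfolding has_grad_on_def by (metis IntD1)
  moreover have "(g has_derivative (\<lambda>v. \<Sum>d\<in>UNIV. g' d x * v $ d)) (at x)"
    using assms(2,3) \<open>x \<in> L\<close> at_within_interior[of x L] unfolding has_grad_on_def by (metis IntD2)
  then have "(f has_derivative (\<lambda>v. \<Sum>d\<in>UNIV. g' d x * v $ d)) (at x)"
    by (rule has_derivative_transform_within_open[where s = "interior K \<inter> interior L"])
      (use assms(3,4) in auto)
  ultimately have "(\<lambda>v. \<Sum>d\<in>UNIV. f' d x * v $ d) = (\<lambda>v. \<Sum>d\<in>UNIV. g' d x * v $ d)"
    by (rule has_derivative_unique)
  from fun_cong[OF this, of "axis d 1"] show ?thesis
    by (simp add: axis_def if_distrib cong: if_cong)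
qed

lemma interior_frontier_closed:
  assumes "closed S" shows "interior (frontier S) = {}"
proof -
  have "interior (frontier S) \<subseteq> interior S"
    using assms by (intro interior_mono) (simp add: frontier_subset_closed)
  moreover have "interior (frontier S) \<subseteq> frontier S" by (rule interior_subset)
  ultimately show ?thesis by (auto simp: frontier_def)
qed

text \<open>The frontier of a closed set has empty interior, and so has a finite union of such
  frontiers. Every open part of \<open>E\<close> thus contains a point off all of them, which lies
  in the interior of the piece covering it.\<close>

lemma interior_subset_closure_interiors:
  assumes "finite J" and K: "\<And>j. j \<in> J \<Longrightarrow> closed (K j)" and cover: "E \<subseteq> (\<Union>j\<in>J. K j)"
  shows "interior E \<subseteq> closure (\<Union>j\<in>J. interior E \<inter> interior (K j))"
proof
  have fr: "interior (\<Union>j\<in>J. frontier (K j)) = {}"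
    using \<open>finite J\<close> K
  proof induction
    case (insert j J)
    then show ?case
      using interior_closed_Un_empty_interior[of "frontier (K j)" "\<Union>j\<in>J. frontier (K j)"]
        interior_frontier_closed[of "K j"] by simp
  qed simp
  fix x assume x: "x \<in> interior E"
  show "x \<in> closure (\<Union>j\<in>J. interior E \<inter> interior (K j))"
    unfolding closure_iff_nhds_not_empty
  proof (intro allI impI)
    fix A V assume V: "V \<subseteq> A" "open V" "x \<in> V"
    have "V \<inter> interior E \<noteq> {}" "open (V \<inter> interior E)" using V x by auto
    then have "\<not> V \<inter> interior E \<subseteq> (\<Union>j\<in>J. frontier (K j))"
      using fr interior_maximal by blast
    then obtain y where y: "y \<in> V" "y \<in> interior E" "\<And>j. j \<in> J \<Longrightarrow> y \<notin> frontier (K j)" by auto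
    then obtain j where "j \<in> J" "y \<in> K j" using cover interior_subset by blast
    moreover have "y \<in> interior (K j)"
      using y(3)[OF \<open>j \<in> J\<close>] \<open>y \<in> K j\<close> closure_subset by (auto simp: frontier_def)
    ultimately show "(\<Union>j\<in>J. interior E \<inter> interior (K j)) \<inter> A \<noteq> {}" using y V by blast
  qed
qed

text \<open>Off the boundaries of the finitely many pieces \<open>K j\<close>, a nowhere dense set, the derivatives
  on \<open>E\<close> are those on some \<open>K j\<close>; continuity extends the bound to all of \<open>E\<close>.\<close>

lemma deriv_bounded_from_pieces:
  assumes "finite J" and K: "\<And>j. j \<in> J \<Longrightarrow> closed (K j)" and E: "closed E" "E \<subseteq> closure (interior E)"
    and cover: "E \<subseteq> (\<Union>j\<in>J. K j)"
    and "\<And>j. j \<in> J \<Longrightarrow> deriv_bounded m B 1 (K j) (g j)"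
    and "\<And>j x. j \<in> J \<Longrightarrow> x \<in> interior E \<inter> interior (K j) \<Longrightarrow> f x = g j x"
    and "Ck_on m E f"
  shows "deriv_bounded m B 1 E f"
proof -
  define D where "D = (\<Union>j\<in>J. interior E \<inter> interior (K j))"
  have "interior E \<subseteq> closure D" unfolding D_def
    by (rule interior_subset_closure_interiors) (use assms in auto)
  then have "E \<subseteq> closure D" using E(2) closure_mono closure_closure by blast
  moreover have "closure D \<subseteq> E"
    using closure_minimal[of D E] E(1) interior_subset by (auto simp: D_def)
  ultimately have D: "closure D = E" by blast
  show ?thesis
    using assms(6-8)
  proof (induction m arbitrary: f g B)
    case (0 f g B)
    have "\<forall>x\<in>D. norm (f x) \<le> B"
      using 0(1,2) interior_subset unfolding D_def by fastforce
    with continuous_on_closure_norm_le[of D f B] show ?case using 0(3) by (simp add: D)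
  next
    case (Suc m f g B)
    obtain f' where f': "has_grad_on E f f'" "\<And>d. Ck_on m E (f' d)"
      using Ck_on_SucE[OF Suc.prems(3)] by blast
    have "\<forall>j\<in>J. \<exists>g'. has_grad_on (K j) (g j) g' \<and> (\<forall>d. deriv_bounded m B 1 (K j) (g' d))"
      using Suc.prems(1) by simp
    then obtain g' where g': "\<And>j. j \<in> J \<Longrightarrow> has_grad_on (K j) (g j) (g' j)"
      "\<And>j d. j \<in> J \<Longrightarrow> deriv_bounded m B 1 (K j) (g' j d)" by metis
    have "\<forall>x\<in>D. norm (f x) \<le> B"
      using Suc.prems(1,2) interior_subset unfolding D_def by fastforce
    with continuous_on_closure_norm_le[of D f B] have "\<forall>x\<in>E. \<bar>f x\<bar> \<le> B"
      using Ck_on_continuous[OF Suc.prems(3)] by (simp add: D)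
    \<comment> \<open>The induction replaces \<open>f\<close> and every \<open>g j\<close> by a
      component of its gradient. The gradients on the pieces are chosen separately, hence the index
      on \<open>g\<close>.\<close>
    moreover have "deriv_bounded m B 1 E (f' d)" for d
    proof (rule Suc.IH[where g = "\<lambda>j. g' j d"])
      fix j x assume "j \<in> J" "x \<in> interior E \<inter> interior (K j)"
      then show "f' d x = g' j d x"
        using has_grad_on_unique_interior[OF f'(1) g'(1)] Suc.prems(2) by blast
    qed (use f' g' in auto)
    ultimately show ?case using f'(1) by auto
  qed
qed

section \<open>The reference triangle\<close>

lemma range_vert: "range vert = {vert 0, vert 1, vert 2}"
proof -
  \<comment> \<open>Numerals of type \<open>3\<close> count modulo 3; the vertices are numbered from
    0.\<close>
  have "(3::3) = 0" by simp
  then have U: "(UNIV :: 3 set) = {0, 1, 2}" using UNIV_3 by (metis insert_commute)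
  show ?thesis unfolding U by simp
qed

lemma vert_simps: "vert 0 = vector [-1, -1]" "vert 1 = vector [1, -1]" "vert 2 = vector [-1, 1]"
  by (simp_all add: vert_def)

lemma ref_tri_eq: "ref_tri = {z. - 1 \<le> z $ 1 \<and> - 1 \<le> z $ 2 \<and> z $ 1 + z $ 2 \<le> 0}"
proof (intro set_eqI iffI)
  fix z assume "z \<in> ref_tri"
  then obtain u v w where "z = u *\<^sub>R vert 0 + v *\<^sub>R vert 1 + w *\<^sub>R vert 2" "0 \<le> u" "0 \<le> v" "0 \<le> w" "u + v + w = 1"
    by (auto simp: ref_tri_def range_vert convex_hull_3)
  then show "z \<in> {z. - 1 \<le> z $ 1 \<and> - 1 \<le> z $ 2 \<and> z $ 1 + z $ 2 \<le> 0}"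
    by (auto simp: vert_simps)
next
  fix z :: "real^2" assume z: "z \<in> {z. - 1 \<le> z $ 1 \<and> - 1 \<le> z $ 2 \<and> z $ 1 + z $ 2 \<le> 0}"
  have "z = ((- z$1 - z$2) / 2) *\<^sub>R vert 0 + ((1 + z$1) / 2) *\<^sub>R vert 1 + ((1 + z$2) / 2) *\<^sub>R vert 2"
    by (simp add: vert_simps vec_eq_iff forall_2 field_simps)
  moreover have "(- z$1 - z$2) / 2 + (1 + z$1) / 2 + (1 + z$2) / 2 = 1" by (simp add: field_simps)
  moreover have "0 \<le> (- z$1 - z$2) / 2" "0 \<le> (1 + z$1) / 2" "0 \<le> (1 + z$2) / 2" using z by auto
  ultimately show "z \<in> ref_tri"
    unfolding ref_tri_def range_vert convex_hull_3 by blast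
qed

lemma convex_ref_tri: "convex ref_tri"
  by (simp add: ref_tri_def)

lemma compact_ref_tri: "compact ref_tri"
  by (simp add: ref_tri_def finite_imp_compact_convex_hull)

lemma ref_tri_coord_diff: "z \<in> ref_tri \<Longrightarrow> w \<in> ref_tri \<Longrightarrow> \<bar>(z - w) $ d\<bar> \<le> 2"
  using exhaust_2[of d] by (auto simp: ref_tri_eq)

lemma facet_pt_in_ref_tri:
  assumes "t \<in> {-1..1}" shows "facet_pt a t \<in> ref_tri"
proof -
  have "vert b \<in> ref_tri" for b unfolding ref_tri_def by (simp add: hull_inc)
  then show ?thesis unfolding facet_pt_def using assms convex_ref_tri
    by (intro convexD) (auto simp: field_simps)
qed

lemma interior_ref_tri: "interior ref_tri \<noteq> {}"
proof -
  have "open {z::real^2. - 1 < z $ 1 \<and> - 1 < z $ 2 \<and> z $ 1 + z $ 2 < 0}"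
    by (intro open_Collect_conj open_Collect_less continuous_intros)
  then have "{z. - 1 < z $ 1 \<and> - 1 < z $ 2 \<and> z $ 1 + z $ 2 < 0} \<subseteq> interior ref_tri"
    by (intro interior_maximal) (auto simp: ref_tri_eq)
  moreover have "vector [-1/2, -1/2] \<in> {z::real^2. - 1 < z $ 1 \<and> - 1 < z $ 2 \<and> z $ 1 + z $ 2 < 0}"
    by simp
  ultimately show ?thesis by blast
qed

text \<open>Uniqueness on open sets does not reach the boundary, where the facet nodes lie.
  Convexity provides one-sided derivatives along the segments to the three vertices, and differences
  of these directions span the plane.\<close>

lemma has_derivative_unique_ref_tri:
  fixes f :: "real^2 \<Rightarrow> 'b::real_normed_vector"
  assumes "(f has_derivative D) (at z within ref_tri)" "(f has_derivative E) (at z within ref_tri)"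
    and z: "z \<in> ref_tri"
  shows "D = E"
proof -
  have lin: "linear D" "linear E" using assms has_derivative_linear by auto
  have dir: "D (y - z) = E (y - z)" if y: "y \<in> ref_tri" for y
  proof -
    have seg: "(\<lambda>t. z + t *\<^sub>R (y - z)) ` {0..1} \<subseteq> ref_tri"
    proof clarify
      fix t :: real assume "t \<in> {0..1}"
      then have "(1 - t) *\<^sub>R z + t *\<^sub>R y \<in> ref_tri" using convex_ref_tri z y by (intro convexD) auto
      then show "z + t *\<^sub>R (y - z) \<in> ref_tri" by (simp add: algebra_simps)
    qed
    have "((\<lambda>t. f (z + t *\<^sub>R (y - z))) has_vector_derivative F (y - z)) (at 0 within cbox 0 1)"
      if "(f has_derivative F) (at z within ref_tri)" for F
    proof -
      have "((\<lambda>t. f (z + t *\<^sub>R (y - z))) has_derivative (\<lambda>t. F (t *\<^sub>R (y - z)))) (at 0 within {0..1})"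
      proof (rule has_derivative_in_compose[where g = f])
        show "(f has_derivative F) (at (z + 0 *\<^sub>R (y - z)) within (\<lambda>t. z + t *\<^sub>R (y - z)) ` {0..1})"
          using has_derivative_subset[OF that seg] by simp
      qed (auto intro!: derivative_eq_intros)
      then show ?thesis using has_derivative_linear[OF that]
        by (simp add: has_vector_derivative_def linear_scale)
    qed
    from this[OF assms(1)] this[OF assms(2)] show ?thesis
      by (rule vector_derivative_unique_within_closed_interval[rotated 2]) auto
  qed
  have vert: "vert i \<in> ref_tri" for i by (simp add: ref_tri_def hull_inc)
  have "D (vert i - vert j) = E (vert i - vert j)" for i j
  proof -
    have "D ((vert i - z) - (vert j - z)) = E ((vert i - z) - (vert j - z))"
      using linear_diff[OF lin(1), of "vert i - z" "vert j - z"]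
        linear_diff[OF lin(2), of "vert i - z" "vert j - z"] dir[OF vert, of i] dir[OF vert, of j] by metis
    then show ?thesis by simp
  qed
  note * = this
  show ?thesis
  proof
    fix v :: "real^2"
    have v: "v = (v$1 / 2) *\<^sub>R (vert 1 - vert 0) + (v$2 / 2) *\<^sub>R (vert 2 - vert 0)"
      by (simp add: vert_simps vec_eq_iff forall_2)
    show "D v = E v"
      by (subst (1 2) v) (simp add: linear_add[OF lin(1)] linear_add[OF lin(2)] linear_scale[OF lin(1)] linear_scale[OF lin(2)] *)
  qed
qed

section \<open>Regular elements\<close>

text \<open>Constant of the iterated chain rule: each order brings a metric term bounded by
  \<open>C * h\<close>, a factor 2 for the two directions and \<open>2 ^ m\<close> from the Leibniz
  rule. The summand 1 keeps the constant at least 1, as the bound on the function itself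
  requires.\<close>

primrec chain_const :: "nat \<Rightarrow> real \<Rightarrow> real" where
  "chain_const 0 C = 1"
| "chain_const (Suc m) C = 1 + 2 ^ Suc m * chain_const m C * C"

lemma chain_const_ge_1: "0 \<le> C \<Longrightarrow> 1 \<le> chain_const m C"
  by (induction m) (auto intro!: mult_nonneg_nonneg)

text \<open>Cofactors of the Jacobian matrix, indexed so that \<open>\<Sum>d. cofactor c d * \<partial>\<^sub>d\<close> is \<open>jac\<close> times
  the physical derivative in direction \<open>c\<close>.\<close>

definition cofactor :: "mesh \<Rightarrow> nat \<Rightarrow> 2 \<Rightarrow> 2 \<Rightarrow> real^2 \<Rightarrow> real" where
  "cofactor M k c d z = (if c = d then 1 else -1) * metric_term M k (if c = 1 then 2 else 1) (if d = 1 then 2 else 1) z"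

lemma cofactor_simps:
  "cofactor M k 1 1 z = metric_term M k 2 2 z" "cofactor M k 1 2 z = - metric_term M k 2 1 z"
  "cofactor M k 2 1 z = - metric_term M k 1 2 z" "cofactor M k 2 2 z = metric_term M k 1 1 z"
  by (simp_all add: cofactor_def)

text \<open>Cramer's rule, in the order that inverts the chain rule.\<close>

lemma cofactor_metric_term:
  "(\<Sum>d\<in>UNIV. cofactor M k c d z * metric_term M k e d z) = (if c = e then jac M k z else 0)"
  using exhaust_2[of c] exhaust_2[of e] by (auto simp: sum_2 cofactor_simps jac_def algebra_simps)

text \<open>The other order of the product, which recovers a reference direction from its image; it
  bounds facet tangents from below.\<close>

lemma metric_term_cofactor:
  "(\<Sum>c\<in>UNIV. metric_term M k c d z * cofactor M k c e z) = (if d = e then jac M k z else 0)"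
  using exhaust_2[of d] exhaust_2[of e] by (auto simp: sum_2 cofactor_simps jac_def algebra_simps)

text \<open>A single element detached from its mesh, so that two neighbours can be handled by two
  interpretations with the same \<open>C\<close>.\<close>

locale regular_element =
  fixes M :: mesh and k :: nat and C :: real
  assumes polynomial: "\<And>c. real_polynomial_function (\<lambda>z. emap M k z $ c)"
    and inj: "inj_on (emap M k) ref_tri"
    and jac_pos: "\<And>z. z \<in> ref_tri \<Longrightarrow> 0 < jac M k z"
    and jac_ge: "\<And>z. z \<in> ref_tri \<Longrightarrow> elem_diam M k ^ 2 \<le> C * jac M k z"
    and emap_deriv_le: "\<And>z c i j. z \<in> ref_tri \<Longrightarrow> 1 \<le> i + j \<Longrightarrow>
        \<bar>(pd 1 ^^ i) ((pd 2 ^^ j) (\<lambda>z. emap M k z $ c)) z\<bar> \<le> C * elem_diam M k ^ (i + j)"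
begin

abbreviation h :: real where "h \<equiv> elem_diam M k"

lemma metric_term_polynomial: "real_polynomial_function (metric_term M k c d)"
  unfolding metric_term_def by (rule real_polynomial_function_derivative[OF polynomial])

lemma emap_has_derivative:
  "(emap M k has_derivative (\<lambda>v. \<chi> c. \<Sum>d\<in>UNIV. metric_term M k c d z * v $ d)) (at z within X)"
proof -
  have "((\<lambda>z. emap M k z $ c) has_derivative (\<lambda>v. \<Sum>d\<in>UNIV. metric_term M k c d z * v $ d)) (at z within X)" for c
    unfolding metric_term_def
    using real_polynomial_function_derivative(1)[OF polynomial] has_derivative_at_withinI by blast
  then have "((\<lambda>z. \<chi> c. emap M k z $ c) has_derivative (\<lambda>v. \<chi> c. \<Sum>d\<in>UNIV. metric_term M k c d z * v $ d)) (at z within X)"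
    by (subst has_derivative_componentwise_within) (auto simp: Basis_vec_def inner_axis)
  then show ?thesis by simp
qed

lemma emap_continuous: "continuous_on X (emap M k)"
  by (rule has_derivative_continuous_on[OF emap_has_derivative])

lemma compact_elem: "compact (elem M k)"
  unfolding elem_def by (rule compact_continuous_image[OF emap_continuous compact_ref_tri])

lemma emap_in_elem: "z \<in> ref_tri \<Longrightarrow> emap M k z \<in> elem M k"
  by (simp add: elem_def)

lemma h_pos: "0 < h"
proof -
  have "vert 0 \<in> ref_tri" "vert 1 \<in> ref_tri" by (simp_all add: ref_tri_def hull_inc)
  moreover have "vert 0 \<noteq> vert 1" by (simp add: vert_simps vec_eq_iff forall_2)
  ultimately have "emap M k (vert 0) \<noteq> emap M k (vert 1)" using inj by (auto dest: inj_onD)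
  then have "0 < dist (emap M k (vert 0)) (emap M k (vert 1))" by simp
  also have "\<dots> \<le> diameter (elem M k)"
    using compact_imp_bounded[OF compact_elem] \<open>vert 0 \<in> ref_tri\<close> \<open>vert 1 \<in> ref_tri\<close>
    by (intro diameter_bounded_bound emap_in_elem)
  finally show ?thesis by (simp add: elem_diam_def)
qed

lemma C_pos: "0 < C"
proof -
  obtain z where z: "z \<in> ref_tri" using interior_ref_tri interior_subset by blast
  have "0 < C * jac M k z" using jac_ge[OF z] h_pos by (meson less_le_trans zero_less_power)
  then show ?thesis using jac_pos[OF z] by (simp add: zero_less_mult_iff)
qed

lemma metric_term_abs_le: "z \<in> ref_tri \<Longrightarrow> \<bar>metric_term M k c d z\<bar> \<le> C * h"
  using emap_deriv_le[of z 1 0 c] emap_deriv_le[of z 0 1 c] exhaust_2[of d]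
  by (auto simp: metric_term_def)

lemma cofactor_abs_le: "z \<in> ref_tri \<Longrightarrow> \<bar>cofactor M k c d z\<bar> \<le> C * h"
  using metric_term_abs_le by (auto simp: cofactor_def)

lemma jac_abs_le:
  assumes "z \<in> ref_tri" shows "jac M k z \<le> 2 * C\<^sup>2 * h\<^sup>2"
proof -
  have "\<bar>metric_term M k a b z * metric_term M k c d z\<bar> \<le> (C * h) * (C * h)" for a b c d
    unfolding abs_mult using metric_term_abs_le[OF assms] C_pos h_pos by (intro mult_mono) auto
  from this[of 1 1 2 2] this[of 1 2 2 1] show ?thesis
    unfolding jac_def power2_eq_square by (simp add: mult_ac) 
qed

text \<open>Regularity bounds derivatives in which every \<open>pd 2\<close> is applied before any
  \<open>pd 1\<close>; a further \<open>pd 2\<close> must be moved past the \<open>pd 1\<close>, as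
  \<open>swap\<close> does. A metric term is a first derivative of the map and so starts at order
  \<open>h\<close>.\<close>

lemma metric_term_deriv_bounded: "deriv_bounded m (C * h) h ref_tri (metric_term M k c d)"
proof -
  have rp: "real_polynomial_function ((pd 1 ^^ i) ((pd 2 ^^ j) (\<lambda>z. emap M k z $ c)))" for i j
  proof -
    have *: "real_polynomial_function ((pd d ^^ i) f)" if "real_polynomial_function f" for d i f
      using that by (induction i) (auto intro: real_polynomial_function_derivative)
    show ?thesis by (intro * polynomial)
  qed
  have swap: "pd 2 ((pd 1 ^^ i) f) = (pd 1 ^^ i) (pd 2 f)" if "real_polynomial_function f" for i f
    using that
  proof (induction i arbitrary: f)
    case (Suc i)
    have "pd 2 ((pd 1 ^^ Suc i) f) = pd 2 ((pd 1 ^^ i) (pd 1 f))" by (simp only: funpow_Suc_right o_apply)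
    also have "\<dots> = (pd 1 ^^ i) (pd 2 (pd 1 f))"
      using Suc real_polynomial_function_derivative(2) by blast
    also have "\<dots> = (pd 1 ^^ Suc i) (pd 2 f)"
      by (simp only: pd_commute[OF Suc.prems, of 2 1] funpow_Suc_right o_apply)
    finally show ?case .
  qed simp
  have step: "deriv_bounded m (C * h ^ (i + j)) h ref_tri ((pd 1 ^^ i) ((pd 2 ^^ j) (\<lambda>z. emap M k z $ c)))"
    if "1 \<le> i + j" for i j
    using that
  proof (induction m arbitrary: i j)
    case 0
    then show ?case using emap_deriv_le by auto
  next
    case (Suc m)
    let ?f = "(pd 1 ^^ i) ((pd 2 ^^ j) (\<lambda>z. emap M k z $ c))"
    have "has_grad_on ref_tri ?f (\<lambda>d. pd d ?f)"
      unfolding has_grad_on_def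
      using real_polynomial_function_derivative(1)[OF rp] has_derivative_at_withinI by blast
    moreover have "deriv_bounded m (C * h ^ (i + j) * h) h ref_tri (pd d ?f)" for d
    proof -
      consider "d = 1" | "d = 2" using exhaust_2 by blast
      then show ?thesis
      proof cases
        case 1
        then show ?thesis using Suc.IH[of "Suc i" j] Suc.prems by (simp add: mult_ac)
      next
        case 2
        have "real_polynomial_function ((pd 2 ^^ j) (\<lambda>z. emap M k z $ c))"
          using rp[of 0 j] by simp
        then show ?thesis using Suc.IH[of i "Suc j"] Suc.prems 2 by (simp add: mult_ac swap)
      qed
    qed
    ultimately show ?case using emap_deriv_le Suc.prems by auto
  qed
  show ?thesis using step[of 1 0] step[of 0 1] exhaust_2[of d] by (auto simp: metric_term_def[abs_def])
qed

lemma cofactor_deriv_bounded: "deriv_bounded m (C * h) h ref_tri (cofactor M k c d)"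
proof -
  have "cofactor M k c d = metric_term M k (if c = 1 then 2 else 1) (if d = 1 then 2 else 1) \<or>
     cofactor M k c d = (\<lambda>z. - metric_term M k (if c = 1 then 2 else 1) (if d = 1 then 2 else 1) z)"
    by (auto simp: cofactor_def fun_eq_iff)
  then show ?thesis
    using metric_term_deriv_bounded deriv_bounded_uminus[OF metric_term_deriv_bounded] by metis
qed

lemma has_derivative_pullback:
  assumes "(f has_derivative (\<lambda>v. \<Sum>c\<in>UNIV. g c * v $ c)) (at (emap M k z) within elem M k)"
  shows "((\<lambda>z. f (emap M k z)) has_derivative
     (\<lambda>v. \<Sum>d\<in>UNIV. (\<Sum>c\<in>UNIV. g c * metric_term M k c d z) * v $ d)) (at z within ref_tri)"
proof -
  have "((\<lambda>z. f (emap M k z)) has_derivative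
     (\<lambda>v. \<Sum>c\<in>UNIV. g c * (\<chi> c. \<Sum>d\<in>UNIV. metric_term M k c d z * v $ d) $ c)) (at z within ref_tri)"
    using assms unfolding elem_def by (intro has_derivative_in_compose[OF emap_has_derivative])
  moreover have "(\<lambda>v. \<Sum>c\<in>UNIV. g c * (\<chi> c. \<Sum>d\<in>UNIV. metric_term M k c d z * v $ d) $ c) =
     (\<lambda>v::real^2. \<Sum>d\<in>UNIV. (\<Sum>c\<in>UNIV. g c * metric_term M k c d z) * v $ d)"
    by (simp add: fun_eq_iff sum_2 algebra_simps)
  ultimately show ?thesis by simp
qed

text \<open>Undoes the chain rule without division; in this form physical derivatives enter the
  split operators.\<close>

lemma cofactor_pullback:
  "(\<Sum>d\<in>UNIV. cofactor M k c d z * (\<Sum>e\<in>UNIV. g e * metric_term M k e d z)) = jac M k z * g c"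
proof -
  have "(\<Sum>d\<in>UNIV. cofactor M k c d z * (\<Sum>e\<in>UNIV. g e * metric_term M k e d z)) =
     (\<Sum>e\<in>UNIV. g e * (\<Sum>d\<in>UNIV. cofactor M k c d z * metric_term M k e d z))"
    by (simp add: sum_2 algebra_simps)
  then show ?thesis by (simp add: cofactor_metric_term if_distrib cong: if_cong)
qed

text \<open>Uniqueness on the reference triangle is transported by the invertible Jacobian matrix,
  so it holds up to the boundary of a curved element.\<close>

lemma gradient_unique:
  assumes "(f has_derivative (\<lambda>v. \<Sum>c\<in>UNIV. g c * v $ c)) (at (emap M k z) within elem M k)"
    "(f has_derivative (\<lambda>v. \<Sum>c\<in>UNIV. g' c * v $ c)) (at (emap M k z) within elem M k)"
    and z: "z \<in> ref_tri"
  shows "g c = g' c"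
proof -
  have eq: "(\<lambda>v::real^2. \<Sum>d\<in>UNIV. (\<Sum>c\<in>UNIV. g c * metric_term M k c d z) * v $ d) =
      (\<lambda>v. \<Sum>d\<in>UNIV. (\<Sum>c\<in>UNIV. g' c * metric_term M k c d z) * v $ d)"
    using has_derivative_unique_ref_tri[OF assms(1,2)[THEN has_derivative_pullback] z] .
  have "(\<Sum>c\<in>UNIV. g c * metric_term M k c d z) = (\<Sum>c\<in>UNIV. g' c * metric_term M k c d z)" for d
    using fun_cong[OF eq, of "axis d 1"] by (simp add: axis_def if_distrib cong: if_cong)
  then have "jac M k z * g c = jac M k z * g' c"
    unfolding cofactor_pullback[symmetric] by simp
  then show ?thesis using jac_pos[OF z] by simp
qed

text \<open>Every differentiation produces a metric term and with it one factor
  \<open>h\<close>.\<close>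

lemma deriv_bounded_pullback:
  assumes "deriv_bounded m B 1 (elem M k) f" "0 \<le> B"
  shows "deriv_bounded m (chain_const m C * B) h ref_tri (\<lambda>z. f (emap M k z))"
  using assms(1)
proof (induction m arbitrary: f)
  case 0
  then show ?case by (simp add: emap_in_elem)
next
  case (Suc m)
  then obtain f' where f': "has_grad_on (elem M k) f f'" "\<And>d. deriv_bounded m B 1 (elem M k) (f' d)"
    by auto
  have "has_grad_on ref_tri (\<lambda>z. f (emap M k z)) (\<lambda>d z. \<Sum>c\<in>UNIV. f' c (emap M k z) * metric_term M k c d z)"
    unfolding has_grad_on_def
  proof
    fix z assume "z \<in> ref_tri"
    then show "((\<lambda>z. f (emap M k z)) has_derivative (\<lambda>v. \<Sum>d\<in>UNIV. (\<Sum>c\<in>UNIV. f' c (emap M k z) * metric_term M k c d z) * v $ d)) (at z within ref_tri)"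
      using f'(1) emap_in_elem unfolding has_grad_on_def by (intro has_derivative_pullback) blast
  qed
  moreover have "deriv_bounded m (chain_const (Suc m) C * B * h) h ref_tri
      (\<lambda>z. \<Sum>c\<in>UNIV. f' c (emap M k z) * metric_term M k c d z)" for d
  proof -
    have "deriv_bounded m (2 ^ m * (chain_const m C * B) * (C * h)) h ref_tri
        (\<lambda>z. f' c (emap M k z) * metric_term M k c d z)" for c
      using Suc.IH[OF f'(2)] metric_term_deriv_bounded h_pos by (intro deriv_bounded_mult) auto
    from deriv_bounded_add[OF this[of 1] this[of 2]]
    have "deriv_bounded m (2 ^ Suc m * chain_const m C * C * (B * h)) h ref_tri
        (\<lambda>z. \<Sum>c\<in>UNIV. f' c (emap M k z) * metric_term M k c d z)"
      by (simp add: sum_2 mult_ac)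
    then show ?thesis
    proof (rule deriv_bounded_mono)
      have "(2 ^ Suc m * chain_const m C * C) * (B * h) \<le> (1 + 2 ^ Suc m * chain_const m C * C) * (B * h)"
        using assms(2) h_pos by (intro mult_right_mono) auto
      then show "2 ^ Suc m * chain_const m C * C * (B * h) \<le> chain_const (Suc m) C * B * h"
        by (simp add: mult_ac)
    qed (use h_pos in simp)
  qed
  moreover have "\<bar>f (emap M k z)\<bar> \<le> chain_const (Suc m) C * B" if "z \<in> ref_tri" for z
  proof -
    have "1 * B \<le> chain_const (Suc m) C * B"
      using assms(2) chain_const_ge_1[of C "Suc m"] C_pos by (intro mult_right_mono) auto
    moreover have "\<bar>f (emap M k z)\<bar> \<le> B" using Suc.prems emap_in_elem[OF that] by auto
    ultimately show ?thesis by linarith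
  qed
  ultimately show ?case by (auto simp del: chain_const.simps)
qed

text \<open>By injectivity and invariance of domain the map is open on the interior of the triangle,
  whose closure is the triangle. So bounds known on a dense part of the interior extend by
  continuity to the whole element.\<close>

lemma elem_subset_closure_interior: "elem M k \<subseteq> closure (interior (elem M k))"
proof -
  have "open (emap M k ` interior ref_tri)"
    using inj interior_subset by (intro invariance_of_domain emap_continuous) (auto intro: inj_on_subset)
  then have "emap M k ` interior ref_tri \<subseteq> interior (elem M k)"
    unfolding elem_def using interior_subset by (intro interior_maximal) auto
  moreover have "closure (interior ref_tri) = ref_tri"
    using convex_closure_interior[OF convex_ref_tri interior_ref_tri] compact_ref_tri
    by (simp add: compact_imp_closed closure_closed)
  then have "elem M k \<subseteq> closure (emap M k ` interior ref_tri)"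
    unfolding elem_def
    using image_closure_subset[of "interior ref_tri" "emap M k" "closure (emap M k ` interior ref_tri)"]
      emap_continuous closure_subset[of "emap M k ` interior ref_tri"] by simp
  ultimately show ?thesis using closure_mono by blast
qed

end

section \<open>Orders of magnitude\<close>

locale scaled_family =
  fixes U :: "'x set" and h :: "'x \<Rightarrow> real"
  assumes scale_pos: "\<And>x. x \<in> U \<Longrightarrow> 0 < h x"
begin

text \<open>Exponents are integers because inverse norm matrices and difference operators have
  negative order. The set \<open>I\<close> singles out the elements on which a given facet is of a
  given kind.\<close>

definition order :: "'x set \<Rightarrow> int \<Rightarrow> ('x \<Rightarrow> 'b::real_normed_vector) \<Rightarrow> bool" where
  "order I r f \<longleftrightarrow> (\<exists>C. \<forall>x\<in>U \<inter> I. norm (f x) \<le> C * h x powi r)"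

lemma orderI: "(\<And>x. x \<in> U \<Longrightarrow> x \<in> I \<Longrightarrow> norm (f x) \<le> C * h x powi r) \<Longrightarrow> order I r f"
  by (auto simp: order_def)

lemma powi_pos: "x \<in> U \<Longrightarrow> 0 < h x powi r"
  using scale_pos by simp

lemma orderE:
  assumes "order I r f"
  obtains C where "0 \<le> C" "\<And>x. x \<in> U \<Longrightarrow> x \<in> I \<Longrightarrow> norm (f x) \<le> C * h x powi r"
proof -
  obtain C where C: "\<And>x. x \<in> U \<Longrightarrow> x \<in> I \<Longrightarrow> norm (f x) \<le> C * h x powi r"
    using assms by (auto simp: order_def)
  have "norm (f x) \<le> max 0 C * h x powi r" if "x \<in> U" "x \<in> I" for x
    using C[OF that] mult_right_mono[of C "max 0 C" "h x powi r"] powi_pos[OF that(1), of r] by linarith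
  then show ?thesis using that by (metis max.cobounded1)
qed

lemma order_subset: "order I r f \<Longrightarrow> J \<subseteq> I \<Longrightarrow> order J r f"
  unfolding order_def by blast

lemma order_cong:
  "order I r f \<Longrightarrow> (\<And>x. x \<in> U \<Longrightarrow> x \<in> I \<Longrightarrow> f x = g x) \<Longrightarrow> order I r g"
  unfolding order_def by (metis Int_iff)

lemma order_le:
  assumes "order I r f" "\<And>x. x \<in> U \<Longrightarrow> x \<in> I \<Longrightarrow> norm (g x) \<le> norm (f x)"
  shows "order I r g"
  using assms unfolding order_def by (metis Int_iff order_trans)

lemma order_const: "order I 0 (\<lambda>_. c)"
  by (rule orderI[of _ _ "norm c"]) simp

lemma order_zero: "order I r (\<lambda>_. 0)"
  by (rule orderI[of _ _ 0]) simp

lemma order_add: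
  assumes "order I r f" "order I r g" shows "order I r (\<lambda>x. f x + g x)"
proof -
  obtain A where "\<And>x. x \<in> U \<Longrightarrow> x \<in> I \<Longrightarrow> norm (f x) \<le> A * h x powi r"
    using assms(1) by (rule orderE) blast
  moreover obtain B where "\<And>x. x \<in> U \<Longrightarrow> x \<in> I \<Longrightarrow> norm (g x) \<le> B * h x powi r"
    using assms(2) by (rule orderE) blast
  ultimately have "norm (f x + g x) \<le> (A + B) * h x powi r" if "x \<in> U" "x \<in> I" for x
    unfolding distrib_right using that by (intro norm_triangle_mono)
  then show ?thesis by (rule orderI)
qed

lemma order_minus: "order I r f \<Longrightarrow> order I r (\<lambda>x. - f x)"
  by (simp add: order_def)

lemma order_diff: "order I r f \<Longrightarrow> order I r g \<Longrightarrow> order I r (\<lambda>x. f x - g x)"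
  using order_add[of I r f "\<lambda>x. - g x"] order_minus by auto

lemma order_sum: "(\<And>i. i \<in> A \<Longrightarrow> order I r (f i)) \<Longrightarrow> order I r (\<lambda>x. \<Sum>i\<in>A. f i x)"
  by (induction A rule: infinite_finite_induct) (auto intro: order_zero order_add)

text \<open>The range of summation varies with the element but lies in a finite type. Extension by
  zero makes it constant, and each summand needs its bound only where it occurs.\<close>

lemma order_sum_dependent:
  assumes "\<And>a::'a::finite. order (I \<inter> {x. a \<in> A x}) r (f a)"
  shows "order I r (\<lambda>x. \<Sum>a\<in>A x. f a x)"
proof -
  have "order I r (\<lambda>x. \<Sum>a\<in>UNIV. if a \<in> A x then f a x else 0)"
  proof (rule order_sum)
    fix a
    obtain C where C: "0 \<le> C" "\<And>x. x \<in> U \<Longrightarrow> x \<in> I \<inter> {x. a \<in> A x} \<Longrightarrow> norm (f a x) \<le> C * h x powi r"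
      using assms[of a] by (rule orderE) blast
    show "order I r (\<lambda>x. if a \<in> A x then f a x else 0)"
      by (rule orderI[of _ _ C]) (use C powi_pos[THEN less_imp_le] in \<open>auto intro!: mult_nonneg_nonneg\<close>)
  qed
  then show ?thesis by (simp add: sum.If_cases)
qed

lemma order_mult:
  fixes f g :: "'x \<Rightarrow> 'b::real_normed_field"
  assumes "order I r f" "order I s g" "t = r + s" shows "order I t (\<lambda>x. f x * g x)"
proof -
  obtain A where A: "0 \<le> A" "\<And>x. x \<in> U \<Longrightarrow> x \<in> I \<Longrightarrow> norm (f x) \<le> A * h x powi r"
    using assms(1) by (rule orderE) blast
  obtain B where B: "0 \<le> B" "\<And>x. x \<in> U \<Longrightarrow> x \<in> I \<Longrightarrow> norm (g x) \<le> B * h x powi s"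
    using assms(2) by (rule orderE) blast
  have "norm (f x * g x) \<le> (A * B) * h x powi t" if "x \<in> U" "x \<in> I" for x
  proof -
    have "norm (f x) * norm (g x) \<le> (A * h x powi r) * (B * h x powi s)"
      using A B that powi_pos[OF that(1), of r] powi_pos[OF that(1), of s] by (intro mult_mono) auto
    then show ?thesis using scale_pos[OF that(1)] by (simp add: assms(3) norm_mult power_int_add mult_ac)
  qed
  then show ?thesis by (rule orderI)
qed

lemma order_vec:
  fixes f :: "'x \<Rightarrow> 'b::real_normed_vector^'n::finite"
  shows "order I r f \<longleftrightarrow> (\<forall>i. order I r (\<lambda>x. f x $ i))"
proof
  assume "order I r f"
  then show "\<forall>i. order I r (\<lambda>x. f x $ i)"
    by (intro allI) (erule order_le, rule Finite_Cartesian_Product.norm_nth_le)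
next
  assume "\<forall>i. order I r (\<lambda>x. f x $ i)"
  then have "order I r (\<lambda>x. \<Sum>i\<in>UNIV. norm (f x $ i))"
    by (intro order_sum) (simp add: order_def)
  then show "order I r f"
    by (rule order_le) (simp add: norm_vec_def L2_set_le_sum sum_nonneg)
qed

lemma order_matrix_vector:
  fixes A :: "'x \<Rightarrow> real^'n^'m"
  assumes "order I r A" "order I s v" "t = r + s" shows "order I t (\<lambda>x. A x *v v x)"
  using assms unfolding order_vec matrix_vector_mult_def
  by (auto intro!: order_sum order_mult[where r = r and s = s])

lemma order_matrix_mult:
  fixes A :: "'x \<Rightarrow> real^'n^'m" and B :: "'x \<Rightarrow> real^'l^'n"
  assumes "order I r A" "order I s B" "t = r + s" shows "order I t (\<lambda>x. A x ** B x)"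
  using assms unfolding order_vec matrix_matrix_mult_def
  by (auto intro!: order_sum order_mult[where r = r and s = s])

lemma order_transpose:
  fixes A :: "'x \<Rightarrow> real^'n^'m"
  assumes "order I r A" shows "order I r (\<lambda>x. transpose (A x))"
  using assms unfolding order_vec transpose_def by simp

lemma order_diag:
  assumes "\<And>i. order I r (\<lambda>x. v x i)" shows "order I r (\<lambda>x. diag (v x))"
proof -
  have "order I r (\<lambda>x. if i = j then v x i else 0)" for i j
    using assms order_zero by (cases "i = j") auto
  then show ?thesis unfolding order_vec diag_def by simp
qed

lemma order_cmult: 
  fixes f :: "'x \<Rightarrow> real"
  shows "order I r f \<Longrightarrow> order I r (\<lambda>x. c * f x)"
  by (rule order_mult[OF order_const]) auto

lemma order_scaleR:
  assumes "order I r f" shows "order I r (\<lambda>x. c *\<^sub>R f x)"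
proof -
  obtain C where "\<And>x. x \<in> U \<Longrightarrow> x \<in> I \<Longrightarrow> norm (f x) \<le> C * h x powi r"
    using assms by (rule orderE) blast
  then show ?thesis
    by (intro orderI[of _ _ "\<bar>c\<bar> * C"]) (auto simp: mult.assoc intro!: mult_left_mono)
qed

text \<open>Here \<open>r\<close> is the order of the function itself, 0 for pullbacks of physical
  functions and 1 for metric terms; each derivative adds another factor \<open>h\<close>.\<close>

definition smooth :: "nat \<Rightarrow> nat \<Rightarrow> ('x \<Rightarrow> real^2 \<Rightarrow> real) \<Rightarrow> bool" where
  "smooth m r F \<longleftrightarrow> (\<exists>A. \<forall>x\<in>U. deriv_bounded m (A * h x ^ r) (h x) ref_tri (F x))"

lemma smooth_add:
  assumes "smooth m r F" "smooth m r F'" shows "smooth m r (\<lambda>x z. F x z + F' x z)"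
proof -
  obtain A B where "\<And>x. x \<in> U \<Longrightarrow> deriv_bounded m (A * h x ^ r) (h x) ref_tri (F x)"
    "\<And>x. x \<in> U \<Longrightarrow> deriv_bounded m (B * h x ^ r) (h x) ref_tri (F' x)"
    using assms by (auto simp: smooth_def)
  then have "deriv_bounded m ((A + B) * h x ^ r) (h x) ref_tri (\<lambda>z. F x z + F' x z)" if "x \<in> U" for x
    using deriv_bounded_add that by (simp add: distrib_right)
  then show ?thesis unfolding smooth_def by blast
qed

lemma smooth_mult:
  assumes "smooth m r F" "smooth m s F'" shows "smooth m (r + s) (\<lambda>x z. F x z * F' x z)"
proof -
  obtain A B where AB: "\<And>x. x \<in> U \<Longrightarrow> deriv_bounded m (A * h x ^ r) (h x) ref_tri (F x)"
    "\<And>x. x \<in> U \<Longrightarrow> deriv_bounded m (B * h x ^ s) (h x) ref_tri (F' x)"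
    using assms by (auto simp: smooth_def)
  have "deriv_bounded m ((2 ^ m * A * B) * h x ^ (r + s)) (h x) ref_tri (\<lambda>z. F x z * F' x z)" if "x \<in> U" for x
    using deriv_bounded_mult[OF AB[OF that]] scale_pos[OF that] by (simp add: power_add mult_ac)
  then show ?thesis unfolding smooth_def by blast
qed

lemma smooth_order:
  assumes "smooth m r F" "\<And>x. x \<in> U \<Longrightarrow> z x \<in> ref_tri" shows "order I (int r) (\<lambda>x. F x (z x))"
proof -
  obtain A where "\<And>x. x \<in> U \<Longrightarrow> deriv_bounded m (A * h x ^ r) (h x) ref_tri (F x)"
    using assms by (auto simp: smooth_def)
  then show ?thesis using deriv_bounded_abs_le assms(2) by (intro orderI[of _ _ A]) fastforce
qed

end

section \<open>Accuracy of the reference operators\<close>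

lemma diag_vector_mult: "(diag v *v u) $ i = v i * u $ i"
proof -
  have "(\<Sum>j\<in>UNIV. (if i = j then v i else 0) * u $ j) = (\<Sum>j\<in>UNIV. if i = j then v i * u $ j else 0)"
    by (intro sum.cong) auto
  then show ?thesis by (simp add: diag_def matrix_vector_mult_def)
qed

lemma diag_mult_nth: "(diag v ** A) $ i $ j = v i * A $ i $ j"
proof -
  have "(\<Sum>l\<in>UNIV. (if i = l then v i else 0) * A $ l $ j) = (\<Sum>l\<in>UNIV. if i = l then v i * A $ l $ j else 0)"
    by (intro sum.cong) auto
  then show ?thesis by (simp add: diag_def matrix_matrix_mult_def)
qed

lemma mult_diag_nth: "(A ** diag v) $ i $ j = A $ i $ j * v j"
proof -
  have "(\<Sum>l\<in>UNIV. A $ i $ l * (if l = j then v l else 0)) = (\<Sum>l\<in>UNIV. if l = j then A $ i $ l * v l else 0)"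
    by (intro sum.cong) auto
  then show ?thesis by (simp add: diag_def matrix_matrix_mult_def)
qed

lemma diag_mult_diag: "diag v ** diag w = diag (\<lambda>i. v i * w i)"
proof -
  have "(diag v ** diag w) $ i $ j = diag (\<lambda>i. v i * w i) $ i $ j" for i j
    by (simp add: diag_mult_nth) (simp add: diag_def)
  then show ?thesis by (simp add: vec_eq_iff)
qed

lemma matrix_inv_diag:
  assumes "\<And>i. v i \<noteq> 0" shows "matrix_inv (diag v) = diag (\<lambda>i. 1 / v i)"
proof -
  have 1: "diag (\<lambda>i. 1::real) = mat 1" by (simp add: diag_def mat_def)
  have eq: "diag v ** diag (\<lambda>i. 1 / v i) = mat 1" "diag (\<lambda>i. 1 / v i) ** diag v = mat 1"
    using assms by (simp_all add: diag_mult_diag 1)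
  then have "invertible (diag v)" unfolding invertible_def by blast
  then have "matrix_inv (diag v) ** diag v = mat 1"
    unfolding invertible_def matrix_inv_def by (metis (mono_tags, lifting) someI_ex)
  then have "matrix_inv (diag v) = matrix_inv (diag v) ** (diag v ** diag (\<lambda>i. 1 / v i))"
    by (simp add: eq matrix_mul_rid)
  also have "\<dots> = (matrix_inv (diag v) ** diag v) ** diag (\<lambda>i. 1 / v i)" by (simp add: matrix_mul_assoc)
  finally show ?thesis by (simp add: \<open>matrix_inv (diag v) ** diag v = mat 1\<close> matrix_mul_lid)
qed

text \<open>\<open>deriv_bounded\<close> speaks of some gradient; uniqueness on the triangle carries
  its bounds over to a prescribed one.\<close>

lemma deriv_bounded_grad_ref_tri:
  assumes "deriv_bounded (Suc m) A h ref_tri f" "has_grad_on ref_tri f f'"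
  shows "deriv_bounded m (A * h) h ref_tri (f' d)"
proof -
  obtain g' where g': "has_grad_on ref_tri f g'" "\<And>d. deriv_bounded m (A * h) h ref_tri (g' d)"
    using assms(1) by auto
  have "f' d z = g' d z" if "z \<in> ref_tri" for z
  proof -
    have eq: "(\<lambda>v::real^2. \<Sum>d\<in>UNIV. f' d z * v $ d) = (\<lambda>v. \<Sum>d\<in>UNIV. g' d z * v $ d)"
      using assms(2) g'(1) that unfolding has_grad_on_def
      by (intro has_derivative_unique_ref_tri[where f = f and z = z]) blast+
    from fun_cong[OF this, of "axis d 1"] show ?thesis
      by (simp add: axis_def if_distrib cong: if_cong)
  qed
  with g'(2) show ?thesis using deriv_bounded_cong by blast
qed

text \<open>Both estimates expand \<open>f\<close> at the point where the operator is evaluated: the Taylor polynomial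
  there has the same value and gradient up to the remainder, and the operator is exact for it.\<close>

lemma node_sum_diff_le:
  assumes "\<And>j. vnode S j \<in> ref_tri" "\<And>z. z \<in> ref_tri \<Longrightarrow> \<bar>f z - P z\<bar> \<le> E"
  shows "\<bar>(A *v ref_nodal S f) $ i - (A *v ref_nodal S P) $ i\<bar> \<le> (\<Sum>j\<in>UNIV. \<bar>A $ i $ j\<bar>) * E"
proof -
  have "(A *v ref_nodal S f) $ i - (A *v ref_nodal S P) $ i =
      (\<Sum>j\<in>UNIV. A $ i $ j * (f (vnode S j) - P (vnode S j)))"
    by (simp add: matrix_vector_mult_def ref_nodal_def sum_subtractf algebra_simps)
  also have "\<bar>\<dots>\<bar> \<le> (\<Sum>j\<in>UNIV. \<bar>A $ i $ j\<bar> * E)"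
    using assms by (intro order_trans[OF sum_abs] sum_mono) (auto simp: abs_mult intro!: mult_left_mono)
  finally show ?thesis by (simp add: sum_distrib_right)
qed

lemma sbp_operatorD:
  assumes "sbp_operator p S"
  shows "vnode S i \<in> ref_tri" "0 < vwt S i" "legendre_gauss p (fpos S) (fwt S)"
    "f \<in> poly2 p \<Longrightarrow> (Rref S a *v ref_nodal S f) $ j = f (facet_pt a (fpos S j))"
    "f \<in> poly2 p \<Longrightarrow> matrix_inv (Href S) ** Qref S d *v ref_nodal S f = ref_nodal S (pd d f)"
    "transpose (Qref S d - (1/2) *\<^sub>R Eref S d) = - (Qref S d - (1/2) *\<^sub>R Eref S d)"
    "transpose (Eref S d) = Eref S d"
  using assms by (simp_all add: sbp_operator_def)

lemma legendre_gaussD: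
  assumes "legendre_gauss p t w"
  shows "t i \<in> {-1..1}" "inj t" "\<exists>j. t j = - t i \<and> w j = w i"
  using assms by (simp_all add: legendre_gauss_def less_imp_le)

lemma extrapolation_error:
  assumes S: "sbp_operator p S" and f: "deriv_bounded (Suc m) A h ref_tri f" and "0 \<le> h" "m \<le> p"
  shows "\<bar>(Rref S a *v ref_nodal S f) $ i - f (facet_pt a (fpos S i))\<bar>
     \<le> ((\<Sum>j\<in>UNIV. \<bar>Rref S a $ i $ j\<bar>) + 1) * (A * (4 * h) ^ Suc m)"
proof -
  let ?z = "facet_pt a (fpos S i)"
  obtain f' where f': "has_grad_on ref_tri f f'" "\<And>d. deriv_bounded m (A * h) h ref_tri (f' d)"
    using f by auto
  have z: "?z \<in> ref_tri"
    using legendre_gaussD(1)[OF sbp_operatorD(3)[OF S]] by (rule facet_pt_in_ref_tri)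
  obtain P where P: "P \<in> poly2 m" "\<And>z. z\<in>ref_tri \<Longrightarrow> \<bar>f z - P z\<bar> \<le> A * (4 * h) ^ Suc m"
     "\<And>d. \<bar>pd d P ?z - f' d ?z\<bar> \<le> A * h ^ Suc m"
    by (rule taylor_poly2[OF f' \<open>0 \<le> h\<close> convex_ref_tri z ref_tri_coord_diff[OF _ z]]) blast+
  have "P \<in> poly2 p" using P(1) \<open>m \<le> p\<close> by (rule poly2_mono)
  then have "(Rref S a *v ref_nodal S P) $ i = P ?z"
    by (rule sbp_operatorD(4)[OF S])
  moreover have "\<bar>(Rref S a *v ref_nodal S f) $ i - (Rref S a *v ref_nodal S P) $ i\<bar>
      \<le> (\<Sum>j\<in>UNIV. \<bar>Rref S a $ i $ j\<bar>) * (A * (4 * h) ^ Suc m)"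
    by (intro node_sum_diff_le P sbp_operatorD(1)[OF S])
  ultimately show ?thesis using P(2)[OF z] by (simp add: distrib_right)
qed

definition Dref :: "('n::finite, 'f::finite) sbp \<Rightarrow> 2 \<Rightarrow> real^'n^'n" where
  "Dref S d = matrix_inv (Href S) ** Qref S d"

lemma differentiation_error:
  assumes S: "sbp_operator p S" and f: "deriv_bounded (Suc m) A h ref_tri f" "has_grad_on ref_tri f f'"
    and "0 \<le> h" "m \<le> p"
  shows "\<bar>(Dref S d *v ref_nodal S f) $ i - f' d (vnode S i)\<bar>
     \<le> ((\<Sum>j\<in>UNIV. \<bar>Dref S d $ i $ j\<bar>) + 1) * (A * (4 * h) ^ Suc m)"
proof -
  let ?z = "vnode S i"
  have f': "\<And>d. deriv_bounded m (A * h) h ref_tri (f' d)"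
    using deriv_bounded_grad_ref_tri[OF f] .
  have z: "?z \<in> ref_tri" by (rule sbp_operatorD(1)[OF S])
  obtain P where P: "P \<in> poly2 m" "\<And>z. z\<in>ref_tri \<Longrightarrow> \<bar>f z - P z\<bar> \<le> A * (4 * h) ^ Suc m"
     "\<And>d. \<bar>pd d P ?z - f' d ?z\<bar> \<le> A * h ^ Suc m"
    by (rule taylor_poly2[OF f(2) f' \<open>0 \<le> h\<close> convex_ref_tri z ref_tri_coord_diff[OF _ z]]) blast+
  have "P \<in> poly2 p" using P(1) \<open>m \<le> p\<close> by (rule poly2_mono)
  then have "(Dref S d *v ref_nodal S P) $ i = pd d P ?z"
    by (simp add: sbp_operatorD(5)[OF S] Dref_def ref_nodal_def[of S "pd d P"])
  moreover have "\<bar>(Dref S d *v ref_nodal S f) $ i - (Dref S d *v ref_nodal S P) $ i\<bar>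
      \<le> (\<Sum>j\<in>UNIV. \<bar>Dref S d $ i $ j\<bar>) * (A * (4 * h) ^ Suc m)"
    by (intro node_sum_diff_le P sbp_operatorD(1)[OF S])
  moreover have "A * h ^ Suc m \<le> A * (4 * h) ^ Suc m"
  proof -
    have "0 \<le> A" using deriv_bounded_abs_le[OF f(1) z] by linarith
    then show ?thesis using \<open>0 \<le> h\<close> by (intro mult_left_mono power_mono) auto
  qed
  ultimately show ?thesis using P(3)[of d] by (simp only: distrib_right)
qed

context scaled_family begin

lemma extrapolation_order:
  assumes S: "sbp_operator p S" and F: "smooth (Suc m) r F" and "m \<le> p"
  shows "order I (int (r + Suc m)) (\<lambda>x. (Rref S a *v ref_nodal S (F x)) $ i - F x (facet_pt a (fpos S i)))"
proof -
  obtain A where A: "\<And>x. x \<in> U \<Longrightarrow> deriv_bounded (Suc m) (A * h x ^ r) (h x) ref_tri (F x)"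
    using F unfolding smooth_def by blast
  show ?thesis
  proof (rule orderI)
    fix x assume "x \<in> U"
    from extrapolation_error[OF S A[OF this] _ \<open>m \<le> p\<close>, of a i] scale_pos[OF this]
    show "norm ((Rref S a *v ref_nodal S (F x)) $ i - F x (facet_pt a (fpos S i)))
      \<le> (((\<Sum>j\<in>UNIV. \<bar>Rref S a $ i $ j\<bar>) + 1) * A * 4 ^ Suc m) * h x powi int (r + Suc m)"
      unfolding power_int_of_nat by (simp add: power_mult_distrib power_add mult_ac del: of_nat_add)
  qed
qed

lemma differentiation_order:
  assumes S: "sbp_operator p S" and F: "smooth (Suc m) r F" "\<And>x. x \<in> U \<Longrightarrow> has_grad_on ref_tri (F x) (F' x)"
    and "m \<le> p"
  shows "order I (int (r + Suc m)) (\<lambda>x. (Dref S d *v ref_nodal S (F x)) $ i - F' x d (vnode S i))"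
proof -
  obtain A where A: "\<And>x. x \<in> U \<Longrightarrow> deriv_bounded (Suc m) (A * h x ^ r) (h x) ref_tri (F x)"
    using F unfolding smooth_def by blast
  show ?thesis
  proof (rule orderI)
    fix x assume "x \<in> U"
    from differentiation_error[OF S A[OF this] F(2)[OF this] _ \<open>m \<le> p\<close>, of d i] scale_pos[OF this]
    show "norm ((Dref S d *v ref_nodal S (F x)) $ i - F' x d (vnode S i))
      \<le> (((\<Sum>j\<in>UNIV. \<bar>Dref S d $ i $ j\<bar>) + 1) * A * 4 ^ Suc m) * h x powi int (r + Suc m)"
      unfolding power_int_of_nat by (simp add: power_mult_distrib power_add mult_ac del: of_nat_add)
  qed
qed

end

section \<open>Accuracy of the physical operators\<close>

lemma matrix_vector_diff: "(A - B) *v (u::real^'n) = A *v u - B *v u"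
  by (simp add: vec_eq_iff matrix_vector_mult_def sum_subtractf algebra_simps)

lemma matrix_vector_uminus: "(- A) *v (u::real^'n) = - (A *v u)"
  by (simp add: vec_eq_iff matrix_vector_mult_def sum_negf)

lemma matrix_vector_scaleR: "(c *\<^sub>R A) *v (u::real^'n) = c *\<^sub>R (A *v u)"
  by (simp add: vec_eq_iff matrix_vector_mult_def sum_distrib_left mult_ac)

lemma matrix_vector_sum: "(\<Sum>i\<in>I. A i) *v (u::real^'n) = (\<Sum>i\<in>I. A i *v u)"
  by (induction I rule: infinite_finite_induct)
    (auto simp: matrix_vector_mult_add_rdistrib) 

lemma matrix_vector_sum_right: "A *v (\<Sum>i\<in>I. (u i::real^'n)) = (\<Sum>i\<in>I. A *v u i)"
  by (induction I rule: infinite_finite_induct)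
    (auto simp: matrix_vector_right_distrib) 

lemma diag_vector_ref_nodal: "diag (\<lambda>i. g (vnode S i)) *v ref_nodal S f = ref_nodal S (\<lambda>z. g z * f z)"
  by (simp add: vec_eq_iff diag_vector_mult ref_nodal_def)

lemma transpose_diag_mult_nth:
  "(transpose A ** diag v ** A) $ n $ m = (\<Sum>i\<in>UNIV. A $ i $ n * v i * A $ i $ m)"
  unfolding matrix_matrix_mult_def[of "transpose A ** diag v"]
  by (simp add: mult_diag_nth) (simp add: transpose_def)

text \<open>The summation-by-parts identity: the skew part cancels in \<open>Q\<close> plus its
  transpose, and the symmetric part \<open>E\<close> remains.\<close>

lemma Qref_transpose:
  assumes "sbp_operator p S" shows "transpose (Qref S d) = Eref S d - Qref S d"
proof -
  have "transpose (Qref S d) $ i $ j = (Eref S d - Qref S d) $ i $ j" for i j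
  proof -
    have "transpose (Qref S d - (1/2) *\<^sub>R Eref S d) $ i $ j = (- (Qref S d - (1/2) *\<^sub>R Eref S d)) $ i $ j"
      "transpose (Eref S d) $ i $ j = Eref S d $ i $ j"
      using sbp_operatorD(6,7)[OF assms, of d] by simp_all
    then show ?thesis by (simp add: transpose_def)
  qed
  then show ?thesis by (simp add: vec_eq_iff)
qed

lemma Qref_eq_Dref:
  assumes "sbp_operator p S" shows "(Qref S d *v u) $ i = vwt S i * (Dref S d *v u) $ i"
proof -
  have w: "vwt S i \<noteq> 0" for i using sbp_operatorD(2)[OF assms, of i] by simp
  have "(Dref S d *v u) $ i = (matrix_inv (Href S) *v (Qref S d *v u)) $ i"
    by (simp add: Dref_def matrix_vector_mul_assoc)
  also have "\<dots> = 1 / vwt S i * (Qref S d *v u) $ i"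
    using w by (simp add: Href_def matrix_inv_diag diag_vector_mult)
  finally show ?thesis using w by simp
qed

text \<open>Nanson's formula: cofactors carry the reference normal to the physical normal scaled by
  arc length. Where the tangent vanishes, both sides are 0.\<close>

lemma facet_normal_scaled:
  "norm (facet_tangent M k a z) * facet_normal M k a z $ c =
     (\<Sum>d\<in>UNIV. ref_normal a $ d * cofactor M k c d z)"
proof -
  have "norm (facet_tangent M k a z) * facet_normal M k a z $ c = rot_cw (facet_tangent M k a z) $ c"
    by (cases "facet_tangent M k a z = 0") (use exhaust_2[of c] in \<open>auto simp: facet_normal_def rot_cw_def\<close>)
  then show ?thesis
    using exhaust_2[of c] by (auto simp: rot_cw_def facet_tangent_def ref_normal_def sum_2 cofactor_simps)
qed

definition facet_perm :: "('n::finite, 'f::finite) sbp \<Rightarrow> mesh \<Rightarrow> nat \<Rightarrow> 3 \<Rightarrow> 'f \<Rightarrow> 'f" where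
  "facet_perm S M k a i = (THE j. fpos S j = orient M k a * fpos S i)"

text \<open>The Legendre-Gauss rule is symmetric about 0, so reversing a facet sends nodes to nodes
  of equal weight; distinctness of the nodes makes the index unique.\<close>

lemma facet_perm:
  assumes "sbp_operator p S"
  shows "fpos S (facet_perm S M k a i) = orient M k a * fpos S i"
    "fwt S (facet_perm S M k a i) = fwt S i"
    "bij (facet_perm S M k a)"
proof -
  note lg = legendre_gaussD[OF sbp_operatorD(3)[OF assms]]
  have *: "fpos S (facet_perm S M k a i) = orient M k a * fpos S i \<and> fwt S (facet_perm S M k a i) = fwt S i" for i
  proof -
    obtain j where j: "fpos S j = orient M k a * fpos S i" "fwt S j = fwt S i"
    proof (cases "orient M k a = 1")
      case False
      then have "orient M k a = - 1" by (auto simp: orient_def split: if_splits)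
      then show ?thesis using lg(3)[of i] that by auto
    qed (use that in auto)
    have "facet_perm S M k a i = j"
      unfolding facet_perm_def
    proof (rule the_equality)
      show "j' = j" if "fpos S j' = orient M k a * fpos S i" for j'
        using that j(1) injD[OF lg(2)] by simp
    qed (rule j(1))
    then show ?thesis using j by simp
  qed
  then show "fpos S (facet_perm S M k a i) = orient M k a * fpos S i"
    "fwt S (facet_perm S M k a i) = fwt S i" by auto
  have "orient M k a \<noteq> 0" by (simp add: orient_def)
  then have "inj (facet_perm S M k a)"
    using * injD[OF lg(2)] unfolding inj_def by (metis mult_left_cancel)
  then show "bij (facet_perm S M k a)"
    by (intro bijI finite_UNIV_inj_surj) simp_all
qed

lemma Rk_nth: "Rk S M k a $ i = Rref S a $ facet_perm S M k a i"
  by (simp add: Rk_def facet_perm_def)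

lemma Rk_vector_nth: "(Rk S M k a *v u) $ i = (Rref S a *v u) $ facet_perm S M k a i"
  by (simp add: matrix_vector_mult_def Rk_nth)

lemma fref_eq: "sbp_operator p S \<Longrightarrow> fref S M k a i = facet_pt a (fpos S (facet_perm S M k a i))"
  by (simp add: fref_def facet_perm)

lemma fref_in_ref_tri: "sbp_operator p S \<Longrightarrow> fref S M k a i \<in> ref_tri"
  unfolding fref_eq by (intro facet_pt_in_ref_tri legendre_gaussD(1)[OF sbp_operatorD(3)])

definition facet_wt :: "('n::finite, 'f::finite) sbp \<Rightarrow> 3 \<Rightarrow> 'f \<Rightarrow> real" where
  "facet_wt S a i = fwt S i * (facet_len a / 2)"

text \<open>Reversing a facet permutes nodes and weights together and leaves the sum over the nodes
  unchanged. The reference boundary operator can thus be compared with \<open>Ek\<close> facet by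
  facet through the same extrapolations.\<close>

lemma Eref_eq_Rk:
  assumes "sbp_operator p S"
  shows "Eref S d = (\<Sum>a\<in>UNIV. transpose (Rk S M k a) ** diag (\<lambda>i. facet_wt S a i * ref_normal a $ d) ** Rk S M k a)"
  unfolding Eref_def
proof (rule sum.cong)
  fix a :: 3
  have "(transpose (Rref S a) ** (Bref S a ** diag (\<lambda>_. ref_normal a $ d)) ** Rref S a) $ n $ m =
     (transpose (Rk S M k a) ** diag (\<lambda>i. facet_wt S a i * ref_normal a $ d) ** Rk S M k a) $ n $ m" for n m
  proof -
    let ?g = "\<lambda>i. Rref S a $ i $ n * (facet_wt S a i * ref_normal a $ d) * Rref S a $ i $ m"
    have "(\<Sum>i\<in>UNIV. ?g (facet_perm S M k a i)) = (\<Sum>i\<in>UNIV. ?g i)"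
      by (rule sum.reindex_bij_betw[OF facet_perm(3)[OF assms]])
    then show ?thesis
      by (simp add: Bref_def diag_mult_diag transpose_diag_mult_nth Rk_nth facet_perm[OF assms] facet_wt_def)
  qed
  then show "transpose (Rref S a) ** Bref S a ** diag (\<lambda>_. ref_normal a $ d) ** Rref S a =
     transpose (Rk S M k a) ** diag (\<lambda>i. facet_wt S a i * ref_normal a $ d) ** Rk S M k a"
    by (simp add: vec_eq_iff matrix_mul_assoc)
qed simp

text \<open>The arc-length factor cancels the normalization of the normal. What is left is linear in
  the cofactors, which are smooth on the whole triangle for polynomial maps.\<close>

lemma Bk_mult_Nk: "Bk S M k a ** Nk S M k a c =
    diag (\<lambda>i. facet_wt S a i * (\<Sum>d\<in>UNIV. ref_normal a $ d * cofactor M k c d (fref S M k a i)))"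
  unfolding Bk_def Jf_def Bref_def Nk_def diag_mult_diag facet_wt_def
  by (intro arg_cong[where f = diag] ext) (simp only: facet_normal_scaled[symmetric] mult_ac)

lemma diag_uminus: "diag (\<lambda>i. - v i) = - diag v"
  by (simp add: vec_eq_iff diag_def)

text \<open>Replacing the transpose of \<open>Q\<close> by \<open>E - Q\<close> displays the average
  of the advective form, cofactor times derivative, and the conservative form, derivative of the
  product. The \<open>E\<close> term is left to cancel against \<open>Ek\<close>.\<close>

lemma Sxy_vector:
  assumes "sbp_operator p S"
  shows "(if c = 1 then Sx S M k else Sy S M k) *v ref_nodal S f =
     (\<Sum>d\<in>UNIV. (1/2) *\<^sub>R (diag (\<lambda>i. cofactor M k c d (vnode S i)) *v (Qref S d *v ref_nodal S f)
        + Qref S d *v ref_nodal S (\<lambda>z. cofactor M k c d z * f z)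
        - Eref S d *v ref_nodal S (\<lambda>z. cofactor M k c d z * f z)))"
proof -
  let ?A = "\<lambda>c d. diag (\<lambda>i. cofactor M k c d (vnode S i))"
  have A: "metric_diag S M k 2 2 = ?A 1 1" "metric_diag S M k 2 1 = - ?A 1 2"
    "metric_diag S M k 1 2 = - ?A 2 1" "metric_diag S M k 1 1 = ?A 2 2"
    by (simp_all add: metric_diag_def cofactor_simps diag_uminus)
  have "(if c = 1 then Sx S M k else Sy S M k) *v ref_nodal S f =
     (\<Sum>d\<in>UNIV. (1/2) *\<^sub>R (?A c d *v (Qref S d *v ref_nodal S f) - transpose (Qref S d) *v (?A c d *v ref_nodal S f)))"
    using exhaust_2[of c]
    by (auto simp: Sx_def Sy_def A sum_2 matrix_vector_mult_add_rdistrib matrix_vector_scaleR matrix_vector_diff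
        matrix_vector_uminus matrix_vector_mul_assoc[symmetric] vec.neg)
  also have "\<dots> = (\<Sum>d\<in>UNIV. (1/2) *\<^sub>R (diag (\<lambda>i. cofactor M k c d (vnode S i)) *v (Qref S d *v ref_nodal S f)
        + Qref S d *v ref_nodal S (\<lambda>z. cofactor M k c d z * f z)
        - Eref S d *v ref_nodal S (\<lambda>z. cofactor M k c d z * f z)))"
    by (simp add: Qref_transpose[OF assms] matrix_vector_diff diag_vector_ref_nodal[of "cofactor M k c _"] algebra_simps)
  finally show ?thesis .
qed

section \<open>Uniform orders of the operators over a family of meshes\<close>

locale mesh_family =
  fixes S :: "('n::finite, 'f::finite) sbp" and p :: nat and M :: "nat \<Rightarrow> mesh" and C :: real
  assumes sbp: "sbp_operator p S"
    and regular: "\<And>n k. k \<in> elems (M n) \<Longrightarrow> regular_element (M n) k C"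
begin

text \<open>Pairs of mesh index and element index: a constant over this set is uniform in the mesh
  as well as in the element.\<close>

definition elements :: "(nat \<times> nat) set" where
  "elements = {x. snd x \<in> elems (M (fst x))}"

definition diam :: "nat \<times> nat \<Rightarrow> real" where
  "diam x = elem_diam (M (fst x)) (snd x)"

lemma regular_elementI: "x \<in> elements \<Longrightarrow> regular_element (M (fst x)) (snd x) C"
  using regular by (simp add: elements_def)

sublocale scaled_family elements diam
  by unfold_locales (simp add: diam_def regular_element.h_pos[OF regular_elementI])

abbreviation cof :: "nat \<times> nat \<Rightarrow> 2 \<Rightarrow> 2 \<Rightarrow> real^2 \<Rightarrow> real" where
  "cof x \<equiv> cofactor (M (fst x)) (snd x)"

abbreviation metr :: "nat \<times> nat \<Rightarrow> 2 \<Rightarrow> 2 \<Rightarrow> real^2 \<Rightarrow> real" where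
  "metr x \<equiv> metric_term (M (fst x)) (snd x)"

abbreviation J :: "nat \<times> nat \<Rightarrow> real^2 \<Rightarrow> real" where
  "J x \<equiv> jac (M (fst x)) (snd x)"

abbreviation emap' :: "nat \<times> nat \<Rightarrow> real^2 \<Rightarrow> real^2" where
  "emap' x \<equiv> emap (M (fst x)) (snd x)"

abbreviation RR :: "nat \<times> nat \<Rightarrow> 3 \<Rightarrow> real^'n^'f" where
  "RR x \<equiv> Rk S (M (fst x)) (snd x)"

abbreviation DD :: "nat \<times> nat \<Rightarrow> 2 \<Rightarrow> real^'n^'n" where
  "DD x \<equiv> Dk S (M (fst x)) (snd x)"

abbreviation EE :: "nat \<times> nat \<Rightarrow> 2 \<Rightarrow> real^'n^'n" where
  "EE x \<equiv> Ek S (M (fst x)) (snd x)"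

abbreviation SS :: "nat \<times> nat \<Rightarrow> 2 \<Rightarrow> real^'n^'n" where
  "SS x c \<equiv> if c = 1 then Sx S (M (fst x)) (snd x) else Sy S (M (fst x)) (snd x)"

abbreviation fnode :: "nat \<times> nat \<Rightarrow> 3 \<Rightarrow> 'f \<Rightarrow> real^2" where
  "fnode x \<equiv> fref S (M (fst x)) (snd x)"

lemma fnode_in: "fnode x a i \<in> ref_tri"
  by (rule fref_in_ref_tri[OF sbp])

lemma vnode_in: "vnode S i \<in> ref_tri"
  by (rule sbp_operatorD(1)[OF sbp])

lemma smooth_metric_term: "smooth m 1 (\<lambda>x. metr x c d)"
  unfolding smooth_def
  using regular_element.metric_term_deriv_bounded[OF regular_elementI]
  by (intro exI[of _ C]) (simp add: diam_def)

lemma smooth_cofactor: "smooth m 1 (\<lambda>x. cof x c d)"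
  unfolding smooth_def
  using regular_element.cofactor_deriv_bounded[OF regular_elementI]
  by (intro exI[of _ C]) (simp add: diam_def)

text \<open>The index may vary with the element, as the facet permutation does; domination by the
  sum over all indices keeps one constant.\<close>

lemma order_select:
  fixes f :: "'i::finite \<Rightarrow> nat \<times> nat \<Rightarrow> 'b::real_normed_vector"
  assumes "\<And>j. order I r (f j)" shows "order I r (\<lambda>x. f (s x) x)"
proof (rule order_le)
  show "order I r (\<lambda>x. \<Sum>j\<in>UNIV. norm (f j x))"
    using assms by (intro order_sum) (simp add: order_def)
  show "norm (f (s x) x) \<le> norm (\<Sum>j\<in>UNIV. norm (f j x))" for x
    using member_le_sum[of "s x" UNIV "\<lambda>j. norm (f j x)"] by (simp add: sum_nonneg)
qed

lemma order_Rk_error: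
  assumes "smooth (Suc m) r F" "m \<le> p"
  shows "order I (int (r + Suc m)) (\<lambda>x. (RR x a *v ref_nodal S (F x)) $ i - F x (fnode x a i))"
  unfolding Rk_vector_nth fref_eq[OF sbp]
  by (rule order_select[where f = "\<lambda>j x. (Rref S a *v ref_nodal S (F x)) $ j - F x (facet_pt a (fpos S j))"
        and s = "\<lambda>x. facet_perm S (M (fst x)) (snd x) a i"])
    (rule extrapolation_order[OF sbp assms])

lemma order_Rk: "order I 0 (\<lambda>x. RR x a)"
proof (subst order_vec, rule allI)
  fix i
  show "order I 0 (\<lambda>x. RR x a $ i)"
    unfolding Rk_nth
    by (rule order_select[where f = "\<lambda>l x. Rref S a $ l" and s = "\<lambda>x. facet_perm S (M (fst x)) (snd x) a i"])
      (rule order_const)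
qed

lemma order_Bk_mult_Nk: "order I 1 (\<lambda>x. Bk S (M (fst x)) (snd x) a ** Nk S (M (fst x)) (snd x) a c)"
  unfolding Bk_mult_Nk
proof (intro order_diag order_cmult order_sum)
  fix i d
  show "order I 1 (\<lambda>x. cof x c d (fnode x a i))"
    using smooth_order[OF smooth_cofactor[of 0] fnode_in] by simp
qed

lemma order_jac_inverse: "order I (-2) (\<lambda>x. 1 / (\<bar>J x (vnode S i)\<bar> * vwt S i))"
proof (rule orderI)
  fix x assume x: "x \<in> elements"
  interpret regular_element "M (fst x)" "snd x" C by (rule regular_elementI[OF x])
  have J: "0 < J x (vnode S i)" "diam x ^ 2 \<le> C * J x (vnode S i)"
    using jac_pos jac_ge vnode_in by (auto simp: diam_def)
  have w: "0 < vwt S i" by (rule sbp_operatorD(2)[OF sbp])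
  have "1 / J x (vnode S i) \<le> C / diam x ^ 2"
    using J scale_pos[OF x] by (simp add: field_simps)
  then have "1 / J x (vnode S i) / vwt S i \<le> C / diam x ^ 2 / vwt S i"
    using w by (intro divide_right_mono) auto
  then show "norm (1 / (\<bar>J x (vnode S i)\<bar> * vwt S i)) \<le> C / vwt S i * diam x powi - 2"
    using J(1) w by (simp add: power_int_minus field_simps)
qed

lemma Hk_eq: "Hk S (M (fst x)) (snd x) = diag (\<lambda>i. \<bar>J x (vnode S i)\<bar> * vwt S i)"
  by (simp add: Hk_def Href_def diag_mult_diag)

lemma matrix_inv_Hk:
  assumes "x \<in> elements"
  shows "matrix_inv (Hk S (M (fst x)) (snd x)) = diag (\<lambda>i. 1 / (\<bar>J x (vnode S i)\<bar> * vwt S i))"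
  unfolding Hk_eq
proof (rule matrix_inv_diag)
  fix i
  show "\<bar>J x (vnode S i)\<bar> * vwt S i \<noteq> 0"
    using regular_element.jac_pos[OF regular_elementI[OF assms] vnode_in[of i]] sbp_operatorD(2)[OF sbp, of i] by simp
qed

lemma order_Hk_inverse: "order I (-2) (\<lambda>x. matrix_inv (Hk S (M (fst x)) (snd x)))"
  by (rule order_cong[OF order_diag[OF order_jac_inverse]]) (simp add: matrix_inv_Hk)

lemma order_metric_diag: "order I 1 (\<lambda>x. metric_diag S (M (fst x)) (snd x) c d)"
  unfolding metric_diag_def
proof (intro order_diag)
  fix i
  show "order I 1 (\<lambda>x. metr x c d (vnode S i))"
    using smooth_order[OF smooth_metric_term[of 0] vnode_in] by simp
qed

lemma order_Ek: "order I 1 (\<lambda>x. EE x c)"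
  unfolding Ek_def matrix_mul_assoc[symmetric, of _ "Bk S _ _ _"]
  by (intro order_sum order_matrix_mult[where r = 1 and s = 0] order_matrix_mult[where r = 0 and s = 1]
      order_transpose order_Rk order_Bk_mult_Nk) auto

lemma order_Dk: "order I (-1) (\<lambda>x. DD x c)"
proof -
  have mQ: "order I 1 (\<lambda>x. metric_diag S (M (fst x)) (snd x) a b ** Q)" for a b Q
    by (rule order_matrix_mult[OF order_metric_diag order_const]) simp
  have Qm: "order I 1 (\<lambda>x. Q ** metric_diag S (M (fst x)) (snd x) a b)" for a b and Q :: "real^'n^'n"
    by (rule order_matrix_mult[OF order_const order_metric_diag]) simp
  have "order I 1 (\<lambda>x. SS x c + (1/2) *\<^sub>R EE x c)"
    unfolding Sx_def Sy_def
    by (cases "c = 1") (auto intro!: order_add order_diff order_minus order_scaleR mQ Qm order_Ek)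
  then show ?thesis
    unfolding Dk_def by (rule order_matrix_mult[OF order_Hk_inverse]) simp
qed

text \<open>The boundary part of the summation-by-parts operator cancels up to the extrapolation errors.\<close>

lemma order_Ek_error:
  assumes F: "smooth (Suc m) r F" and "m \<le> p"
  shows "order I (int (r + m + 2)) (\<lambda>x. EE x c *v ref_nodal S (F x) -
     (\<Sum>d\<in>UNIV. Eref S d *v ref_nodal S (\<lambda>z. cof x c d z * F x z)))"
proof -
  \<comment> \<open>The commutator of extrapolation with multiplication by a cofactor, contracted
    with the reference normal.\<close>
  define w where "w x a i = facet_wt S a i * (\<Sum>d\<in>UNIV. ref_normal a $ d * (cof x c d (fnode x a i) * (RR x a *v ref_nodal S (F x)) $ i
      - (RR x a *v ref_nodal S (\<lambda>z. cof x c d z * F x z)) $ i))" for x a i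
  have eq: "EE x c *v ref_nodal S (F x) -
     (\<Sum>d\<in>UNIV. Eref S d *v ref_nodal S (\<lambda>z. cof x c d z * F x z)) = (\<Sum>a\<in>UNIV. transpose (RR x a) *v (\<chi> i. w x a i))" for x
  proof -
    have 1: "EE x c *v ref_nodal S (F x) = (\<Sum>a\<in>UNIV. transpose (RR x a) *v
        (diag (\<lambda>i. facet_wt S a i * (\<Sum>d\<in>UNIV. ref_normal a $ d * cof x c d (fnode x a i))) *v (RR x a *v ref_nodal S (F x))))"
      by (simp add: Ek_def matrix_vector_sum matrix_vector_mul_assoc matrix_mul_assoc Bk_mult_Nk[symmetric])
    have 2: "(\<Sum>d\<in>UNIV. Eref S d *v ref_nodal S (\<lambda>z. cof x c d z * F x z)) = (\<Sum>a\<in>UNIV. transpose (RR x a) *v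
        (\<Sum>d\<in>UNIV. diag (\<lambda>i. facet_wt S a i * ref_normal a $ d) *v (RR x a *v ref_nodal S (\<lambda>z. cof x c d z * F x z))))"
      unfolding Eref_eq_Rk[OF sbp, of _ "M (fst x)" "snd x"] matrix_vector_sum matrix_vector_sum_right
      by (subst sum.swap) (simp add: matrix_vector_mul_assoc matrix_mul_assoc)
    have 3: "diag (\<lambda>i. facet_wt S a i * (\<Sum>d\<in>UNIV. ref_normal a $ d * cof x c d (fnode x a i))) *v (RR x a *v ref_nodal S (F x))
       - (\<Sum>d\<in>UNIV. diag (\<lambda>i. facet_wt S a i * ref_normal a $ d) *v (RR x a *v ref_nodal S (\<lambda>z. cof x c d z * F x z)))
       = (\<chi> i. w x a i)" for a
      by (simp add: vec_eq_iff diag_vector_mult w_def sum_2 algebra_simps)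
    show ?thesis
      unfolding 1 2 sum_subtractf[symmetric] 
      by (simp add: 3[symmetric] matrix_vector_mult_diff_distrib)
  qed
  have "order I (int (r + m + 2)) (\<lambda>x. w x a i)" for a i
    unfolding w_def
  proof (intro order_cmult order_sum)
    fix d
    \<comment> \<open>Both products are compared with the exact product at the facet node. The
      cofactor supplies one power of \<open>h\<close> beyond the extrapolation error.\<close>
    have A: "order I (int (r + m + 2)) (\<lambda>x. cof x c d (fnode x a i) * ((RR x a *v ref_nodal S (F x)) $ i - F x (fnode x a i)))"
      by (rule order_mult[OF smooth_order[OF smooth_cofactor[of 0] fnode_in] order_Rk_error[OF assms]]) simp
    have "smooth (Suc m) (1 + r) (\<lambda>x z. cof x c d z * F x z)"
      by (intro smooth_mult smooth_cofactor F)
    from order_Rk_error[OF this \<open>m \<le> p\<close>]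
    have B: "order I (int (r + m + 2)) (\<lambda>x. (RR x a *v ref_nodal S (\<lambda>z. cof x c d z * F x z)) $ i - cof x c d (fnode x a i) * F x (fnode x a i))"
      by (simp add: add_ac)
    from order_diff[OF A B]
    show "order I (int (r + m + 2)) (\<lambda>x. cof x c d (fnode x a i) * (RR x a *v ref_nodal S (F x)) $ i
      - (RR x a *v ref_nodal S (\<lambda>z. cof x c d z * F x z)) $ i)"
      by (simp add: algebra_simps)
  qed
  then have "order I (int (r + m + 2)) (\<lambda>x. \<chi> i. w x a i)" for a
    unfolding order_vec by simp
  then show ?thesis
    unfolding eq by (intro order_sum order_matrix_vector[OF order_transpose[OF order_Rk]]) auto
qed

text \<open>The derivatives of the cofactors cancel in the average of the advective and the conservative
  form, because their divergence vanishes.\<close>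

lemma cofactor_divergence:
  assumes "x \<in> elements" shows "(\<Sum>d\<in>UNIV. pd d (cof x c d) z) = 0"
proof -
  interpret regular_element "M (fst x)" "snd x" C by (rule regular_elementI[OF assms])
  have neg: "pd d (\<lambda>z. - f z) = (\<lambda>z. - pd d f z)" if "real_polynomial_function f" for f d
  proof
    fix z
    from pd_eqI[OF has_derivative_minus[OF real_polynomial_function_derivative(1)[OF that]]]
    show "pd d (\<lambda>z. - f z) z = - pd d f z" by (simp add: axis_def if_distrib cong: if_cong)
  qed
  have "cof x 1 1 = metr x 2 2" "cof x 1 2 = (\<lambda>z. - metr x 2 1 z)"
    "cof x 2 1 = (\<lambda>z. - metr x 1 2 z)" "cof x 2 2 = metr x 1 1"
    by (simp_all add: fun_eq_iff cofactor_simps)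
  then show ?thesis
    using exhaust_2[of c] pd_commute[OF polynomial, of 1 2]
    by (auto simp: sum_2 neg metric_term_polynomial) (simp_all add: metric_term_def)
qed

lemma has_grad_on_mult_cofactor:
  assumes "x \<in> elements" "has_grad_on ref_tri f f'"
  shows "has_grad_on ref_tri (\<lambda>z. cof x c d z * f z) (\<lambda>e z. cof x c d z * f' e z + pd e (cof x c d) z * f z)"
  unfolding has_grad_on_def
proof
  fix z assume "z \<in> ref_tri"
  interpret regular_element "M (fst x)" "snd x" C by (rule regular_elementI[OF assms(1)])
  have "real_polynomial_function (cof x c d)"
  proof -
    have "cof x c d = (\<lambda>z. (if c = d then 1 else - 1) * metr x (if c = 1 then 2 else 1) (if d = 1 then 2 else 1) z)"
      by (simp add: fun_eq_iff cofactor_def)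
    then show ?thesis using metric_term_polynomial by (simp add: real_polynomial_function.intros)
  qed
  then have "(cof x c d has_derivative (\<lambda>v. \<Sum>e\<in>UNIV. pd e (cof x c d) z * v $ e)) (at z within ref_tri)"
    using real_polynomial_function_derivative(1) has_derivative_at_withinI by blast
  from has_derivative_mult[OF this] assms(2) \<open>z \<in> ref_tri\<close>
  have "((\<lambda>z. cof x c d z * f z) has_derivative (\<lambda>v. cof x c d z * (\<Sum>e\<in>UNIV. f' e z * v $ e) + (\<Sum>e\<in>UNIV. pd e (cof x c d) z * v $ e) * f z)) (at z within ref_tri)"
    unfolding has_grad_on_def by blast
  then show "((\<lambda>z. cof x c d z * f z) has_derivative (\<lambda>v. \<Sum>e\<in>UNIV. (cof x c d z * f' e z + pd e (cof x c d) z * f z) * v $ e)) (at z within ref_tri)"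
    by (rule has_derivative_eq_rhs) (simp add: fun_eq_iff sum_2 algebra_simps)
qed

text \<open>Differentiation on the reference triangle and the boundary mismatch both err by order
  \<open>r + m + 2\<close>: \<open>Suc m\<close> from the expansion, \<open>r\<close> from
  \<open>F\<close> and one from the cofactor. The inverse of \<open>Hk\<close> takes away two. The
  exact part of the bracket is \<open>jac\<close> times the physical derivative, which the inverse
  of \<open>Hk\<close> turns into \<open>g\<close>.\<close>

lemma order_Dk_error:
  assumes F: "smooth (Suc m) r F" and "m \<le> p"
    and g: "\<And>x. x \<in> elements \<Longrightarrow> has_grad_on ref_tri (F x) (\<lambda>d z. \<Sum>e\<in>UNIV. g x e z * metr x e d z)"
  shows "order I (int (r + m)) (\<lambda>x. DD x c *v ref_nodal S (F x) - ref_nodal S (g x c))"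
  unfolding order_vec
proof
  fix i
  define F' where "F' x d z = (\<Sum>e\<in>UNIV. g x e z * metr x e d z)" for x d z
  have F': "has_grad_on ref_tri (F x) (F' x)" if "x \<in> elements" for x
    using g[OF that] by (simp add: F'_def[abs_def])
  define u where "u x = ref_nodal S (F x)" for x
  define Au where "Au x d = ref_nodal S (\<lambda>z. cof x c d z * F x z)" for x d
  let ?z = "vnode S i"
  \<comment> \<open>Errors of the advective and the conservative form at node \<open>i\<close>. The
    exact value of the latter contains the derivative of the cofactor, which drops out only after
    summation over \<open>d\<close>.\<close>
  define e where "e x = (\<Sum>d\<in>UNIV. cof x c d ?z * ((Dref S d *v u x) $ i - F' x d ?z)
      + ((Dref S d *v Au x d) $ i - (cof x c d ?z * F' x d ?z + pd d (cof x c d) ?z * F x ?z)))" for x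
  define b where "b x = (EE x c *v u x - (\<Sum>d\<in>UNIV. Eref S d *v Au x d)) $ i" for x
  have eq: "(DD x c *v u x - ref_nodal S (g x c)) $ i =
      1 / (\<bar>J x ?z\<bar> * vwt S i) * (vwt S i / 2 * e x + 1 / 2 * b x)" if x: "x \<in> elements" for x
  proof -
    interpret regular_element "M (fst x)" "snd x" C by (rule regular_elementI[OF x])
    have J: "0 < J x ?z" using jac_pos vnode_in by auto
    have w: "0 < vwt S i" by (rule sbp_operatorD(2)[OF sbp])
    have S1: "(SS x c *v u x) $ i = (\<Sum>d\<in>UNIV. (1/2) * (cof x c d ?z * (vwt S i * (Dref S d *v u x) $ i)
        + vwt S i * (Dref S d *v Au x d) $ i - (Eref S d *v Au x d) $ i))"
      unfolding u_def Au_def Sxy_vector[OF sbp]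
      by (simp add: diag_vector_mult Qref_eq_Dref[OF sbp])
    have "((SS x c + (1/2) *\<^sub>R EE x c) *v u x) $ i = vwt S i / 2 * (\<Sum>d\<in>UNIV. cof x c d ?z * (Dref S d *v u x) $ i + (Dref S d *v Au x d) $ i)
        + 1/2 * b x"
      by (simp add: matrix_vector_mult_add_rdistrib matrix_vector_scaleR S1 b_def sum_2 del: if_split) (simp add: field_simps)
    also have "(\<Sum>d\<in>UNIV. cof x c d ?z * (Dref S d *v u x) $ i + (Dref S d *v Au x d) $ i)
        = e x + (2 * (\<Sum>d\<in>UNIV. cof x c d ?z * F' x d ?z) + (\<Sum>d\<in>UNIV. pd d (cof x c d) ?z) * F x ?z)"
      by (simp add: e_def sum_2 algebra_simps)
    also have "(\<Sum>d\<in>UNIV. pd d (cof x c d) ?z) = 0" by (rule cofactor_divergence[OF x])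
    also have "(\<Sum>d\<in>UNIV. cof x c d ?z * F' x d ?z) = J x ?z * g x c ?z"
      unfolding F'_def by (rule cofactor_pullback)
    finally have "((SS x c + (1/2) *\<^sub>R EE x c) *v u x) $ i = vwt S i / 2 * e x + 1/2 * b x + J x ?z * vwt S i * g x c ?z"
      by (simp add: algebra_simps)
    then have "(DD x c *v u x) $ i = 1 / (\<bar>J x ?z\<bar> * vwt S i) * (vwt S i / 2 * e x + 1/2 * b x + J x ?z * vwt S i * g x c ?z)"
      unfolding Dk_def matrix_vector_mul_assoc[symmetric] matrix_inv_Hk[OF x] diag_vector_mult by simp
    then show ?thesis using J w by (simp add: ref_nodal_def field_simps)
  qed
  have "order I (int (r + m + 2)) e"
    unfolding e_def
  proof (intro order_sum order_add)
    fix d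
    show "order I (int (r + m + 2)) (\<lambda>x. cof x c d ?z * ((Dref S d *v u x) $ i - F' x d ?z))"
      unfolding u_def
      by (rule order_mult[OF smooth_order[OF smooth_cofactor[of 0] vnode_in] differentiation_order[OF sbp F F' \<open>m \<le> p\<close>]]) simp_all
    have "smooth (Suc m) (1 + r) (\<lambda>x z. cof x c d z * F x z)"
      by (intro smooth_mult smooth_cofactor F)
    from differentiation_order[OF sbp this has_grad_on_mult_cofactor[OF _ F'] \<open>m \<le> p\<close>]
    show "order I (int (r + m + 2)) (\<lambda>x. (Dref S d *v Au x d) $ i - (cof x c d ?z * F' x d ?z + pd d (cof x c d) ?z * F x ?z))"
      unfolding Au_def by (simp add: add_ac)
  qed
  moreover have "order I (int (r + m + 2)) b"
    using order_Ek_error[OF F \<open>m \<le> p\<close>, of I c] unfolding order_vec b_def u_def Au_def by blast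
  ultimately have "order I (int (r + m + 2)) (\<lambda>x. vwt S i / 2 * e x + 1 / 2 * b x)"
    by (intro order_add order_cmult)
  then have "order I (int (r + m)) (\<lambda>x. 1 / (\<bar>J x ?z\<bar> * vwt S i) * (vwt S i / 2 * e x + 1 / 2 * b x))"
    by (rule order_mult[OF order_jac_inverse]) simp
  then show "order I (int (r + m)) (\<lambda>x. (DD x c *v ref_nodal S (F x) - ref_nodal S (g x c)) $ i)"
    by (rule order_cong) (simp only: eq u_def[symmetric])
qed

end

section \<open>Neighbouring elements\<close>

text \<open>The sides have length 2 and \<open>sqrt 8\<close>; these coarse bounds suffice to
  compare two parametrizations of a common facet.\<close>

lemma facet_len_bounds: "2 \<le> facet_len a" "facet_len a \<le> 3"
proof -
  have "a = 0 \<or> a = 1 \<or> a = 2" using exhaust_3[of a] by auto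
  moreover have "norm (vector [x, y] :: real^2) = sqrt (x\<^sup>2 + y\<^sup>2)" for x y
    by (simp add: norm_vec_def L2_set_def sum_2)
  moreover have "vert (0 + 1) - vert 0 = vector [2, 0]" "vert (1 + 1) - vert 1 = vector [-2, 2]"
    "vert (2 + 1) - vert 2 = vector [0, -2]"
    by (simp_all add: vert_def vec_eq_iff forall_2)
  moreover have "2 \<le> sqrt 8" "sqrt 8 \<le> 3" by (simp_all add: real_le_rsqrt real_le_lsqrt)
  ultimately show "2 \<le> facet_len a" "facet_len a \<le> 3" by (auto simp: facet_len_def)
qed

lemma facet_len_tan: "vert (a + 1) - vert a = facet_len a *\<^sub>R facet_tan a"
  using facet_len_bounds(1)[of a] by (simp add: facet_tan_def)

lemma norm_facet_tan: "norm (facet_tan a) = 1"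
  using facet_len_bounds(1)[of a] by (auto simp: facet_tan_def facet_len_def)

lemma rot_cw_scaleR: "rot_cw (c *\<^sub>R v) = c *\<^sub>R rot_cw v"
  by (simp add: rot_cw_def vec_eq_iff forall_2)

context regular_element begin

lemma facet_curve_derivative:
  "((\<lambda>s. emap M k (facet_pt a s)) has_vector_derivative (facet_len a / 2) *\<^sub>R facet_tangent M k a (facet_pt a s)) (at s within X)"
proof -
  have "(facet_pt a has_derivative (\<lambda>t. (t / 2) *\<^sub>R (vert (a + 1) - vert a))) (at s within X)"
    unfolding facet_pt_def[abs_def]
    by (auto intro!: derivative_eq_intros simp: algebra_simps add_divide_distrib diff_divide_distrib)
  from has_derivative_in_compose[OF this emap_has_derivative]
  have "((\<lambda>s. emap M k (facet_pt a s)) has_derivative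
     (\<lambda>t. \<chi> c. \<Sum>d\<in>UNIV. metric_term M k c d (facet_pt a s) * ((t / 2) *\<^sub>R (vert (a + 1) - vert a)) $ d)) (at s within X)" .
  then show ?thesis
    unfolding has_vector_derivative_def facet_len_tan
    by (rule has_derivative_eq_rhs) (simp add: fun_eq_iff vec_eq_iff facet_tangent_def sum_2 algebra_simps)
qed

lemma facet_tangent_le: 
  assumes "z \<in> ref_tri" shows "norm (facet_tangent M k a z) \<le> 4 * C * h"
proof -
  have "\<bar>facet_tangent M k a z $ c\<bar> \<le> 2 * C * h" for c
  proof -
    have "\<bar>metric_term M k c d z * facet_tan a $ d\<bar> \<le> (C * h) * 1" for d
      unfolding abs_mult using metric_term_abs_le[OF assms] component_le_norm_cart[of "facet_tan a" d]
      by (intro mult_mono) (auto simp: norm_facet_tan intro: order_trans[OF abs_ge_zero])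
    from this[of 1] this[of 2] show ?thesis by (simp add: facet_tangent_def sum_2)
  qed
  from this[of 1] this[of 2] norm_le_l1_cart[of "facet_tangent M k a z"] show ?thesis by (simp add: sum_2)
qed

text \<open>The cofactors recover \<open>jac\<close> times the reference tangent from the physical
  one. As \<open>jac\<close> is at least \<open>h ^ 2 / C\<close> and the cofactors are at most
  \<open>C * h\<close>, the physical tangent has length at least a multiple of
  \<open>h\<close>.\<close>

lemma facet_tangent_ge:
  assumes "z \<in> ref_tri" shows "h \<le> 4 * C\<^sup>2 * norm (facet_tangent M k a z)"
proof -
  let ?t = "facet_tangent M k a z"
  have J: "\<bar>jac M k z * facet_tan a $ e\<bar> \<le> 2 * C * h * norm ?t" for e
  proof -
    have "(\<Sum>c\<in>UNIV. ?t $ c * cofactor M k c e z) =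
      (\<Sum>d\<in>UNIV. facet_tan a $ d * (\<Sum>c\<in>UNIV. metric_term M k c d z * cofactor M k c e z))"
      by (simp add: facet_tangent_def sum_2 algebra_simps)
    also have "\<dots> = jac M k z * facet_tan a $ e"
      by (simp add: metric_term_cofactor if_distrib cong: if_cong)
    finally have "jac M k z * facet_tan a $ e = (\<Sum>c\<in>UNIV. ?t $ c * cofactor M k c e z)" by simp
    moreover have "\<bar>?t $ c * cofactor M k c e z\<bar> \<le> norm ?t * (C * h)" for c
      unfolding abs_mult using cofactor_abs_le[OF assms] component_le_norm_cart[of ?t c]
      by (intro mult_mono) auto
    from this[of 1] this[of 2] have "\<bar>\<Sum>c\<in>UNIV. ?t $ c * cofactor M k c e z\<bar> \<le> 2 * (norm ?t * (C * h))"
      unfolding sum_2 by linarith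
    ultimately show ?thesis by (simp add: mult_ac)
  qed
  have pos: "0 < jac M k z" by (rule jac_pos[OF assms])
  \<comment> \<open>The absolute components of a unit vector add up to at least 1, so adding the two
    componentwise bounds isolates \<open>jac\<close>.\<close>
  have "jac M k z * 1 \<le> jac M k z * (\<bar>facet_tan a $ 1\<bar> + \<bar>facet_tan a $ 2\<bar>)"
    using norm_le_l1_cart[of "facet_tan a"] norm_facet_tan[of a] pos by (intro mult_left_mono) (auto simp: sum_2)
  also have "\<dots> \<le> 4 * C * h * norm ?t"
    using J[of 1] J[of 2] pos by (simp add: abs_mult distrib_left)
  finally have "jac M k z \<le> 4 * C * h * norm ?t" by simp
  then have "C * jac M k z \<le> C * (4 * C * h * norm ?t)" using C_pos by (intro mult_left_mono) auto
  with jac_ge[OF assms] have "h * h \<le> h * (4 * C\<^sup>2 * norm ?t)"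
    by (simp add: power2_eq_square mult_ac)
  then show ?thesis using h_pos by (simp add: mult_le_cancel_left_pos)
qed

end

lemma is_meshD:
  assumes "is_mesh pmap \<Omega> \<Gamma>D \<Gamma>N M"
  shows "finite (elems M)" "\<Omega> = (\<Union>k\<in>elems M. elem M k)"
    "k \<in> elems M \<Longrightarrow> l \<in> elems M \<Longrightarrow> k \<noteq> l \<Longrightarrow> interior (elem M k) \<inter> interior (elem M l) = {}"
    "k \<in> elems M \<Longrightarrow> (\<lambda>z. emap M k z $ c) \<in> poly2 pmap"
    "k \<in> elems M \<Longrightarrow> inj_on (emap M k) ref_tri"
    "k \<in> elems M \<Longrightarrow> z \<in> ref_tri \<Longrightarrow> 0 < jac M k z"
    "\<Gamma>D = (\<Union>k\<in>elems M. \<Union>a\<in>dir_facets M k. facet_set M k a)"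
  using assms unfolding is_mesh_def by blast+

lemma is_mesh_neighbour:
  assumes "is_mesh pmap \<Omega> \<Gamma>D \<Gamma>N M" "k \<in> elems M" "a \<in> int_facets M k"
  shows "nbe M k a \<in> elems M" "nbe M k a \<noteq> k" "nbf M k a \<in> int_facets M (nbe M k a)"
    "link M (nbe M k a) (nbf M k a) = Interior k a"
    "s \<in> {-1..1} \<Longrightarrow> emap M k (facet_pt a s) = emap M (nbe M k a) (facet_pt (nbf M k a) (- s))"
proof -
  have link: "link M k a = Interior (nbe M k a) (nbf M k a)"
    using assms(3) by (simp add: int_facets_def nbe_def nbf_def)
  have "nbe M k a \<in> elems M \<and> nbe M k a \<noteq> k \<and> link M (nbe M k a) (nbf M k a) = Interior k a \<and>
        (\<forall>s\<in>{-1..1}. emap M k (facet_pt a s) = emap M (nbe M k a) (facet_pt (nbf M k a) (- s)))"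
    using assms(1,2) link unfolding is_mesh_def by blast
  then show "nbe M k a \<in> elems M" "nbe M k a \<noteq> k" "nbf M k a \<in> int_facets M (nbe M k a)"
    "link M (nbe M k a) (nbf M k a) = Interior k a"
    "s \<in> {-1..1} \<Longrightarrow> emap M k (facet_pt a s) = emap M (nbe M k a) (facet_pt (nbf M k a) (- s))"
    by (auto simp: int_facets_def)
qed

lemma is_mesh_regular_element:
  assumes "is_mesh pmap \<Omega> \<Gamma>D \<Gamma>N M" "regular_mesh C M" "k \<in> elems M"
  shows "regular_element M k C"
proof
  show "real_polynomial_function (\<lambda>z. emap M k z $ c)" for c
    by (rule poly2_real_polynomial_function[OF is_meshD(4)[OF assms(1,3)]])
  show "inj_on (emap M k) ref_tri" by (rule is_meshD(5)[OF assms(1,3)])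
  show "0 < jac M k z" if "z \<in> ref_tri" for z by (rule is_meshD(6)[OF assms(1,3) that])
  show "elem_diam M k ^ 2 \<le> C * jac M k z" if "z \<in> ref_tri" for z
    using assms(2,3) that unfolding regular_mesh_def by blast
  show "\<bar>(pd 1 ^^ i) ((pd 2 ^^ j) (\<lambda>z. emap M k z $ c)) z\<bar> \<le> C * elem_diam M k ^ (i + j)"
    if "z \<in> ref_tri" "1 \<le> i + j" for z c i j
    using assms(2,3) that unfolding regular_mesh_def by blast
qed

text \<open>Of two distinct element indices exactly one is the larger, so exactly one side carries
  the sign -1.\<close>

lemma orient_neighbour:
  assumes "is_mesh pmap \<Omega> \<Gamma>D \<Gamma>N M" "k \<in> elems M" "a \<in> int_facets M k"
  shows "orient M (nbe M k a) (nbf M k a) = - orient M k a"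
proof -
  note nb = is_mesh_neighbour[OF assms]
  have "nbe M (nbe M k a) (nbf M k a) = k" using nb(4) by (simp add: nbe_def)
  then show ?thesis using nb(2,3) assms(3) by (auto simp: orient_def int_facets_def)
qed

text \<open>The opposite orientation signs compensate the opposite traversal, so node
  \<open>i\<close> is the same physical point from both sides.\<close>

lemma fref_neighbour:
  fixes S :: "('n::finite, 'f::finite) sbp"
  assumes "is_mesh pmap \<Omega> \<Gamma>D \<Gamma>N M" "k \<in> elems M" "a \<in> int_facets M k" "sbp_operator p S"
  shows "emap M k (fref S M k a i) = emap M (nbe M k a) (fref S M (nbe M k a) (nbf M k a) i)"
proof -
  have "fpos S i \<in> {-1..1}" using legendre_gaussD(1)[OF sbp_operatorD(3)[OF assms(4)]] .
  then have "orient M k a * fpos S i \<in> {-1..1}" by (auto simp: orient_def)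
  from is_mesh_neighbour(5)[OF assms(1-3) this] show ?thesis
    by (simp add: fref_def orient_neighbour[OF assms(1-3)])
qed

text \<open>Differentiates the matching of the two parametrizations; the reversal produces the sign,
  and the lengths appear because the shared facet may correspond to reference sides of different
  length. Derivatives within the closed interval include its end points.\<close>

lemma facet_tangent_neighbour:
  assumes mesh: "is_mesh pmap \<Omega> \<Gamma>D \<Gamma>N M" "k \<in> elems M" "a \<in> int_facets M k" and reg: "regular_mesh C M"
    and s: "s \<in> {-1..1}"
  defines "v \<equiv> nbe M k a" and "b \<equiv> nbf M k a"
  shows "facet_len a *\<^sub>R facet_tangent M k a (facet_pt a s) = - (facet_len b *\<^sub>R facet_tangent M v b (facet_pt b (- s)))"
proof -
  note nb = is_mesh_neighbour[OF mesh]
  interpret k: regular_element M k C by (rule is_mesh_regular_element[OF mesh(1) reg mesh(2)])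
  interpret v: regular_element M v C unfolding v_def by (rule is_mesh_regular_element[OF mesh(1) reg nb(1)])
  have D1: "((\<lambda>s. emap M k (facet_pt a s)) has_vector_derivative (facet_len a / 2) *\<^sub>R facet_tangent M k a (facet_pt a s)) (at s within cbox (-1) 1)"
    by (rule k.facet_curve_derivative)
  have m: "(uminus has_vector_derivative (-1)) (at s within cbox (-1) 1)"
    using has_vector_derivative_minus[OF has_vector_derivative_id] by simp
  have "((\<lambda>s. emap M v (facet_pt b (- s))) has_vector_derivative (- 1) *\<^sub>R ((facet_len b / 2) *\<^sub>R facet_tangent M v b (facet_pt b (- s)))) (at s within cbox (-1) 1)"
    using vector_diff_chain_within[OF m v.facet_curve_derivative[of b "- s"]] by (simp add: o_def)
  then have D2: "((\<lambda>s. emap M k (facet_pt a s)) has_vector_derivative (- 1) *\<^sub>R ((facet_len b / 2) *\<^sub>R facet_tangent M v b (facet_pt b (- s)))) (at s within cbox (-1) 1)"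
    by (rule has_vector_derivative_transform[rotated 2]) (use s nb(5) in \<open>auto simp: v_def b_def\<close>)
  have "(facet_len a / 2) *\<^sub>R facet_tangent M k a (facet_pt a s) = (- 1) *\<^sub>R ((facet_len b / 2) *\<^sub>R facet_tangent M v b (facet_pt b (- s)))"
    by (rule vector_derivative_unique_within_closed_interval[OF _ _ D1 D2]) (use s in auto)
  then have "2 *\<^sub>R ((facet_len a / 2) *\<^sub>R facet_tangent M k a (facet_pt a s)) = 2 *\<^sub>R ((- 1) *\<^sub>R ((facet_len b / 2) *\<^sub>R facet_tangent M v b (facet_pt b (- s))))"
    by simp
  then show ?thesis by simp
qed

text \<open>The tangent of the common facet measures both diameters. The constant is
  \<open>4 * C ^ 2\<close> from the lower bound on the neighbour's tangent, \<open>4 * C\<close>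
  from the upper bound on the element's own and 3/2 from the reference sides.\<close>

lemma diam_neighbour_le:
  assumes mesh: "is_mesh pmap \<Omega> \<Gamma>D \<Gamma>N M" "k \<in> elems M" "a \<in> int_facets M k" and reg: "regular_mesh C M"
  shows "elem_diam M (nbe M k a) \<le> 24 * C ^ 3 * elem_diam M k"
proof -
  define v where "v = nbe M k a"
  define b where "b = nbf M k a"
  note nb = is_mesh_neighbour[OF mesh]
  interpret k: regular_element M k C by (rule is_mesh_regular_element[OF mesh(1) reg mesh(2)])
  interpret v: regular_element M v C unfolding v_def by (rule is_mesh_regular_element[OF mesh(1) reg nb(1)])
  let ?t = "facet_tangent M k a (facet_pt a 0)" and ?u = "facet_tangent M v b (facet_pt b 0)"
  have "facet_len a *\<^sub>R ?t = - (facet_len b *\<^sub>R ?u)"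
    using facet_tangent_neighbour[OF mesh reg, of 0] by (simp add: v_def b_def)
  then have "norm (facet_len a *\<^sub>R ?t) = norm (facet_len b *\<^sub>R ?u)" by simp
  then have "facet_len b * norm ?u = facet_len a * norm ?t"
    using facet_len_bounds[of a] facet_len_bounds[of b] by simp
  moreover have "2 * norm ?u \<le> facet_len b * norm ?u" "facet_len a * norm ?t \<le> 3 * norm ?t"
    using facet_len_bounds[of a] facet_len_bounds[of b] by (auto intro: mult_right_mono)
  moreover have "norm ?t \<le> 4 * C * k.h"
    by (rule k.facet_tangent_le[OF facet_pt_in_ref_tri]) simp
  ultimately have u: "norm ?u \<le> 6 * C * k.h" by linarith
  have "v.h \<le> 4 * C\<^sup>2 * norm ?u"
    by (rule v.facet_tangent_ge[OF facet_pt_in_ref_tri]) simp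
  also have "\<dots> \<le> 4 * C\<^sup>2 * (6 * C * k.h)" using u by (intro mult_left_mono) auto
  finally show ?thesis by (simp add: v_def power2_eq_square power3_eq_cube mult_ac)
qed

lemma facet_normal_neighbour:
  fixes S :: "('n::finite, 'f::finite) sbp"
  assumes mesh: "is_mesh pmap \<Omega> \<Gamma>D \<Gamma>N M" "k \<in> elems M" "a \<in> int_facets M k" and reg: "regular_mesh C M"
    and sbp: "sbp_operator p S"
  shows "facet_normal M k a (fref S M k a i) = - facet_normal M (nbe M k a) (nbf M k a) (fref S M (nbe M k a) (nbf M k a) i)"
proof -
  define v where "v = nbe M k a"
  define b where "b = nbf M k a"
  define r where "r = facet_len b / facet_len a"
  have r: "0 < r" using facet_len_bounds[of a] facet_len_bounds[of b] by (simp add: r_def)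
  have "fpos S i \<in> {-1..1}" using legendre_gaussD(1)[OF sbp_operatorD(3)[OF sbp]] .
  then have s: "orient M k a * fpos S i \<in> {-1..1}" by (auto simp: orient_def)
  let ?t = "facet_tangent M k a (fref S M k a i)" and ?u = "facet_tangent M v b (fref S M v b i)"
  have "facet_len a *\<^sub>R ?t = - (facet_len b *\<^sub>R ?u)"
    using facet_tangent_neighbour[OF mesh reg s] orient_neighbour[OF mesh]
    by (simp add: v_def b_def fref_def)
  then have "(1 / facet_len a) *\<^sub>R (facet_len a *\<^sub>R ?t) = (1 / facet_len a) *\<^sub>R (- (facet_len b *\<^sub>R ?u))" by simp
  \<comment> \<open>A negative multiple: normalization removes the factor \<open>r\<close>, and the
    sign reverses the normal.\<close>
  then have t: "?t = (- r) *\<^sub>R ?u" using facet_len_bounds(1)[of a] by (simp add: r_def)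
  show ?thesis
    unfolding facet_normal_def v_def[symmetric] b_def[symmetric] t
    using r by (simp add: rot_cw_scaleR del: scaleR_minus_left) simp
qed

section \<open>The residual of the exact adjoint\<close>

lemma Ck_on_cong:
  assumes "Ck_on m K f" "\<And>z. z \<in> K \<Longrightarrow> f z = g z" shows "Ck_on m K g"
proof (cases m)
  case 0
  then show ?thesis using assms by (simp cong: continuous_on_cong)
next
  case (Suc l)
  with assms(1) obtain fx fy where f:
    "\<And>z. z \<in> K \<Longrightarrow> (f has_derivative (\<lambda>v. fx z * v $ 1 + fy z * v $ 2)) (at z within K)"
    "Ck_on l K fx" "Ck_on l K fy" by auto
  have "(g has_derivative (\<lambda>v. fx z * v $ 1 + fy z * v $ 2)) (at z within K)" if "z \<in> K" for z
    using has_derivative_transform[OF that _ f(1)[OF that], of g] assms(2) by simp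
  with f show ?thesis unfolding Suc by auto
qed

lemma linear_axis_expansion:
  fixes L :: "real^2 \<Rightarrow> 'b::real_vector"
  assumes "linear L" shows "L v = (\<Sum>c\<in>UNIV. v $ c *\<^sub>R L (axis c 1))"
proof -
  have "L v = L (\<Sum>c\<in>UNIV. v $ c *\<^sub>R axis c 1)"
    by (simp add: basis_expansion[of v, unfolded scalar_mult_eq_scaleR])
  then show ?thesis using assms by (simp add: linear_sum linear_scale)
qed

lemma has_derivative_grad_in:
  assumes "f differentiable (at y within \<Omega>)"
  shows "(f has_derivative (\<lambda>v. \<Sum>c\<in>UNIV. grad_in \<Omega> f y $ c * v $ c)) (at y within \<Omega>)"
proof -
  have D: "(f has_derivative frechet_derivative f (at y within \<Omega>)) (at y within \<Omega>)"
    using assms by (simp only: frechet_derivative_works)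
  have "frechet_derivative f (at y within \<Omega>) = (\<lambda>v. \<Sum>c\<in>UNIV. grad_in \<Omega> f y $ c * v $ c)"
    by (rule ext, subst linear_axis_expansion[OF has_derivative_linear[OF D]]) (simp add: grad_in_def mult.commute)
  with D show ?thesis by simp
qed

locale adjoint_problem = mesh_family S p M C
  for S :: "('n::finite, 'f::finite) sbp" and p :: nat and M :: "nat \<Rightarrow> mesh" and C :: real +
  fixes pmap :: nat and \<Omega> \<Gamma>D \<Gamma>N :: "(real^2) set" and lam :: "real^2 \<Rightarrow> real^2^2"
    and G \<psi>D \<psi>N \<psi> :: "real^2 \<Rightarrow> real" and T :: "nat \<Rightarrow> 'f sat" and B :: real
  assumes mesh: "\<And>n. is_mesh pmap \<Omega> \<Gamma>D \<Gamma>N (M n)"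
    and reg: "\<And>n. regular_mesh C (M n)"
    and lam_Ck: "\<And>n k c d. k \<in> elems (M n) \<Longrightarrow> Ck_on p (elem (M n) k) (\<lambda>x. lam x $ c $ d)"
    and adjoint_solution: "solves_diffusion \<Omega> \<Gamma>D \<Gamma>N lam G \<psi>D \<psi>N \<psi>"
    and p_ge_1: "1 \<le> p"
    and psi_Ck: "\<And>n k. k \<in> elems (M n) \<Longrightarrow> Ck_on (p + 1) (elem (M n) k) \<psi>"
    and scaled: "\<And>n. sat_scaled B (M n) (T n)"
    and adjoint_conditions: "\<And>n. sat_adjoint_conditions S (M n) (T n)"
begin

lemma elem_subset: "x \<in> elements \<Longrightarrow> elem (M (fst x)) (snd x) \<subseteq> \<Omega>"
  using is_meshD(2)[OF mesh[of "fst x"]] by (auto simp: elements_def)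

lemma emap_in: "x \<in> elements \<Longrightarrow> z \<in> ref_tri \<Longrightarrow> emap' x z \<in> \<Omega>"
  using elem_subset[of x] unfolding elem_def by blast

text \<open>The derivatives are bounded uniformly over all meshes by their bounds on the first one.\<close>

lemma smooth_pullback:
  assumes f: "\<And>n k. k \<in> elems (M n) \<Longrightarrow> Ck_on m (elem (M n) k) f"
  shows "smooth m 0 (\<lambda>x z. f (emap' x z))"
proof -
  have compact: "compact (elem (M n) k)" if "k \<in> elems (M n)" for n k
    using regular_element.compact_elem[OF regular[OF that]] .
  have "\<forall>j\<in>elems (M 0). \<exists>b. deriv_bounded m b 1 (elem (M 0) j) f"
    using Ck_on_deriv_bounded[OF compact f] by blast
  then obtain b where b: "\<And>j. j \<in> elems (M 0) \<Longrightarrow> deriv_bounded m (b j) 1 (elem (M 0) j) f"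
    by metis
  define A where "A = (\<Sum>j\<in>elems (M 0). \<bar>b j\<bar>)"
  have A: "0 \<le> A" by (simp add: A_def sum_nonneg)
  have "b j \<le> A" if "j \<in> elems (M 0)" for j
    using member_le_sum[of j "elems (M 0)" "\<lambda>j. \<bar>b j\<bar>"] is_meshD(1)[OF mesh] that by (force simp: A_def)
  then have b: "deriv_bounded m A 1 (elem (M 0) j) f" if "j \<in> elems (M 0)" for j
    using deriv_bounded_mono[OF b[OF that]] that by simp
  have "deriv_bounded m (chain_const m C * A * diam x ^ 0) (diam x) ref_tri (\<lambda>z. f (emap' x z))"
    if x: "x \<in> elements" for x
  proof -
    interpret regular_element "M (fst x)" "snd x" C by (rule regular_elementI[OF x])
    have x': "snd x \<in> elems (M (fst x))" using x by (simp add: elements_def)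
    have "deriv_bounded m A 1 (elem (M (fst x)) (snd x)) f"
    \<comment> \<open>The meshes need not be nested: an element may cut across several elements of
      the first mesh, which only have to cover it.\<close>
    proof (rule deriv_bounded_from_pieces[where J = "elems (M 0)" and K = "elem (M 0)" and g = "\<lambda>_. f"])
      show "elem (M (fst x)) (snd x) \<subseteq> (\<Union>j\<in>elems (M 0). elem (M 0) j)"
        using elem_subset[OF x] is_meshD(2)[OF mesh[of 0]] by simp
      show "closed (elem (M 0) j)" if "j \<in> elems (M 0)" for j
        using compact[OF that] by (rule compact_imp_closed)
    qed (use is_meshD(1)[OF mesh] compact_elem compact_imp_closed elem_subset_closure_interior b f[OF x'] in auto)
    from deriv_bounded_pullback[OF this A] show ?thesis by (simp add: diam_def)
  qed
  then show ?thesis unfolding smooth_def by blast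
qed

definition q :: "real^2 \<Rightarrow> real^2" where
  "q x = lam x *v grad_in \<Omega> \<psi> x"

lemma psi_differentiable: "y \<in> \<Omega> \<Longrightarrow> \<psi> differentiable (at y within \<Omega>)"
  and q_differentiable: "y \<in> \<Omega> \<Longrightarrow> q differentiable (at y within \<Omega>)"
  and div_q: "y \<in> \<Omega> \<Longrightarrow> - div_in \<Omega> q y = G y"
  using adjoint_solution unfolding solves_diffusion_def q_def[abs_def] Let_def by auto

lemma psi_has_derivative:
  assumes "x \<in> elements" "z \<in> ref_tri"
  shows "(\<psi> has_derivative (\<lambda>v. \<Sum>c\<in>UNIV. grad_in \<Omega> \<psi> (emap' x z) $ c * v $ c)) (at (emap' x z) within elem (M (fst x)) (snd x))"
  using has_derivative_grad_in[OF psi_differentiable[OF emap_in[OF assms]]] has_derivative_subset elem_subset[OF assms(1)]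
  by blast

lemma smooth_psi: "smooth (Suc p) 0 (\<lambda>x z. \<psi> (emap' x z))"
  using psi_Ck by (intro smooth_pullback) simp

lemma smooth_lam: "smooth p 0 (\<lambda>x z. lam (emap' x z) $ c $ d)"
  using lam_Ck by (intro smooth_pullback[where f = "\<lambda>y. lam y $ c $ d"])

text \<open>\<open>grad_in\<close> differentiates within \<open>\<Omega>\<close>, whereas the
  smoothness hypothesis supplies a gradient within the element. The two agree up to the element
  boundary by uniqueness, so the smoothness passes to \<open>grad_in\<close>.\<close>

lemma smooth_grad_psi: "smooth p 0 (\<lambda>x z. grad_in \<Omega> \<psi> (emap' x z) $ c)"
proof (rule smooth_pullback[where f = "\<lambda>y. grad_in \<Omega> \<psi> y $ c"])
  fix n k assume k: "k \<in> elems (M n)"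
  have x: "(n, k) \<in> elements" using k by (simp add: elements_def)
  interpret regular_element "M n" k C by (rule regular[OF k])
  have "Ck_on (Suc p) (elem (M n) k) \<psi>" using psi_Ck[OF k] by simp
  then obtain f' where f': "has_grad_on (elem (M n) k) \<psi> f'" "\<And>d. Ck_on p (elem (M n) k) (f' d)"
    using Ck_on_SucE by blast
  have "f' c y = grad_in \<Omega> \<psi> y $ c" if y: "y \<in> elem (M n) k" for y
  proof -
    obtain z where z: "z \<in> ref_tri" "y = emap (M n) k z" using y unfolding elem_def by blast
    show ?thesis
      unfolding z(2)
    proof (rule gradient_unique[OF _ _ z(1)])
      show "(\<psi> has_derivative (\<lambda>v. \<Sum>c\<in>UNIV. f' c (emap (M n) k z) * v $ c)) (at (emap (M n) k z) within elem (M n) k)"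
        using f'(1) emap_in_elem[OF z(1)] unfolding has_grad_on_def by blast
      show "(\<psi> has_derivative (\<lambda>v. \<Sum>c\<in>UNIV. grad_in \<Omega> \<psi> (emap (M n) k z) $ c * v $ c)) (at (emap (M n) k z) within elem (M n) k)"
        using psi_has_derivative[OF x z(1)] by simp
    qed
  qed
  then show "Ck_on p (elem (M n) k) (\<lambda>y. grad_in \<Omega> \<psi> y $ c)" by (rule Ck_on_cong[OF f'(2)])
qed

lemma smooth_q: "smooth p 0 (\<lambda>x z. q (emap' x z) $ c)"
proof -
  have "smooth p (0 + 0) (\<lambda>x z. lam (emap' x z) $ c $ d * grad_in \<Omega> \<psi> (emap' x z) $ d)" for d
    by (intro smooth_mult smooth_lam smooth_grad_psi)
  from smooth_add[OF this[of 1] this[of 2]] show ?thesis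
    by (simp add: q_def matrix_vector_mult_def sum_2)
qed

abbreviation psi_n :: "nat \<times> nat \<Rightarrow> real^'n" where
  "psi_n x \<equiv> nodal S (M (fst x)) \<psi> (snd x)"

lemma nodal_eq: "nodal S (M (fst x)) f (snd x) = ref_nodal S (\<lambda>z. f (emap' x z))"
  by (simp add: nodal_def ref_nodal_def)

definition flux :: "nat \<times> nat \<Rightarrow> 2 \<Rightarrow> real^'n" where
  "flux x c = (\<Sum>d\<in>UNIV. Lam S (M (fst x)) lam (snd x) c d *v (DD x d *v psi_n x))"

lemma order_Dk_psi:
  "order I (int p) (\<lambda>x. DD x c *v psi_n x - ref_nodal S (\<lambda>z. grad_in \<Omega> \<psi> (emap' x z) $ c))"
proof -
  have "order I (int (0 + p)) (\<lambda>x. DD x c *v ref_nodal S (\<lambda>z. \<psi> (emap' x z)) - ref_nodal S (\<lambda>z. grad_in \<Omega> \<psi> (emap' x z) $ c))"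
  proof (rule order_Dk_error[OF smooth_psi order_refl])
    fix x assume x: "x \<in> elements"
    interpret regular_element "M (fst x)" "snd x" C by (rule regular_elementI[OF x])
    show "has_grad_on ref_tri (\<lambda>z. \<psi> (emap' x z)) (\<lambda>d z. \<Sum>e\<in>UNIV. grad_in \<Omega> \<psi> (emap' x z) $ e * metr x e d z)"
      unfolding has_grad_on_def using has_derivative_pullback[OF psi_has_derivative[OF x]] by blast
  qed
  then show ?thesis by (simp add: nodal_eq)
qed

lemma order_Lam: "order I 0 (\<lambda>x. Lam S (M (fst x)) lam (snd x) c d)"
  unfolding Lam_def
proof (rule order_diag)
  fix i show "order I 0 (\<lambda>x. lam (emap' x (vnode S i)) $ c $ d)"
    using smooth_order[OF smooth_lam vnode_in] by simp
qed

lemma order_flux: "order I (int p) (\<lambda>x. flux x c - ref_nodal S (\<lambda>z. q (emap' x z) $ c))"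
proof -
  have "order I (int p) (\<lambda>x. \<Sum>d\<in>UNIV. Lam S (M (fst x)) lam (snd x) c d *v
     (DD x d *v psi_n x - ref_nodal S (\<lambda>z. grad_in \<Omega> \<psi> (emap' x z) $ d)))"
    by (intro order_sum order_matrix_vector[OF order_Lam order_Dk_psi]) simp
  moreover have "(\<Sum>d\<in>UNIV. Lam S (M (fst x)) lam (snd x) c d *v ref_nodal S (\<lambda>z. grad_in \<Omega> \<psi> (emap' x z) $ d))
      = ref_nodal S (\<lambda>z. q (emap' x z) $ c)" for x
    unfolding Lam_def diag_vector_ref_nodal[of "\<lambda>z. lam (emap' x z) $ c $ _"]
    by (simp add: vec_eq_iff ref_nodal_def q_def matrix_vector_mult_def)
  ultimately show ?thesis
    by (simp add: flux_def matrix_vector_mult_diff_distrib sum_subtractf)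
qed

text \<open>Two losses of the same size: \<open>Dk\<close> amplifies the flux error of order
  \<open>p\<close> by \<open>1 / h\<close>, and the exact flux has one derivative less than
  \<open>\<psi>\<close>, so its own differentiation is accurate to order \<open>p - 1\<close>. The
  divergence of the exact flux matches the source at the nodes.\<close>

lemma order_D2: "order I (int p - 1) (\<lambda>x. - (D2 S (M (fst x)) lam (snd x) *v psi_n x) - nodal S (M (fst x)) G (snd x))"
proof -
  obtain m where m: "p = Suc m" using p_ge_1 by (cases p) auto
  define g where "g x c z = frechet_derivative q (at (emap' x z) within \<Omega>) (axis c 1)" for x c z
  have dq: "order I (int (0 + m)) (\<lambda>x. DD x c *v ref_nodal S (\<lambda>z. q (emap' x z) $ c) - ref_nodal S (\<lambda>z. g x c z $ c))" for c
  proof (rule order_Dk_error[where g = "\<lambda>x e z. g x e z $ c"])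
    show "smooth (Suc m) 0 (\<lambda>x z. q (emap' x z) $ c)" using smooth_q m by simp
    fix x assume x: "x \<in> elements"
    interpret regular_element "M (fst x)" "snd x" C by (rule regular_elementI[OF x])
    show "has_grad_on ref_tri (\<lambda>z. q (emap' x z) $ c) (\<lambda>d z. \<Sum>e\<in>UNIV. g x e z $ c * metr x e d z)"
      unfolding has_grad_on_def
    proof
      fix z assume z: "z \<in> ref_tri"
      let ?D = "frechet_derivative q (at (emap' x z) within \<Omega>)"
      have D: "(q has_derivative ?D) (at (emap' x z) within \<Omega>)"
        using q_differentiable[OF emap_in[OF x z]] by (simp only: frechet_derivative_works)
      have "((\<lambda>y. q y $ c) has_derivative (\<lambda>v. ?D v $ c)) (at (emap' x z) within elem (M (fst x)) (snd x))"
        using bounded_linear.has_derivative[OF bounded_linear_vec_nth has_derivative_subset[OF D elem_subset[OF x]]] .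
      moreover have "(\<lambda>v. ?D v $ c) = (\<lambda>v. \<Sum>e\<in>UNIV. g x e z $ c * v $ e)"
      proof
        fix v show "?D v $ c = (\<Sum>e\<in>UNIV. g x e z $ c * v $ e)"
          by (subst linear_axis_expansion[OF has_derivative_linear[OF D]]) (simp add: g_def mult.commute)
      qed
      ultimately show "((\<lambda>z. q (emap' x z) $ c) has_derivative (\<lambda>v. \<Sum>d\<in>UNIV. (\<Sum>e\<in>UNIV. g x e z $ c * metr x e d z) * v $ d)) (at z within ref_tri)"
        by (intro has_derivative_pullback) simp
    qed
  qed (simp add: m)
  have eq: "- (D2 S (M (fst x)) lam (snd x) *v psi_n x) - nodal S (M (fst x)) G (snd x) =
     - ((\<Sum>c\<in>UNIV. DD x c *v (flux x c - ref_nodal S (\<lambda>z. q (emap' x z) $ c))) +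
        (\<Sum>c\<in>UNIV. DD x c *v ref_nodal S (\<lambda>z. q (emap' x z) $ c) - ref_nodal S (\<lambda>z. g x c z $ c)))"
    if x: "x \<in> elements" for x
  proof -
    have "D2 S (M (fst x)) lam (snd x) *v psi_n x = (\<Sum>c\<in>UNIV. DD x c *v flux x c)"
      by (simp add: D2_def flux_def matrix_vector_sum matrix_vector_sum_right matrix_vector_mul_assoc matrix_mul_assoc)
    moreover have "nodal S (M (fst x)) G (snd x) = - (\<Sum>c\<in>UNIV. ref_nodal S (\<lambda>z. g x c z $ c))"
      using div_q[OF emap_in[OF x vnode_in]]
      by (simp add: vec_eq_iff nodal_def ref_nodal_def g_def div_in_def)
    ultimately show ?thesis
      by (simp add: matrix_vector_mult_diff_distrib sum_subtractf)
  qed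
  have "order I (int p - 1) (\<lambda>x. (\<Sum>c\<in>UNIV. DD x c *v (flux x c - ref_nodal S (\<lambda>z. q (emap' x z) $ c))) +
        (\<Sum>c\<in>UNIV. DD x c *v ref_nodal S (\<lambda>z. q (emap' x z) $ c) - ref_nodal S (\<lambda>z. g x c z $ c)))"
    using dq by (intro order_add order_sum order_matrix_vector[OF order_Dk order_flux]) (simp_all add: m)
  then show ?thesis by (rule order_cong[OF order_minus]) (simp add: eq)
qed

section \<open>Facet operators and the errors of traces and fluxes\<close>

lemma order_Nk: "order I 0 (\<lambda>x. Nk S (M (fst x)) (snd x) a c)"
  unfolding Nk_def
proof (rule order_diag, rule orderI)
  fix x i
  let ?t = "facet_tangent (M (fst x)) (snd x) a (fnode x a i)"
  have "norm (rot_cw ?t) = norm ?t" by (simp add: rot_cw_def norm_vec_def L2_set_def sum_2 add.commute)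
  then have "norm (facet_normal (M (fst x)) (snd x) a (fnode x a i)) \<le> 1"
    by (simp add: facet_normal_def)
  then show "norm (facet_normal (M (fst x)) (snd x) a (fnode x a i) $ c) \<le> 1 * diam x powi 0"
    using component_le_norm_cart[of "facet_normal (M (fst x)) (snd x) a (fnode x a i)" c] by simp
qed

lemma order_Bk: "order I 1 (\<lambda>x. Bk S (M (fst x)) (snd x) a)"
  unfolding Bk_def Jf_def Bref_def diag_mult_diag
proof (rule order_diag)
  fix i
  have "order I 1 (\<lambda>x. norm (facet_tangent (M (fst x)) (snd x) a (fnode x a i)))"
  proof (rule orderI)
    fix x assume x: "x \<in> elements"
    show "norm (norm (facet_tangent (M (fst x)) (snd x) a (fnode x a i))) \<le> (4 * C) * diam x powi 1"
      using regular_element.facet_tangent_le[OF regular_elementI[OF x] fnode_in] by (simp add: diam_def)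
  qed
  then show "order I 1 (\<lambda>x. norm (facet_tangent (M (fst x)) (snd x) a (fnode x a i)) * (fwt S i * (facet_len a / 2)))"
    by (rule order_mult[OF _ order_const]) simp
qed

lemma order_Df: "order I (-1) (\<lambda>x. Df S (M (fst x)) lam (snd x) a)"
  unfolding Df_def
  by (intro order_sum order_matrix_mult[OF _ order_Dk] order_matrix_mult[OF _ order_Lam] order_matrix_mult[OF order_Nk order_Rk]) auto

definition trace_error :: "3 \<Rightarrow> nat \<times> nat \<Rightarrow> real^'f" where
  "trace_error a x = RR x a *v psi_n x - facet_nodal S (M (fst x)) \<psi> (snd x) a"

definition flux_error :: "3 \<Rightarrow> nat \<times> nat \<Rightarrow> real^'f" where
  "flux_error a x = Df S (M (fst x)) lam (snd x) a *v psi_n x - facet_flux S (M (fst x)) q (snd x) a"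

lemma order_trace_error: "order I (int p + 1) (trace_error a)"
proof -
  have "order I (int (0 + Suc p)) (\<lambda>x. (RR x a *v ref_nodal S (\<lambda>z. \<psi> (emap' x z))) $ i - \<psi> (emap' x (fnode x a i)))" for i
    by (rule order_Rk_error[OF smooth_psi order_refl])
  then show ?thesis
    unfolding trace_error_def[abs_def] by (subst order_vec) (simp add: nodal_eq facet_nodal_def add.commute)
qed

text \<open>Splits into the extrapolated error of the discrete flux at the volume nodes and the
  error of extrapolating the exact flux, both of order \<open>p\<close>.\<close>

lemma order_flux_error: "order I (int p) (flux_error a)"
proof -
  obtain m where m: "p = Suc m" using p_ge_1 by (cases p) auto
  have R: "order I (int p) (\<lambda>x. RR x a *v ref_nodal S (\<lambda>z. q (emap' x z) $ c) - (\<chi> i. q (emap' x (fnode x a i)) $ c))" for c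
  proof (subst order_vec, rule allI)
    fix i
    have "order I (int (0 + Suc m)) (\<lambda>x. (RR x a *v ref_nodal S (\<lambda>z. q (emap' x z) $ c)) $ i - q (emap' x (fnode x a i)) $ c)"
      using smooth_q[of c] by (intro order_Rk_error[where F = "\<lambda>x z. q (emap' x z) $ c"]) (simp_all add: m)
    then show "order I (int p) (\<lambda>x. (RR x a *v ref_nodal S (\<lambda>z. q (emap' x z) $ c) - (\<chi> i. q (emap' x (fnode x a i)) $ c)) $ i)"
      by (simp add: m)
  qed
  have eq: "flux_error a x = (\<Sum>c\<in>UNIV. Nk S (M (fst x)) (snd x) a c *v
      (RR x a *v (flux x c - ref_nodal S (\<lambda>z. q (emap' x z) $ c)) +
       (RR x a *v ref_nodal S (\<lambda>z. q (emap' x z) $ c) - (\<chi> i. q (emap' x (fnode x a i)) $ c))))" for x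
  proof -
    have "Df S (M (fst x)) lam (snd x) a *v psi_n x = (\<Sum>c\<in>UNIV. Nk S (M (fst x)) (snd x) a c *v (RR x a *v flux x c))"
      by (simp add: Df_def flux_def matrix_vector_sum matrix_vector_sum_right matrix_vector_mul_assoc matrix_mul_assoc)
    moreover have "facet_flux S (M (fst x)) q (snd x) a = (\<Sum>c\<in>UNIV. Nk S (M (fst x)) (snd x) a c *v (\<chi> i. q (emap' x (fnode x a i)) $ c))"
      by (simp add: vec_eq_iff facet_flux_def Nk_def diag_vector_mult inner_vec_def)
    ultimately show ?thesis
      by (simp add: flux_error_def matrix_vector_mult_diff_distrib sum_subtractf)
  qed
  have "order I (int p) (\<lambda>x. \<Sum>c\<in>UNIV. Nk S (M (fst x)) (snd x) a c *v
      (RR x a *v (flux x c - ref_nodal S (\<lambda>z. q (emap' x z) $ c)) +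
       (RR x a *v ref_nodal S (\<lambda>z. q (emap' x z) $ c) - (\<chi> i. q (emap' x (fnode x a i)) $ c))))"
  proof (rule order_sum)
    fix c :: 2
    have "order I (int p) (\<lambda>x. RR x a *v (flux x c - ref_nodal S (\<lambda>z. q (emap' x z) $ c)))"
      by (rule order_matrix_vector[OF order_Rk order_flux]) simp
    from order_add[OF this R]
    show "order I (int p) (\<lambda>x. Nk S (M (fst x)) (snd x) a c *v
      (RR x a *v (flux x c - ref_nodal S (\<lambda>z. q (emap' x z) $ c)) +
       (RR x a *v ref_nodal S (\<lambda>z. q (emap' x z) $ c) - (\<chi> i. q (emap' x (fnode x a i)) $ c))))"
      by (rule order_matrix_vector[OF order_Nk]) simp
  qed
  then show ?thesis by (simp add: eq[abs_def])
qed

end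

section \<open>Interface and boundary terms of the adjoint operator\<close>

context adjoint_problem begin

definition interior_at :: "3 \<Rightarrow> (nat \<times> nat) set" where
  "interior_at a = {x. a \<in> int_facets (M (fst x)) (snd x)}"

definition nbr :: "3 \<Rightarrow> nat \<times> nat \<Rightarrow> nat \<times> nat" where
  "nbr a x = (fst x, nbe (M (fst x)) (snd x) a)"

definition nbr_facet :: "3 \<Rightarrow> nat \<times> nat \<Rightarrow> 3" where
  "nbr_facet a x = nbf (M (fst x)) (snd x) a"

text \<open>For a natural exponent it is enough that the diameter of the neighbour is at most a
  fixed multiple of the element's own.\<close>

lemma order_neighbour:
  assumes F: "\<And>b. order (interior_at b) (int r) (F b)"
  shows "order (interior_at a) (int r) (\<lambda>x. F (nbr_facet a x) (nbr a x))"
proof -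
  have "\<exists>c\<ge>0. \<forall>x\<in>elements \<inter> interior_at b. norm (F b x) \<le> c * diam x powi int r" for b
    using F[of b] by (rule orderE) blast
  then obtain c where c: "\<And>b. 0 \<le> c b" "\<And>b x. x \<in> elements \<Longrightarrow> x \<in> interior_at b \<Longrightarrow> norm (F b x) \<le> c b * diam x ^ r"
    unfolding power_int_of_nat by (metis IntI)
  \<comment> \<open>Which facet of the neighbour is shared varies with the element, so one constant
    has to dominate those of all facets.\<close>
  define A where "A = (\<Sum>b\<in>UNIV. c b)"
  have A: "c b \<le> A" for b unfolding A_def using c(1) by (intro member_le_sum) auto
  show ?thesis
  proof (rule orderI)
    fix x assume x: "x \<in> elements" "x \<in> interior_at a"
    then have mem: "snd x \<in> elems (M (fst x))" "a \<in> int_facets (M (fst x)) (snd x)"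
      by (auto simp: elements_def interior_at_def)
    note nb = is_mesh_neighbour[OF mesh mem]
    let ?y = "nbr a x" and ?b = "nbr_facet a x"
    have y: "?y \<in> elements" "?y \<in> interior_at ?b"
      using nb(1,3) by (auto simp: nbr_def nbr_facet_def elements_def interior_at_def)
    have "diam ?y \<le> 24 * C ^ 3 * diam x"
      using diam_neighbour_le[OF mesh mem reg] by (simp add: nbr_def diam_def)
    then have "diam ?y ^ r \<le> (24 * C ^ 3 * diam x) ^ r"
      using scale_pos[OF y(1)] by (intro power_mono) auto
    then have "A * diam ?y ^ r \<le> A * (24 * C ^ 3 * diam x) ^ r"
      using c(1) A order_trans by (intro mult_left_mono) blast+
    moreover have "c ?b * diam ?y ^ r \<le> A * diam ?y ^ r"
      using A scale_pos[OF y(1)] by (intro mult_right_mono) auto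
    ultimately have "norm (F ?b ?y) \<le> A * (24 * C ^ 3 * diam x) ^ r"
      using c(2)[OF y] by linarith
    then show "norm (F ?b ?y) \<le> (A * (24 * C ^ 3) ^ r) * diam x powi int r"
      by (simp add: power_mult_distrib mult_ac)
  qed
qed

definition jump :: "3 \<Rightarrow> nat \<times> nat \<Rightarrow> real^'f" where
  "jump a x = RR x a *v psi_n x - RR (nbr a x) (nbr_facet a x) *v psi_n (nbr a x)"

definition flux_sum :: "3 \<Rightarrow> nat \<times> nat \<Rightarrow> real^'f" where
  "flux_sum a x = Df S (M (fst x)) lam (snd x) a *v psi_n x +
     Df S (M (fst (nbr a x))) lam (snd (nbr a x)) (nbr_facet a x) *v psi_n (nbr a x)"

text \<open>Both sides sample the exact trace at the same physical points, so it cancels from the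
  difference of the two trace errors.\<close>

lemma order_jump: "order (interior_at a) (int p + 1) (jump a)"
proof -
  have "order (interior_at a) (int (p + 1)) (\<lambda>x. trace_error a x - trace_error (nbr_facet a x) (nbr a x))"
    using order_trace_error by (intro order_diff order_neighbour) (simp_all add: add.commute)
  then have "order (interior_at a) (int p + 1) (\<lambda>x. trace_error a x - trace_error (nbr_facet a x) (nbr a x))"
    by (simp only: of_nat_add of_nat_1)
  then show ?thesis
  proof (rule order_cong)
    fix x assume "x \<in> elements" "x \<in> interior_at a"
    then have "snd x \<in> elems (M (fst x))" "a \<in> int_facets (M (fst x)) (snd x)"
      by (auto simp: elements_def interior_at_def)
    from fref_neighbour[OF mesh this sbp]
    show "trace_error a x - trace_error (nbr_facet a x) (nbr a x) = jump a x"
      by (simp add: trace_error_def jump_def facet_nodal_def nbr_def nbr_facet_def)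
  qed
qed

text \<open>The outward normals at a common node are opposite, so the exact fluxes cancel in the sum
  of the two flux errors.\<close>

lemma order_flux_sum: "order (interior_at a) (int p) (flux_sum a)"
proof -
  have "order (interior_at a) (int p) (\<lambda>x. flux_error a x + flux_error (nbr_facet a x) (nbr a x))"
    using order_flux_error by (intro order_add order_neighbour)
  then show ?thesis
  proof (rule order_cong)
    fix x assume "x \<in> elements" "x \<in> interior_at a"
    then have mem: "snd x \<in> elems (M (fst x))" "a \<in> int_facets (M (fst x)) (snd x)"
      by (auto simp: elements_def interior_at_def)
    have "facet_flux S (M (fst x)) q (snd x) a = - facet_flux S (M (fst x)) q (nbe (M (fst x)) (snd x) a) (nbf (M (fst x)) (snd x) a)"
      by (simp add: facet_flux_def vec_eq_iff fref_neighbour[OF mesh mem sbp] facet_normal_neighbour[OF mesh mem reg sbp])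
    then show "flux_error a x + flux_error (nbr_facet a x) (nbr a x) = flux_sum a x"
      by (simp add: flux_error_def flux_sum_def nbr_def nbr_facet_def)
  qed
qed

lemma order_mat_le:
  fixes A :: "nat \<times> nat \<Rightarrow> real^'f^'f"
  assumes "\<And>x. x \<in> elements \<Longrightarrow> x \<in> I \<Longrightarrow> mat_le (A x) (B * diam x ^ r)"
  shows "order I (int r) A"
  unfolding order_vec using assms by (intro allI orderI[of _ _ B]) (simp add: mat_le_def)

lemma order_sat:
  shows "order (interior_at a) 0 (\<lambda>x. T1 (T (fst x)) (snd x) a)"
    "order (interior_at a) 1 (\<lambda>x. T2 (T (fst x)) (snd x) a)"
    "order (interior_at a) 1 (\<lambda>x. T3 (T (fst x)) (snd x) a)"
    "order (interior_at a) 2 (\<lambda>x. T4 (T (fst x)) (snd x) a)"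
    "order {x. a \<in> dir_facets (M (fst x)) (snd x)} 0 (\<lambda>x. TD (T (fst x)) (snd x) a)"
    "a \<noteq> e \<Longrightarrow> order (interior_at a \<inter> interior_at e) 0 (\<lambda>x. T5 (T (fst x)) (snd x) a e)"
proof -
  note sc = scaled[unfolded sat_scaled_def]
  show "order (interior_at a) 0 (\<lambda>x. T1 (T (fst x)) (snd x) a)"
    using order_mat_le[of "interior_at a" "\<lambda>x. T1 (T (fst x)) (snd x) a" 0] sc
    by (auto simp: elements_def interior_at_def)
  show "order (interior_at a) 1 (\<lambda>x. T2 (T (fst x)) (snd x) a)"
    using order_mat_le[of "interior_at a" "\<lambda>x. T2 (T (fst x)) (snd x) a" 1] sc
    by (auto simp: elements_def interior_at_def diam_def)
  show "order (interior_at a) 1 (\<lambda>x. T3 (T (fst x)) (snd x) a)"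
    using order_mat_le[of "interior_at a" "\<lambda>x. T3 (T (fst x)) (snd x) a" 1] sc
    by (auto simp: elements_def interior_at_def diam_def)
  show "order (interior_at a) 2 (\<lambda>x. T4 (T (fst x)) (snd x) a)"
    using order_mat_le[of "interior_at a" "\<lambda>x. T4 (T (fst x)) (snd x) a" 2] sc
    by (auto simp: elements_def interior_at_def diam_def)
  show "order {x. a \<in> dir_facets (M (fst x)) (snd x)} 0 (\<lambda>x. TD (T (fst x)) (snd x) a)"
    using order_mat_le[of "{x. a \<in> dir_facets (M (fst x)) (snd x)}" "\<lambda>x. TD (T (fst x)) (snd x) a" 0] sc
    by (auto simp: elements_def)
  show "order (interior_at a \<inter> interior_at e) 0 (\<lambda>x. T5 (T (fst x)) (snd x) a e)" if "a \<noteq> e"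
    using order_mat_le[of "interior_at a \<inter> interior_at e" "\<lambda>x. T5 (T (fst x)) (snd x) a e" 0] sc that
    by (auto simp: elements_def interior_at_def)
qed

text \<open>The adjoint conditions turn the interior terms into terms in the jumps and flux sums alone.\<close>

definition facet_term :: "3 \<Rightarrow> nat \<times> nat \<Rightarrow> real^'n" where
  "facet_term a x = transpose (RR x a) *v (T1 (T (fst x)) (snd x) a *v jump a x
        - T2 (T (fst x)) (snd (nbr a x)) (nbr_facet a x) *v flux_sum a x)
     + transpose (Df S (M (fst x)) lam (snd x) a) *v
        (T4 (T (fst x)) (snd x) a *v flux_sum a x - T3 (T (fst x)) (snd (nbr a x)) (nbr_facet a x) *v jump a x)"

definition cross_term :: "3 \<Rightarrow> nat \<times> nat \<Rightarrow> real^'f" where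
  "cross_term a x = (\<Sum>e\<in>int_facets (M (fst x)) (snd x) - {a}. T5 (T (fst x)) (snd x) a e *v jump e x)"

text \<open>The conditions turn \<open>T2 + Bk\<close> and \<open>T3 - Bk\<close> into minus the
  coefficients on the other side, so the traces from both sides carry one matrix.
  \<open>T6 = - T5\<close> does the same for the coupling across different facets, on the element
  and on its neighbour.\<close>

lemma sI_adj_eq:
  assumes x: "x \<in> elements"
  shows "sI_adj S (M (fst x)) (T (fst x)) lam (nodal S (M (fst x)) \<psi>) (snd x) =
     (\<Sum>a\<in>int_facets (M (fst x)) (snd x). facet_term a x) +
     (\<Sum>a\<in>int_facets (M (fst x)) (snd x). transpose (RR x a) *v (cross_term a x - cross_term (nbr_facet a x) (nbr a x)))"
proof -
  obtain n k where nk: "x = (n, k)" by (cases x)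
  have k: "k \<in> elems (M n)" using x by (simp add: elements_def nk)
  note adj = adjoint_conditions[of n, unfolded sat_adjoint_conditions_def]
  \<comment> \<open>Stated for any element \<open>l\<close> and any matrix \<open>R\<close>, since
    the neighbour's coupling is multiplied by the extrapolation matrix of \<open>k\<close>.\<close>
  have cross: "(\<Sum>e\<in>int_facets (M n) l - {a}. R *v (T5 (T n) l a e *v facet_trace S (M n) (nodal S (M n) \<psi>) l e
        + T6 (T n) l a e *v facet_trace S (M n) (nodal S (M n) \<psi>) (nbe (M n) l e) (nbf (M n) l e)))
     = R *v cross_term a (n, l)" if l: "l \<in> elems (M n)" "a \<in> int_facets (M n) l" for l a and R :: "real^'f^'n"
  proof -
    have "T6 (T n) l a e = - T5 (T n) l a e" if "e \<in> int_facets (M n) l - {a}" for e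
      using adj l that by auto
    then show ?thesis
      by (simp add: cross_term_def matrix_vector_sum_right facet_trace_def jump_def nbr_def nbr_facet_def
          matrix_vector_uminus matrix_vector_mult_diff_distrib)
  qed
  have "facet_term a x = (let v = nbe (M n) k a; b = nbf (M n) k a in
        transpose (Rk S (M n) k a) *v
          (T1 (T n) k a *v facet_trace S (M n) (nodal S (M n) \<psi>) k a - T1 (T n) v b *v facet_trace S (M n) (nodal S (M n) \<psi>) v b +
           (T2 (T n) k a + Bk S (M n) k a) *v flux_trace S (M n) lam (nodal S (M n) \<psi>) k a - T2 (T n) v b *v flux_trace S (M n) lam (nodal S (M n) \<psi>) v b) +
        transpose (Df S (M n) lam k a) *v
          ((T3 (T n) k a - Bk S (M n) k a) *v facet_trace S (M n) (nodal S (M n) \<psi>) k a + T3 (T n) v b *v facet_trace S (M n) (nodal S (M n) \<psi>) v b +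
           T4 (T n) k a *v flux_trace S (M n) lam (nodal S (M n) \<psi>) k a + T4 (T n) v b *v flux_trace S (M n) lam (nodal S (M n) \<psi>) v b))"
    if a: "a \<in> int_facets (M n) k" for a
  proof -
    let ?v = "nbe (M n) k a" and ?b = "nbf (M n) k a"
    have c: "T1 (T n) k a = T1 (T n) ?v ?b" "T2 (T n) k a + T2 (T n) ?v ?b = - Bk S (M n) k a"
      "T3 (T n) k a + T3 (T n) ?v ?b = Bk S (M n) k a" "T4 (T n) k a = T4 (T n) ?v ?b"
      using adj k a by auto
    have c2: "T2 (T n) k a + Bk S (M n) k a = - T2 (T n) ?v ?b"
      using c(2) by (simp add: eq_neg_iff_add_eq_0 algebra_simps)
    have c3: "T3 (T n) k a - Bk S (M n) k a = - T3 (T n) ?v ?b"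
      using c(3) by (simp add: algebra_simps)
    show ?thesis
      unfolding Let_def c2 c3
      by (simp add: c(1,4) facet_term_def jump_def flux_sum_def nk nbr_def nbr_facet_def facet_trace_def flux_trace_def
          matrix_vector_uminus matrix_vector_mult_diff_distrib matrix_vector_right_distrib algebra_simps)
  qed
  moreover have "transpose (Rk S (M n) k a) *v (cross_term a x - cross_term (nbr_facet a x) (nbr a x)) =
     (let v = nbe (M n) k a; b = nbf (M n) k a in
        (\<Sum>e\<in>int_facets (M n) k - {a}. transpose (Rk S (M n) k a) *v
          (T5 (T n) k a e *v facet_trace S (M n) (nodal S (M n) \<psi>) k e + T6 (T n) k a e *v facet_trace S (M n) (nodal S (M n) \<psi>) (nbe (M n) k e) (nbf (M n) k e))) -
        (\<Sum>d\<in>int_facets (M n) v - {b}. transpose (Rk S (M n) k a) *v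
          (T5 (T n) v b d *v facet_trace S (M n) (nodal S (M n) \<psi>) v d + T6 (T n) v b d *v facet_trace S (M n) (nodal S (M n) \<psi>) (nbe (M n) v d) (nbf (M n) v d))))"
    if a: "a \<in> int_facets (M n) k" for a
    unfolding Let_def cross[OF k a] cross[OF is_mesh_neighbour(1,3)[OF mesh k a]]
    by (simp only: nk nbr_def nbr_facet_def fst_conv snd_conv matrix_vector_mult_diff_distrib)
  ultimately show ?thesis
    by (simp add: sI_adj_def nk)
qed

text \<open>All contributions reach order \<open>p + 1\<close>: \<open>T1\<close> and
  \<open>T5\<close> act on jumps, and \<open>T2\<close> adds one power to a flux sum. Behind the
  transpose of \<open>Df\<close>, which costs one power, \<open>T4\<close> adds two to a flux sum
  and \<open>T3\<close> one to a jump.\<close>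

lemma order_sI_adj:
  "order UNIV (int p + 1) (\<lambda>x. sI_adj S (M (fst x)) (T (fst x)) lam (nodal S (M (fst x)) \<psi>) (snd x))"
proof -
  have "order (interior_at a) (int p + 1) (facet_term a)" for a
  proof -
    have T2: "order (interior_at a) 1 (\<lambda>x. T2 (T (fst x)) (snd (nbr a x)) (nbr_facet a x))"
      using order_neighbour[of 1 "\<lambda>b x. T2 (T (fst x)) (snd x) b" a] order_sat(2) by (simp add: nbr_def)
    have T3: "order (interior_at a) 1 (\<lambda>x. T3 (T (fst x)) (snd (nbr a x)) (nbr_facet a x))"
      using order_neighbour[of 1 "\<lambda>b x. T3 (T (fst x)) (snd x) b" a] order_sat(3) by (simp add: nbr_def)
    have 1: "order (interior_at a) (int p + 1) (\<lambda>x. T1 (T (fst x)) (snd x) a *v jump a x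
        - T2 (T (fst x)) (snd (nbr a x)) (nbr_facet a x) *v flux_sum a x)"
      by (intro order_diff order_matrix_vector[OF order_sat(1) order_jump] order_matrix_vector[OF T2 order_flux_sum]) simp_all
    have 2: "order (interior_at a) (int p + 2) (\<lambda>x. T4 (T (fst x)) (snd x) a *v flux_sum a x
        - T3 (T (fst x)) (snd (nbr a x)) (nbr_facet a x) *v jump a x)"
      by (intro order_diff order_matrix_vector[OF order_sat(4) order_flux_sum] order_matrix_vector[OF T3 order_jump]) simp_all
    show ?thesis
      unfolding facet_term_def[abs_def]
      by (intro order_add order_matrix_vector[OF order_transpose[OF order_Rk] 1] order_matrix_vector[OF order_transpose[OF order_Df] 2]) simp_all
  qed
  then have A: "order UNIV (int p + 1) (\<lambda>x. \<Sum>a\<in>int_facets (M (fst x)) (snd x). facet_term a x)"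
    by (intro order_sum_dependent) (simp add: interior_at_def)
  have cross: "order (interior_at a) (int (p + 1)) (cross_term a)" for a
    unfolding cross_term_def[abs_def]
  proof (rule order_sum_dependent)
    fix e
    show "order (interior_at a \<inter> {x. e \<in> int_facets (M (fst x)) (snd x) - {a}}) (int (p + 1))
       (\<lambda>x. T5 (T (fst x)) (snd x) a e *v jump e x)"
    proof (cases "a = e")
      case True
      then show ?thesis by (simp add: order_def)
    next
      case False
      have "order (interior_at a \<inter> interior_at e) (int (p + 1)) (\<lambda>x. T5 (T (fst x)) (snd x) a e *v jump e x)"
        by (rule order_matrix_vector[OF order_sat(6)[OF False] order_subset[OF order_jump]]) auto
      then show ?thesis by (rule order_subset) (auto simp: interior_at_def)
    qed
  qed
  have "order (interior_at a) (int (p + 1)) (\<lambda>x. transpose (RR x a) *v (cross_term a x - cross_term (nbr_facet a x) (nbr a x)))" for a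
    by (rule order_matrix_vector[OF order_transpose[OF order_Rk] order_diff[OF cross order_neighbour[OF cross]]]) simp
  then have "order UNIV (int (p + 1)) (\<lambda>x. \<Sum>a\<in>int_facets (M (fst x)) (snd x). transpose (RR x a) *v (cross_term a x - cross_term (nbr_facet a x) (nbr a x)))"
    by (intro order_sum_dependent) (simp add: interior_at_def)
  then have "order UNIV (int p + 1) (\<lambda>x. \<Sum>a\<in>int_facets (M (fst x)) (snd x). transpose (RR x a) *v (cross_term a x - cross_term (nbr_facet a x) (nbr a x)))"
    by (simp only: of_nat_add of_nat_1)
  from order_add[OF A this] show ?thesis
    by (rule order_cong) (simp add: sI_adj_eq)
qed

text \<open>With exact data only trace and flux errors are left. On Dirichlet facets the power lost
  by the transpose of \<open>Df\<close> is regained from \<open>Bk\<close>.\<close>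

lemma order_sB_adj:
  "order UNIV (int p + 1) (\<lambda>x. sB_adj S (M (fst x)) (T (fst x)) lam (facet_nodal S (M (fst x)) \<psi>)
     (facet_flux S (M (fst x)) q) (nodal S (M (fst x)) \<psi>) (snd x))"
  unfolding sB_adj_def facet_trace_def flux_trace_def trace_error_def[symmetric] flux_error_def[symmetric]
proof (intro order_add order_sum_dependent)
  fix a
  have TD: "order {x. a \<in> dir_facets (M (fst x)) (snd x)} (int p + 1) (\<lambda>x. TD (T (fst x)) (snd x) a *v trace_error a x)"
    by (rule order_matrix_vector[OF order_sat(5) order_trace_error]) simp
  have 1: "order {x. a \<in> dir_facets (M (fst x)) (snd x)} (int p + 1) (\<lambda>x. transpose (RR x a) *v (TD (T (fst x)) (snd x) a *v trace_error a x))"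
    by (rule order_matrix_vector[OF order_transpose[OF order_Rk] TD]) simp
  have B: "order I (int p + 2) (\<lambda>x. Bk S (M (fst x)) (snd x) a *v trace_error a x)" for I
    by (rule order_matrix_vector[OF order_Bk order_trace_error]) simp
  have 2: "order I (int p + 1) (\<lambda>x. transpose (Df S (M (fst x)) lam (snd x) a) *v (Bk S (M (fst x)) (snd x) a *v trace_error a x))" for I
    by (rule order_matrix_vector[OF order_transpose[OF order_Df] B]) simp
  show "order (UNIV \<inter> {x. a \<in> dir_facets (M (fst x)) (snd x)}) (int p + 1) (\<lambda>x. transpose (RR x a) *v (TD (T (fst x)) (snd x) a *v trace_error a x)
      - transpose (Df S (M (fst x)) lam (snd x) a) *v (Bk S (M (fst x)) (snd x) a *v trace_error a x))"
    using order_diff[OF 1 2] by simp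
  have F: "order I (int p + 1) (\<lambda>x. Bk S (M (fst x)) (snd x) a *v flux_error a x)" for I
    by (rule order_matrix_vector[OF order_Bk order_flux_error]) simp
  show "order (UNIV \<inter> {x. a \<in> neu_facets (M (fst x)) (snd x)}) (int p + 1) (\<lambda>x. transpose (RR x a) *v (Bk S (M (fst x)) (snd x) a *v flux_error a x))"
    by (rule order_matrix_vector[OF order_transpose[OF order_Rk] F]) simp
qed

section \<open>The residual in the maximum norm and in the norm of \<open>Hk\<close>\<close>

abbreviation residual :: "nat \<times> nat \<Rightarrow> real^'n" where
  "residual x \<equiv> adj_residual S (M (fst x)) (T (fst x)) \<Omega> lam G \<psi> (snd x)"

text \<open>The inverse of \<open>Hk\<close> takes two powers from the penalty terms and brings them
  level with the volume term.\<close>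

lemma order_residual: "order UNIV (int p - 1) residual"
proof -
  have "order UNIV (int p - 1) (\<lambda>x. (- (D2 S (M (fst x)) lam (snd x) *v psi_n x) - nodal S (M (fst x)) G (snd x))
     + (matrix_inv (Hk S (M (fst x)) (snd x)) *v sI_adj S (M (fst x)) (T (fst x)) lam (nodal S (M (fst x)) \<psi>) (snd x)
     + matrix_inv (Hk S (M (fst x)) (snd x)) *v sB_adj S (M (fst x)) (T (fst x)) lam (facet_nodal S (M (fst x)) \<psi>)
     (facet_flux S (M (fst x)) q) (nodal S (M (fst x)) \<psi>) (snd x)))"
    by (intro order_add order_D2 order_matrix_vector[OF order_Hk_inverse order_sI_adj]
        order_matrix_vector[OF order_Hk_inverse order_sB_adj]) simp_all
  then show ?thesis
    by (rule order_cong) (simp add: adj_residual_def Lstar_def q_def[abs_def] algebra_simps)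
qed

lemma infnorm_residual_le:
  "\<exists>K. \<forall>n. \<forall>k\<in>elems (M n). infnorm (adj_residual S (M n) (T n) \<Omega> lam G \<psi> k) \<le> K * elem_diam (M n) k ^ (p - 1)"
proof -
  obtain K where K: "\<And>x. x \<in> elements \<Longrightarrow> x \<in> UNIV \<Longrightarrow> norm (residual x) \<le> K * diam x powi (int p - 1)"
    using order_residual by (rule orderE) blast
  have p: "int p - 1 = int (p - 1)" using p_ge_1 by simp
  have "infnorm (adj_residual S (M n) (T n) \<Omega> lam G \<psi> k) \<le> K * elem_diam (M n) k ^ (p - 1)"
    if "k \<in> elems (M n)" for n k
  proof (rule order_trans[OF infnorm_le_norm])
    have "(n, k) \<in> elements" using that by (simp add: elements_def)
    from K[OF this, unfolded p power_int_of_nat]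
    show "norm (adj_residual S (M n) (T n) \<Omega> lam G \<psi> k) \<le> K * elem_diam (M n) k ^ (p - 1)"
      by (simp add: diam_def)
  qed
  then show ?thesis by blast
qed

lemma order_Hk: "order I 2 (\<lambda>x. Hk S (M (fst x)) (snd x))"
  unfolding Hk_eq
proof (rule order_diag, rule order_mult[OF _ order_const])
  fix i
  show "order I 2 (\<lambda>x. \<bar>J x (vnode S i)\<bar>)"
  proof (rule orderI)
    fix x assume x: "x \<in> elements"
    interpret regular_element "M (fst x)" "snd x" C by (rule regular_elementI[OF x])
    show "norm \<bar>J x (vnode S i)\<bar> \<le> (2 * C\<^sup>2) * diam x powi 2"
      using jac_pos[OF vnode_in, of i] jac_abs_le[OF vnode_in, of i] by (simp add: diam_def)
  qed
qed simp

text \<open>\<open>Hk\<close> scales like the element area \<open>h ^ 2\<close>, so the quadratic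
  form has order \<open>2 * p\<close> and its root gains one power over the residual.\<close>

lemma hnorm_residual_le:
  "\<exists>K\<ge>0. \<forall>n. \<forall>k\<in>elems (M n). hnorm (Hk S (M n) k) (adj_residual S (M n) (T n) \<Omega> lam G \<psi> k) \<le> K * elem_diam (M n) k ^ p"
proof -
  have "order UNIV (int p + 1) (\<lambda>x. Hk S (M (fst x)) (snd x) *v residual x)"
    by (rule order_matrix_vector[OF order_Hk order_residual]) simp
  then have "order UNIV (2 * int p) (\<lambda>x. residual x $ i * (Hk S (M (fst x)) (snd x) *v residual x) $ i)" for i
    using order_residual unfolding order_vec by (intro order_mult[where r = "int p - 1" and s = "int p + 1"]) auto
  then have "order UNIV (int (p * 2)) (\<lambda>x. residual x \<bullet> (Hk S (M (fst x)) (snd x) *v residual x))"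
    unfolding inner_vec_def by (intro order_sum) (simp add: mult.commute)
  then obtain K where K: "0 \<le> K" "\<And>x. x \<in> elements \<Longrightarrow> x \<in> UNIV \<Longrightarrow> norm (residual x \<bullet> (Hk S (M (fst x)) (snd x) *v residual x)) \<le> K * diam x powi int (p * 2)"
    by (rule orderE) blast
  have "hnorm (Hk S (M n) k) (adj_residual S (M n) (T n) \<Omega> lam G \<psi> k) \<le> sqrt K * elem_diam (M n) k ^ p"
    if k: "k \<in> elems (M n)" for n k
  proof -
    have x: "(n, k) \<in> elements" using k by (simp add: elements_def)
    have "adj_residual S (M n) (T n) \<Omega> lam G \<psi> k \<bullet> (Hk S (M n) k *v adj_residual S (M n) (T n) \<Omega> lam G \<psi> k)
       \<le> K * (elem_diam (M n) k ^ p)\<^sup>2"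
      using K(2)[OF x UNIV_I, unfolded power_int_of_nat] by (simp add: diam_def power_mult)
    then have "hnorm (Hk S (M n) k) (adj_residual S (M n) (T n) \<Omega> lam G \<psi> k) \<le> sqrt (K * (elem_diam (M n) k ^ p)\<^sup>2)"
      unfolding hnorm_def by (rule real_sqrt_le_mono)
    also have "\<dots> = sqrt K * elem_diam (M n) k ^ p"
      using scale_pos[OF x] by (simp add: real_sqrt_mult diam_def)
    finally show ?thesis .
  qed
  then show ?thesis using K(1) by (intro exI[of _ "sqrt K"]) auto
qed

end

section \<open>Summation over the elements\<close>

lemma measure_interior_ref_tri_pos: "0 < measure lebesgue (interior ref_tri)"
proof -
  have "interior ref_tri \<in> lmeasurable"
    using compact_imp_bounded[OF compact_ref_tri] by (rule lmeasurable_interior)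
  moreover have "\<not> negligible (interior ref_tri)"
    using interior_ref_tri open_not_negligible[of "interior ref_tri"] by simp
  ultimately show ?thesis using negligible_iff_measure zero_less_measure_iff by blast
qed

context regular_element begin

text \<open>Change of variables with \<open>jac\<close> at least \<open>h ^ 2 / C\<close>. The open
  triangle is used because a mesh provides disjointness of interiors only.\<close>

lemma measure_elem_ge:
  shows "emap M k ` interior ref_tri \<in> lmeasurable"
    and "h\<^sup>2 / C * measure lebesgue (interior ref_tri) \<le> measure lebesgue (emap M k ` interior ref_tri)"
proof -
  let ?S = "interior ref_tri"
  let ?f' = "\<lambda>z v. \<chi> c. \<Sum>d\<in>UNIV. metric_term M k c d z * v $ d"
  have inj': "inj_on (emap M k) ?S" using inj interior_subset by (rule inj_on_subset)
  have S: "?S \<in> lmeasurable"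
    using compact_imp_bounded[OF compact_ref_tri] by (rule lmeasurable_interior)
  have "open (emap M k ` ?S)"
    by (intro invariance_of_domain emap_continuous inj') simp
  moreover have "bounded (emap M k ` ?S)"
    using compact_imp_bounded[OF compact_elem] interior_subset unfolding elem_def
    by (meson bounded_subset image_mono)
  ultimately show E: "emap M k ` ?S \<in> lmeasurable" by (simp add: lmeasurable_open)
  have det: "det (matrix (?f' z)) = jac M k z" for z
    by (simp add: det_2 matrix_def jac_def axis_def if_distrib cong: if_cong)
  have "((\<lambda>z. \<bar>det (matrix (?f' z))\<bar>) has_integral measure lebesgue (emap M k ` ?S)) ?S"
    using has_measure_differentiable_image[of ?S "emap M k" ?f' "measure lebesgue (emap M k ` ?S)"]
      S E inj' emap_has_derivative by (auto simp: fmeasurable_def)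
  then have I: "((\<lambda>z. \<bar>jac M k z\<bar>) has_integral measure lebesgue (emap M k ` ?S)) ?S"
    by (simp add: det)
  have "((\<lambda>_. 1::real) has_integral measure lebesgue ?S) ?S"
    using S lmeasure_integral[OF S] integrable_on_const[OF S, of "1::real"] by (simp add: has_integral_integral)
  then have "((\<lambda>_. h\<^sup>2 / C * 1) has_integral h\<^sup>2 / C * measure lebesgue ?S) ?S"
    by (rule has_integral_mult_right)
  then show "h\<^sup>2 / C * measure lebesgue ?S \<le> measure lebesgue (emap M k ` ?S)"
  proof (rule has_integral_le[OF _ I])
    fix z assume "z \<in> ?S"
    then have "z \<in> ref_tri" using interior_subset by blast
    from jac_ge[OF this] jac_pos[OF this] show "h\<^sup>2 / C * 1 \<le> \<bar>jac M k z\<bar>"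
      using C_pos by (simp add: field_simps)
  qed
qed

end

text \<open>A packing argument: the images of the open triangle are disjoint parts of
  \<open>\<Omega>\<close>, each with area at least a fixed multiple of the squared diameter.\<close>

lemma sum_diam_squared_le:
  assumes mesh: "is_mesh pmap \<Omega> \<Gamma>D \<Gamma>N M" and reg: "regular_mesh C M" and "compact \<Omega>" "0 < C"
  shows "(\<Sum>k\<in>elems M. (elem_diam M k)\<^sup>2) \<le> C * measure lebesgue \<Omega> / measure lebesgue (interior ref_tri)"
proof -
  let ?E = "\<lambda>k. emap M k ` interior ref_tri"
  let ?m = "measure lebesgue (interior ref_tri)"
  have re: "regular_element M k C" if "k \<in> elems M" for k
    by (rule is_mesh_regular_element[OF mesh reg that])
  have E: "?E k \<in> lmeasurable" if "k \<in> elems M" for k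
    using regular_element.measure_elem_ge(1)[OF re[OF that]] .
  have sub: "?E k \<subseteq> interior (elem M k)" if "k \<in> elems M" for k
  proof -
    interpret regular_element M k C by (rule re[OF that])
    have "open (?E k)"
      using inj interior_subset by (intro invariance_of_domain emap_continuous) (auto intro: inj_on_subset)
    then show ?thesis unfolding elem_def using interior_subset by (intro interior_maximal) auto
  qed
  have "?m * (\<Sum>k\<in>elems M. (elem_diam M k)\<^sup>2) = C * (\<Sum>k\<in>elems M. (elem_diam M k)\<^sup>2 / C * ?m)"
    using \<open>0 < C\<close> by (simp add: sum_distrib_left mult_ac)
  also have "(\<Sum>k\<in>elems M. (elem_diam M k)\<^sup>2 / C * ?m) \<le> (\<Sum>k\<in>elems M. measure lebesgue (?E k))"
    by (intro sum_mono regular_element.measure_elem_ge(2)[OF re])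
  also have "\<dots> = measure lebesgue (\<Union>k\<in>elems M. ?E k)"
  proof (rule measure_finite_Union[symmetric])
    show "finite (elems M)" by (rule is_meshD(1)[OF mesh])
    show "?E ` elems M \<subseteq> sets lebesgue" using E by (auto dest: fmeasurableD)
    show "disjoint_family_on ?E (elems M)"
      unfolding disjoint_family_on_def using sub is_meshD(3)[OF mesh] by blast
    show "emeasure lebesgue (?E k) \<noteq> \<infinity>" if "k \<in> elems M" for k
      using fmeasurableD2[OF E[OF that]] by simp
  qed
  also have "\<dots> \<le> measure lebesgue \<Omega>"
  proof (rule measure_mono_fmeasurable)
    show "(\<Union>k\<in>elems M. ?E k) \<subseteq> \<Omega>"
      using sub interior_subset is_meshD(2)[OF mesh] by blast
    show "(\<Union>k\<in>elems M. ?E k) \<in> sets lebesgue"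
      using is_meshD(1)[OF mesh] E by (intro sets.finite_UN) (auto dest: fmeasurableD)
    show "\<Omega> \<in> lmeasurable" using \<open>compact \<Omega>\<close> by (rule lmeasurable_compact)
  qed
  finally have "?m * (\<Sum>k\<in>elems M. (elem_diam M k)\<^sup>2) \<le> C * measure lebesgue \<Omega>"
    using \<open>0 < C\<close> by (simp add: mult_left_mono)
  then show ?thesis using measure_interior_ref_tri_pos by (simp add: field_simps)
qed

text \<open>Two powers are spent on the area sum; each of the others is bounded by the mesh
  size.\<close>

lemma sum_diam_power_le:
  assumes mesh: "is_mesh pmap \<Omega> \<Gamma>D \<Gamma>N M" and reg: "regular_mesh C M"
    and sum: "(\<Sum>k\<in>elems M. (elem_diam M k)\<^sup>2) \<le> A"
    and "elems M \<noteq> {}"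
  shows "(\<Sum>k\<in>elems M. elem_diam M k ^ (r + 2)) \<le> mesh_size M ^ r * A"
proof -
  have h: "0 < elem_diam M k" "elem_diam M k \<le> mesh_size M" if "k \<in> elems M" for k
    using regular_element.h_pos[OF is_mesh_regular_element[OF mesh reg that]] is_meshD(1)[OF mesh] that
    by (auto simp: mesh_size_def)
  have "(\<Sum>k\<in>elems M. elem_diam M k ^ (r + 2)) \<le> (\<Sum>k\<in>elems M. mesh_size M ^ r * (elem_diam M k)\<^sup>2)"
    unfolding power_add using h by (intro sum_mono mult_right_mono power_mono) (auto intro: less_imp_le)
  also have "\<dots> = mesh_size M ^ r * (\<Sum>k\<in>elems M. (elem_diam M k)\<^sup>2)" by (simp add: sum_distrib_left)
  also have "\<dots> \<le> mesh_size M ^ r * A"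
  proof (intro mult_left_mono sum zero_le_power)
    obtain k where "k \<in> elems M" using \<open>elems M \<noteq> {}\<close> by blast
    with h[OF this] show "0 \<le> mesh_size M" by linarith
  qed
  finally show ?thesis .
qed

theorem theorem4:
  fixes \<Omega> \<Gamma>D \<Gamma>N :: "(real^2) set"
    and lam :: "real^2 \<Rightarrow> real^2^2"
    and G \<psi>D \<psi>N \<psi> :: "real^2 \<Rightarrow> real"
    and p pmap :: nat
    and S :: "('n::finite, 'f::finite) sbp"
    and M :: "nat \<Rightarrow> mesh"
    and T :: "nat \<Rightarrow> 'f sat"
  assumes "compact \<Omega>" and "frontier \<Omega> = \<Gamma>D \<union> \<Gamma>N" and "\<Gamma>D \<noteq> {}"
    and "spd_tensor \<Omega> lam"
    and "\<And>n k c d. k \<in> elems (M n) \<Longrightarrow> Ck_on p (elem (M n) k) (\<lambda>x. lam x $ c $ d)"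
    and "solves_diffusion \<Omega> \<Gamma>D \<Gamma>N lam G \<psi>D \<psi>N \<psi>"
    and "1 \<le> p" and "pmap \<le> p + 1"
    and "sbp_operator p S"
    and "\<And>n. is_mesh pmap \<Omega> \<Gamma>D \<Gamma>N (M n)"
    and "(\<lambda>n. mesh_size (M n)) \<longlonglongrightarrow> 0"
    and "\<exists>C. \<forall>n. regular_mesh C (M n)"
    and "\<And>n. sat_symmetric (M n) (T n)"
    and "\<exists>C. \<forall>n. sat_scaled C (M n) (T n)"
    and "\<And>n k. k \<in> elems (M n) \<Longrightarrow> Ck_on (p + 1) (elem (M n) k) \<psi>"
    and "\<And>n. sat_adjoint_conditions S (M n) (T n)"
  shows "(3 \<le> p \<longrightarrow>
           (\<lambda>n. \<Sum>k\<in>elems (M n). hnorm (Hk S (M n) k) (adj_residual S (M n) (T n) \<Omega> lam G \<psi> k))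
             \<longlonglongrightarrow> 0) \<and>
         (2 \<le> p \<longrightarrow>
           (\<lambda>n. sqrt (\<Sum>k\<in>elems (M n).
                  (hnorm (Hk S (M n) k) (adj_residual S (M n) (T n) \<Omega> lam G \<psi> k))\<^sup>2))
             \<longlonglongrightarrow> 0) \<and>
         (\<exists>C. \<forall>\<^sub>F n in sequentially. \<forall>k\<in>elems (M n).
           infnorm (adj_residual S (M n) (T n) \<Omega> lam G \<psi> k) \<le> C * elem_diam (M n) k ^ (p - 1))"
proof -
  obtain C where reg: "\<And>n. regular_mesh C (M n)" using assms(12) by blast
  obtain B where scaled: "\<And>n. sat_scaled B (M n) (T n)" using assms(14) by blast
  note mesh = assms(10)
  \<comment> \<open>\<open>\<Gamma>D\<close> is a union of element facets and nonempty, so every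
    mesh has an element; this makes the maximum in \<open>mesh_size\<close> meaningful and yields
    \<open>0 < C\<close> below.\<close>
  have ne: "elems (M n) \<noteq> {}" for n
    using assms(3) is_meshD(7)[OF mesh[of n]] by blast
  interpret adjoint_problem S p M C pmap \<Omega> \<Gamma>D \<Gamma>N lam G \<psi>D \<psi>N \<psi> T B
  proof (intro adjoint_problem.intro adjoint_problem_axioms.intro mesh_family.intro)
    show "regular_element (M n) k C" if "k \<in> elems (M n)" for n k
      by (rule is_mesh_regular_element[OF mesh reg that])
  qed (fact assms mesh reg scaled)+
  obtain k where "k \<in> elems (M 0)" using ne by blast
  then have C: "0 < C" by (rule regular_element.C_pos[OF regular])
  define A where "A = C * measure lebesgue \<Omega> / measure lebesgue (interior ref_tri)"
  have sum2: "(\<Sum>k\<in>elems (M n). (elem_diam (M n) k)\<^sup>2) \<le> A" for n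
    unfolding A_def by (rule sum_diam_squared_le[OF mesh reg assms(1) C])
  let ?e = "\<lambda>n k. hnorm (Hk S (M n) k) (adj_residual S (M n) (T n) \<Omega> lam G \<psi> k)"
  obtain K where K: "0 \<le> K" "\<And>n k. k \<in> elems (M n) \<Longrightarrow> ?e n k \<le> K * elem_diam (M n) k ^ p"
    using hnorm_residual_le by blast
  have e: "0 \<le> ?e n k" if "k \<in> elems (M n)" for n k
  proof -
    have "0 \<le> adj_residual S (M n) (T n) \<Omega> lam G \<psi> k \<bullet> (Hk S (M n) k *v adj_residual S (M n) (T n) \<Omega> lam G \<psi> k)"
      unfolding Hk_eq[of "(n, k)", simplified] inner_vec_def diag_vector_mult
      using sbp_operatorD(2)[OF sbp, THEN less_imp_le] by (intro sum_nonneg) (auto simp: mult.left_commute intro!: mult_nonneg_nonneg)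
    then show ?thesis by (simp add: hnorm_def)
  qed
  \<comment> \<open>The lower bounds on \<open>p\<close> enter through \<open>0 < r\<close>, used
    with \<open>p - 2\<close> and with \<open>2 * p - 2\<close>.\<close>
  have lim: "(\<lambda>n. c * (mesh_size (M n) ^ r * A)) \<longlonglongrightarrow> 0" if "0 < r" for c r
  proof -
    have "(\<lambda>n. c * (mesh_size (M n) ^ r * A)) \<longlonglongrightarrow> c * (0 ^ r * A)"
      by (intro tendsto_intros assms(11))
    moreover have "c * (0 ^ r * A) = 0" using that by (simp add: zero_power)
    ultimately show ?thesis by metis
  qed
  have "(\<lambda>n. \<Sum>k\<in>elems (M n). ?e n k) \<longlonglongrightarrow> 0" if "3 \<le> p"
  proof (rule tendsto_sandwich[OF _ _ tendsto_const lim[of "p - 2" K]])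
    show "\<forall>\<^sub>F n in sequentially. 0 \<le> (\<Sum>k\<in>elems (M n). ?e n k)"
      using e by (intro always_eventually allI sum_nonneg)
    have "(\<Sum>k\<in>elems (M n). ?e n k) \<le> K * (mesh_size (M n) ^ (p - 2) * A)" for n
    proof -
      have p: "p - 2 + 2 = p" using that by simp
      have "(\<Sum>k\<in>elems (M n). ?e n k) \<le> K * (\<Sum>k\<in>elems (M n). elem_diam (M n) k ^ p)"
        unfolding sum_distrib_left by (intro sum_mono K)
      also have "\<dots> \<le> K * (mesh_size (M n) ^ (p - 2) * A)"
        using sum_diam_power_le[OF mesh reg sum2 ne, of n "p - 2", unfolded p] K(1) by (intro mult_left_mono)
      finally show ?thesis .
    qed
    then show "\<forall>\<^sub>F n in sequentially. (\<Sum>k\<in>elems (M n). ?e n k) \<le> K * (mesh_size (M n) ^ (p - 2) * A)"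
      by simp
  qed (use that in simp)
  moreover have "(\<lambda>n. sqrt (\<Sum>k\<in>elems (M n). (?e n k)\<^sup>2)) \<longlonglongrightarrow> 0" if "2 \<le> p"
  proof -
    have "(\<lambda>n. \<Sum>k\<in>elems (M n). (?e n k)\<^sup>2) \<longlonglongrightarrow> 0"
    proof (rule tendsto_sandwich[OF _ _ tendsto_const lim[of "2 * p - 2" "K\<^sup>2"]])
      have "(\<Sum>k\<in>elems (M n). (?e n k)\<^sup>2) \<le> K\<^sup>2 * (mesh_size (M n) ^ (2 * p - 2) * A)" for n
      proof -
        have p: "2 * p - 2 + 2 = 2 * p" using that by simp
        have "(\<Sum>k\<in>elems (M n). (?e n k)\<^sup>2) \<le> (\<Sum>k\<in>elems (M n). (K * elem_diam (M n) k ^ p)\<^sup>2)"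
          by (intro sum_mono power_mono K e)
        also have "\<dots> = K\<^sup>2 * (\<Sum>k\<in>elems (M n). elem_diam (M n) k ^ (2 * p))"
          by (simp add: sum_distrib_left power_mult_distrib power_mult[symmetric] mult.commute)
        also have "\<dots> \<le> K\<^sup>2 * (mesh_size (M n) ^ (2 * p - 2) * A)"
          using sum_diam_power_le[OF mesh reg sum2 ne, of n "2 * p - 2", unfolded p] by (intro mult_left_mono) simp_all
        finally show ?thesis .
      qed
      then show "\<forall>\<^sub>F n in sequentially. (\<Sum>k\<in>elems (M n). (?e n k)\<^sup>2) \<le> K\<^sup>2 * (mesh_size (M n) ^ (2 * p - 2) * A)"
        by simp
    qed (use that in \<open>auto intro!: always_eventually sum_nonneg\<close>)
    from tendsto_real_sqrt[OF this] show ?thesis by simp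
  qed
  moreover obtain L where "\<forall>n. \<forall>k\<in>elems (M n).
      infnorm (adj_residual S (M n) (T n) \<Omega> lam G \<psi> k) \<le> L * elem_diam (M n) k ^ (p - 1)"
    using infnorm_residual_le by blast
  then have "\<forall>\<^sub>F n in sequentially. \<forall>k\<in>elems (M n).
      infnorm (adj_residual S (M n) (T n) \<Omega> lam G \<psi> k) \<le> L * elem_diam (M n) k ^ (p - 1)"
    by (rule always_eventually)
  ultimately show ?thesis by blast
qed

end
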